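(* Let $M\in\mathbb{Z}_{\ge2}$ and let $m\in\mathbb{Z}_{\ge0}$ be such that $\gcd(M,2m+2)=1$ if $m>0$. Let $c=3\big(1-\frac{2m+2}{M}\big)$, let $s\in\mathbb{Z}$ with $0\le s\le m$, and let $\epsilon,\epsilon'\in\{0,\frac12\}$. Put $$\Omega^{(M)}_{\epsilon}=\{(j,k)\in(\epsilon+\mathbb{Z}_{\ge0})^2\mid j+k\le M-1,\ j>0\}.$$ Then for $(j,k)\in\Omega^{(M)}_{\epsilon'}$ the modified $N=2$ (super)characters satisfy $$\widetilde{ch}^{N=2[M,m,s;\epsilon]}_{j,k;\epsilon'}\Big(-\frac1\tau,\frac z\tau\Big)=e^{\frac{\pi i c}{3\tau}z^2}\sum_{(a,b)\in\Omega^{(M)}_{\epsilon}}S^{[M,m,\epsilon,\epsilon']}_{(j,k),(a,b)}\,\widetilde{ch}^{N=2[M,m,s;\epsilon']}_{a,b;\epsilon}(\tau,z),$$ where $$S^{[M,m,\epsilon,\epsilon']}_{(j,k),(a,b)}=(-i)^{(1-2\epsilon)(1-2\epsilon')}\,\frac2M\,e^{\frac{\pi i(m+1)}{M}(j-k)(a-b)}\sin\Big(\frac{m+1}{M}(j+k)(a+b)\pi\Big),$$ and $$\widetilde{ch}^{N=2[M,m,s;\epsilon]}_{j,k;\epsilon'}(\tau+1,z)=e^{\frac{2\pi i(m+1)}{M}jk-\frac{\pi i\epsilon'}{2}}\,\widetilde{ch}^{N=2[M,m,s;|\epsilon-\epsilon'|]}_{j,k;\epsilon'}(\tau,z).$$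
   Context: Variables: $\tau,z,z_1,z_2,t\in\mathbb{C}$, $\mathrm{Im}\,\tau>0$, $q^r=e^{2\pi i r\tau}$. All identities are identities of functions away from poles. For integers $m\ge0$, $0\le s\le m$ and $j\in\mathbb{Z}$ put $\Theta_{j,m+1}(\tau,z)=\sum_{n\in\mathbb{Z}}e^{2\pi i(m+1)z(n+\frac{j}{2(m+1)})}q^{(m+1)(n+\frac{j}{2(m+1)})^2}$, $$\Phi_1^{[m;s]}(\tau,z_1,z_2)=\sum_{j\in\mathbb{Z}}\frac{e^{2\pi i(m+1)j(z_1+z_2)}e^{-2\pi i s z_1}q^{j^2(m+1)-js}}{1-e^{2\pi i z_1}q^j},$$ $$\Phi^{[m;s]}(\tau,z_1,z_2,t)=e^{2\pi i(m+1)t}\big(\Phi_1^{[m;s]}(\tau,z_1,z_2)-\Phi_1^{[m;s]}(\tau,-z_2,-z_1)\big).$$ With $E(x)=2\int_0^xe^{-\pi u^2}du$, put $$R_{j;m+1}(\tau,v)=\sum_{\substack{n\in\mathbb{Z}\\ n\equiv-j\ \mathrm{mod}\ 2(m+1)}}\Big(\mathrm{sgn}\big(n+\tfrac12+j-2(m+1)\big)-E\Big(\big(n+2(m+1)\tfrac{\mathrm{Im}\,v}{\mathrm{Im}\,\tau}\big)\sqrt{\tfrac{\mathrm{Im}\,\tau}{m+1}}\Big)\Big)e^{-\frac{\pi i n^2}{2(m+1)}\tau-2\pi i nv},$$ $$\Phi^{[m;s]}_{\rm add}(\tau,z_1,z_2,t)=\tfrac12e^{2\pi i(m+1)t}\sum_{j=-s}^{-s+2m+1}R_{j;m+1}\big(\tau,\tfrac{z_1-z_2}{2}\big)\,(\Theta_{j,m+1}-\Theta_{-j,m+1})(\tau,z_1+z_2),$$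 and $\widetilde\Phi^{[m;s]}=\Phi^{[m;s]}+\Phi^{[m;s]}_{\rm add}$. For $\epsilon,\epsilon'\in\{0,\frac12\}$ and $a,b\in\epsilon'+\mathbb{Z}$ put $$\widetilde\Psi^{[M,m,s;\epsilon]}_{a,b;\epsilon'}(\tau,z_1,z_2,t)=q^{\frac{(m+1)ab}{M}}e^{\frac{2\pi i(m+1)}{M}(bz_1+az_2)}\,\widetilde\Phi^{[m;s]}\big(M\tau,z_1+a\tau+\epsilon,z_2+b\tau+\epsilon,\tfrac tM\big).$$ Jacobi theta functions ($a,b\in\{0,1\}$): $\vartheta_{ab}(\tau,z)=\sum_{n\in\mathbb{Z}}e^{\pi i\tau(n+\frac a2)^2+2\pi i(n+\frac a2)(z+\frac b2)}$; $\eta(\tau)=q^{1/24}\prod_{n\ge1}(1-q^n)$. The $N=2$ normalized denominators ($\epsilon=\frac12$) and superdenominators ($\epsilon=0$), in the Neveu-Schwarz ($\epsilon'=\frac12$) and Ramond ($\epsilon'=0$) sectors, are $$\overset{2}{R}{}^{(\epsilon)}_{\epsilon'}(\tau,z)=\frac{(-1)^{(1-2\epsilon)(1-2\epsilon')}\,\eta(\tau)^3}{\vartheta_{1-2\epsilon',1-2\epsilon}(\tau,z)}.$$ The modified $N=2$ characters ($\epsilon=\frac12$) and supercharacters ($\epsilon=0$) (of modules of central charge $c$ over the $N=2$ superconformal algebra) are defined by $$\overset{2}{R}{}^{(\epsilon)}_{\epsilon'}(\tau,z)\,\widetilde{ch}^{N=2[M,m,s;\epsilon]}_{j,k;\epsilon'}(\tau,z)=\widetilde\Psi^{[M,m,s;\epsilon]}_{j,k;\epsilon'}(\tau,-z,z,0),\qquad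 (j,k)\in\Omega^{(M)}_{\epsilon'}.$$ *)

theory Defs
  imports "HOL-Analysis.Analysis" "HOL-Number_Theory.Cong"
begin

text \<open>
  Sums over the integers are unconditional sums (\<open>infsum\<close>); away from the poles all the
  series below converge absolutely when \<open>Im \<tau> > 0\<close>. The half-integral parameters
  \<open>\<epsilon>\<close>, \<open>\<epsilon>'\<close> and the indices lying in \<open>\<epsilon>' + \<int>\<close> are represented by reals.
\<close>

definition e2pi :: "complex \<Rightarrow> complex" where
  "e2pi w = exp (2 * of_real pi * \<i> * w)"

definition qpow :: "complex \<Rightarrow> real \<Rightarrow> complex" where
  "qpow \<tau> r = e2pi (of_real r * \<tau>)"

definition Theta :: "int \<Rightarrow> nat \<Rightarrow> complex \<Rightarrow> complex \<Rightarrow> complex" where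
  "Theta j N \<tau> z =
     (\<Sum>\<^sub>\<infinity>n::int. let x = of_int n + of_int j / (2 * real N)
        in e2pi (of_nat N * z * of_real x) * qpow \<tau> (real N * x\<^sup>2))"

definition Phi1 :: "nat \<Rightarrow> nat \<Rightarrow> complex \<Rightarrow> complex \<Rightarrow> complex \<Rightarrow> complex" where
  "Phi1 m s \<tau> z1 z2 =
     (\<Sum>\<^sub>\<infinity>j::int. e2pi (of_nat (m + 1) * of_int j * (z1 + z2)) * e2pi (- (of_nat s * z1))
         * qpow \<tau> ((of_int j)\<^sup>2 * real (m + 1) - of_int j * real s)
       / (1 - e2pi z1 * qpow \<tau> (of_int j)))"

definition Phi :: "nat \<Rightarrow> nat \<Rightarrow> complex \<Rightarrow> complex \<Rightarrow> complex \<Rightarrow> complex \<Rightarrow> complex" where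
  "Phi m s \<tau> z1 z2 t =
     e2pi (of_nat (m + 1) * t) * (Phi1 m s \<tau> z1 z2 - Phi1 m s \<tau> (- z2) (- z1))"

text \<open>The oriented interval integral is used because \<open>x\<close> may be negative.\<close>

definition Efun :: "real \<Rightarrow> real" where
  "Efun x = 2 * (LBINT u=0..ereal x. exp (- pi * u\<^sup>2))"

definition Rfun :: "int \<Rightarrow> nat \<Rightarrow> complex \<Rightarrow> complex \<Rightarrow> complex" where
  "Rfun j N \<tau> v =
     (\<Sum>\<^sub>\<infinity>n\<in>{n::int. [n = - j] (mod 2 * int N)}.
        of_real (sgn (of_int n + 1 / 2 + of_int j - 2 * real N)
           - Efun ((of_int n + 2 * real N * Im v / Im \<tau>) * sqrt (Im \<tau> / real N)))
        * exp (- (of_real pi * \<i> * (of_int n)\<^sup>2 / (2 * of_nat N) * \<tau>)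
               - 2 * of_real pi * \<i> * of_int n * v))"

definition Phi_add :: "nat \<Rightarrow> nat \<Rightarrow> complex \<Rightarrow> complex \<Rightarrow> complex \<Rightarrow> complex \<Rightarrow> complex" where
  "Phi_add m s \<tau> z1 z2 t =
     1 / 2 * e2pi (of_nat (m + 1) * t) *
     (\<Sum>j = - int s..- int s + 2 * int m + 1.
        Rfun j (m + 1) \<tau> ((z1 - z2) / 2)
        * (Theta j (m + 1) \<tau> (z1 + z2) - Theta (- j) (m + 1) \<tau> (z1 + z2)))"

definition Phi_mod :: "nat \<Rightarrow> nat \<Rightarrow> complex \<Rightarrow> complex \<Rightarrow> complex \<Rightarrow> complex \<Rightarrow> complex" where
  "Phi_mod m s \<tau> z1 z2 t = Phi m s \<tau> z1 z2 t + Phi_add m s \<tau> z1 z2 t"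

definition Psi_mod ::
  "nat \<Rightarrow> nat \<Rightarrow> nat \<Rightarrow> real \<Rightarrow> real \<Rightarrow> real \<Rightarrow> complex \<Rightarrow> complex \<Rightarrow> complex \<Rightarrow> complex \<Rightarrow> complex" where
  "Psi_mod M m s \<epsilon> a b \<tau> z1 z2 t =
     qpow \<tau> (real (m + 1) * a * b / real M)
     * e2pi (of_nat (m + 1) / of_nat M * (of_real b * z1 + of_real a * z2))
     * Phi_mod m s (of_nat M * \<tau>) (z1 + of_real a * \<tau> + of_real \<epsilon>)
         (z2 + of_real b * \<tau> + of_real \<epsilon>) (t / of_nat M)"

text \<open>Only the characteristics \<open>a, b \<in> {0, 1}\<close> are used.\<close>

definition jacobi_theta :: "real \<Rightarrow> real \<Rightarrow> complex \<Rightarrow> complex \<Rightarrow> complex" where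
  "jacobi_theta a b \<tau> z =
     (\<Sum>\<^sub>\<infinity>n::int. exp (of_real pi * \<i> * \<tau> * (of_int n + of_real a / 2)\<^sup>2
        + 2 * of_real pi * \<i> * (of_int n + of_real a / 2) * (z + of_real b / 2)))"

definition dedekind_eta :: "complex \<Rightarrow> complex" where
  "dedekind_eta \<tau> = qpow \<tau> (1 / 24) * (\<Prod>n::nat. 1 - qpow \<tau> (real (n + 1)))"

text \<open>
  The exponent \<open>(1 - 2\<epsilon>)(1 - 2\<epsilon>')\<close> is 0 or 1, so no choice of branch is involved in \<open>powr\<close>,
  here and in \<open>S_matrix\<close>.
\<close>

definition N2_denom :: "real \<Rightarrow> real \<Rightarrow> complex \<Rightarrow> complex \<Rightarrow> complex" where
  "N2_denom \<epsilon> \<epsilon>' \<tau> z =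
     (- 1) powr of_real ((1 - 2 * \<epsilon>) * (1 - 2 * \<epsilon>')) * dedekind_eta \<tau> ^ 3
     / jacobi_theta (1 - 2 * \<epsilon>') (1 - 2 * \<epsilon>) \<tau> z"

text \<open>
  The modified (super)character is the solution \<open>ch\<close> of
  \<open>N2_denom \<epsilon> \<epsilon>' \<tau> z * ch = Psi_mod M m s \<epsilon> j k \<tau> (- z) z 0\<close>.
\<close>

definition N2_ch ::
  "nat \<Rightarrow> nat \<Rightarrow> nat \<Rightarrow> real \<Rightarrow> real \<Rightarrow> real \<Rightarrow> real \<Rightarrow> complex \<Rightarrow> complex \<Rightarrow> complex" where
  "N2_ch M m s \<epsilon> j k \<epsilon>' \<tau> z =
     Psi_mod M m s \<epsilon> j k \<tau> (- z) z 0 / N2_denom \<epsilon> \<epsilon>' \<tau> z"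

text \<open>
  The zeros of \<open>jacobi_theta (1 - 2 * \<epsilon>') (1 - 2 * \<epsilon>) \<tau>\<close>, that is, the poles of
  \<open>N2_denom \<epsilon> \<epsilon>' \<tau>\<close>. For \<open>j, k \<in> \<epsilon>' + \<int>\<close> this set contains every \<open>z\<close> at which a denominator
  in \<open>Psi_mod M m s \<epsilon> j k \<tau> (- z) z 0\<close> vanishes.
\<close>

definition N2_poles :: "real \<Rightarrow> real \<Rightarrow> complex \<Rightarrow> complex set" where
  "N2_poles \<epsilon> \<epsilon>' \<tau> =
     {(of_real \<epsilon>' + of_int p) * \<tau> + of_real \<epsilon> + of_int r | p r :: int. True}"

definition Omega :: "nat \<Rightarrow> real \<Rightarrow> (real \<times> real) set" where
  "Omega M \<epsilon> =
     {(j, k). (\<exists>p::nat. j = \<epsilon> + real p) \<and> (\<exists>r::nat. k = \<epsilon> + real r)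
        \<and> j + k \<le> real M - 1 \<and> j > 0}"

definition S_matrix ::
  "nat \<Rightarrow> nat \<Rightarrow> real \<Rightarrow> real \<Rightarrow> real \<times> real \<Rightarrow> real \<times> real \<Rightarrow> complex" where
  "S_matrix M m \<epsilon> \<epsilon>' = (\<lambda>(j, k) (a, b).
     (- \<i>) powr of_real ((1 - 2 * \<epsilon>) * (1 - 2 * \<epsilon>')) * (2 / of_nat M)
     * exp (of_real pi * \<i> * of_nat (m + 1) / of_nat M * of_real ((j - k) * (a - b)))
     * of_real (sin (real (m + 1) / real M * (j + k) * (a + b) * pi)))"

end

theory Submission
  imports Defs "HOL-Complex_Analysis.Complex_Analysis" "HOL-Probability.Distributions"
begin

text \<open>
  Up to an exponential factor the numerator of a character is a difference of two values of one
  function, the completed Appell function \<open>capp N s \<tau> z1 z2\<close> of degree \<open>N = m + 1\<close>: a Lerch sum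
  \<open>appell\<close> plus a nonholomorphic correction \<open>corr\<close>. Indeed \<open>Phi_mod\<close> is its antisymmetrization under
  \<open>(z1, z2) \<mapsto> (- z2, - z1)\<close> (\<open>Phi_mod_eq_capp\<close>). Three properties of \<open>capp\<close> carry the proof.

  First, \<open>capp\<close> does not depend on the integer \<open>s\<close> (\<open>capp_indep\<close>): raising \<open>s\<close> adds a theta series
  to \<open>appell\<close> and removes the same one from \<open>corr\<close>. A translation of \<open>z1\<close> and \<open>z2\<close> by multiples of
  \<open>\<tau>\<close> only shifts \<open>s\<close>, so \<open>capp\<close> transforms by an exponential factor, as a theta function does
  (\<open>capp_add_tau\<close>).

  Secondly, if \<open>N\<close> is coprime to \<open>M\<close>, then \<open>capp\<close> at \<open>\<tau> / M\<close> is a sum of \<open>M\<^sup>2\<close> translates of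
  \<open>capp\<close> at \<open>M * \<tau>\<close>, with exponential factors (\<open>capp_level\<close>). This comes from
  \<open>1 / (1 - X) = (\<Sum>k<M. X ^ k) / (1 - X ^ M)\<close> and a different choice of \<open>s\<close> in every summand.

  Thirdly, there is the inversion formula \<open>capp_inversion\<close>. Fix \<open>u = z1 + z2\<close> and let \<open>D\<close> be the
  difference of its two sides as a function of \<open>z1\<close>. The antiholomorphic derivative of \<open>corr\<close> is,
  up to elementary factors, a pairing \<open>dbar_theta\<close> of a complex conjugate vector of theta functions
  with another one. Both vectors transform under inversion by the same matrix, which is unitary up
  to a factor; this preserves the pairing (\<open>dbar_theta_inversion\<close>), and \<open>D\<close> is holomorphic away
  from the poles. The residues of the two sides agree (\<open>appell_residue\<close>), so that \<open>D\<close> is entire;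
  under translations by the lattice it behaves like a section of a line bundle of negative degree,
  and therefore it vanishes (\<open>negative_degree_eq_0\<close>, by Liouville's theorem).

  The inversion formula \<open>theta0_inversion\<close> of the theta function itself is proved by a similar
  uniqueness argument, which needs the zeros of \<open>theta0\<close>; the Jacobi triple product
  (\<open>theta0_eq_product\<close>) supplies them. It also exhibits \<open>\<eta>\<^sup>3\<close> as the derivative at 0 of the odd theta
  function, so that the multiplier \<open>theta0_mult\<close> cancels in the inversion of the denominators
  (\<open>N2_denom_inversion\<close>). Its modulus, which enters \<open>dbar_theta_inversion\<close>, follows from
  the heat equation (\<open>theta0_mult_square\<close>).

  The second and third properties express \<open>Psi_mod\<close> at \<open>- 1 / \<tau>\<close> as a sum over all pairs of
  residues modulo \<open>M\<close>. Its summands are periodic, and the antisymmetry of \<open>Psi_mod\<close> under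
  \<open>(a, b) \<mapsto> (- b, - a)\<close> folds it to a sum over \<open>Omega\<close> (\<open>sum_box_eq_sum_Omega\<close>); the two phases of
  each orbit combine to the sine in \<open>S_matrix\<close>. The translation \<open>\<tau> \<mapsto> \<tau> + 1\<close> can be read off
  the series term by term.
\<close>

section \<open>The exponential function with period 1\<close>

lemma e2pi_add: "e2pi (a + b) = e2pi a * e2pi b"
  by (simp add: e2pi_def exp_add distrib_left)

lemma e2pi_diff: "e2pi (a - b) = e2pi a / e2pi b"
  by (simp add: e2pi_def exp_diff right_diff_distrib)

lemma e2pi_0 [simp]: "e2pi 0 = 1"
  by (simp add: e2pi_def)

lemma e2pi_nonzero [simp]: "e2pi a \<noteq> 0"
  by (simp add: e2pi_def)

lemma e2pi_minus: "e2pi (- a) = inverse (e2pi a)"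
  by (simp add: e2pi_def exp_minus)

lemma e2pi_power: "e2pi a ^ n = e2pi (of_nat n * a)"
  by (simp add: e2pi_def exp_of_nat_mult [symmetric] mult_ac)

lemma norm_e2pi: "norm (e2pi a) = exp (- 2 * pi * Im a)"
  by (simp add: e2pi_def norm_exp_eq_Re)

lemma e2pi_eq_1_iff: "e2pi a = 1 \<longleftrightarrow> a \<in> \<int>"
proof
  assume "e2pi a = 1"
  then obtain n :: int where n: "Re (2 * of_real pi * \<i> * a) = 0" "Im (2 * of_real pi * \<i> * a) = of_int (2 * n) * pi"
    unfolding e2pi_def exp_eq_1 by auto
  then have "a = of_int n"
    by (auto simp: complex_eq_iff)
  then show "a \<in> \<int>" by simp
next
  assume "a \<in> \<int>"
  then obtain n :: int where "a = of_int n" by (elim Ints_cases)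
  then show "e2pi a = 1"
    unfolding e2pi_def exp_eq_1 by (intro conjI exI[of _ n]) auto
qed

lemma e2pi_of_int [simp]: "e2pi (of_int n) = 1"
  by (simp add: e2pi_eq_1_iff)

lemma e2pi_eqI: "a = b + of_int k \<Longrightarrow> e2pi a = e2pi b"
  by (simp add: e2pi_add)

lemma has_field_derivative_e2pi [derivative_intros]:
  assumes "(f has_field_derivative f') (at x within S)"
  shows "((\<lambda>x. e2pi (f x)) has_field_derivative 2 * of_real pi * \<i> * f' * e2pi (f x)) (at x within S)"
  unfolding e2pi_def by (rule derivative_eq_intros assms refl)+ simp

lemma holomorphic_e2pi [holomorphic_intros]:
  "f holomorphic_on S \<Longrightarrow> (\<lambda>x. e2pi (f x)) holomorphic_on S"
  unfolding e2pi_def by (intro holomorphic_intros)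

section \<open>Sums over the integers\<close>

lemma summable_exp_neg_abs: "(\<lambda>n::int. exp (- \<bar>real_of_int n\<bar>)) summable_on UNIV"
proof -
  have "summable (\<lambda>n::nat. exp (-1::real) ^ n)"
    by (rule summable_geometric) simp
  then have "summable (\<lambda>n::nat. exp (- real n))"
    by (simp add: exp_of_nat_mult [symmetric])
  then have s: "(\<lambda>n::nat. exp (- real n)) summable_on UNIV"
    by (simp add: summable_on_UNIV_nonneg_real_iff)
  have 1: "(\<lambda>n::int. exp (- \<bar>real_of_int n\<bar>)) summable_on range int"
    by (subst summable_on_reindex) (auto simp: o_def s)
  have 2: "(\<lambda>n::int. exp (- \<bar>real_of_int n\<bar>)) summable_on range (\<lambda>n. - int n)"
    by (subst summable_on_reindex) (auto simp: o_def s inj_on_def)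
  have "UNIV = range int \<union> range (\<lambda>n. - int n)"
    by (auto intro: int_cases2)
  then show ?thesis
    using summable_on_union[OF 1 2] by simp
qed

text \<open>Completing the square.\<close>

lemma gauss_le_exp_neg_abs:
  fixes a b x :: real
  assumes "a > 0"
  shows "exp (- a * x\<^sup>2 + b * \<bar>x\<bar>) \<le> exp ((b + 1)\<^sup>2 / (4 * a)) * exp (- \<bar>x\<bar>)"
proof -
  have "0 \<le> (2 * a * \<bar>x\<bar> - (b + 1))\<^sup>2 / (4 * a)"
    using assms by simp
  also have "\<dots> = a * x\<^sup>2 - (b + 1) * \<bar>x\<bar> + (b + 1)\<^sup>2 / (4 * a)"
    using assms by (simp add: power2_eq_square field_simps)
  finally have "- a * x\<^sup>2 + b * \<bar>x\<bar> \<le> (b + 1)\<^sup>2 / (4 * a) - \<bar>x\<bar>"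
    by (simp add: algebra_simps)
  then show ?thesis
    by (simp add: exp_add [symmetric])
qed

lemma summable_gauss:
  fixes a b :: real
  assumes "a > 0"
  shows "(\<lambda>n::int. exp (- a * (of_int n)\<^sup>2 + b * \<bar>of_int n\<bar>)) summable_on UNIV"
proof (rule summable_on_comparison_test)
  show "(\<lambda>n::int. exp ((b + 1)\<^sup>2 / (4 * a)) * exp (- \<bar>real_of_int n\<bar>)) summable_on UNIV"
    by (intro summable_on_cmult_right summable_exp_neg_abs)
qed (use gauss_le_exp_neg_abs[OF assms] in auto)

lemma summable_gauss_comparison:
  fixes f :: "int \<Rightarrow> complex" and a b K :: real
  assumes "a > 0" and "\<And>n. norm (f n) \<le> K * exp (- a * (of_int n)\<^sup>2 + b * \<bar>of_int n\<bar>)"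
  shows "f summable_on UNIV"
proof -
  have "(\<lambda>n. norm (f n)) summable_on UNIV"
    by (rule Infinite_Sum.abs_summable_on_comparison_test'[OF summable_on_cmult_right[OF summable_gauss[OF assms(1)]]])
       (use assms(2) in auto)
  then show ?thesis
    by (rule abs_summable_summable)
qed

lemma bij_betw_residues:
  fixes a c e K :: int
  assumes "K > 0" and "coprime c K"
  shows "bij_betw (\<lambda>d. (c * d + e) mod K) {a..<a + K} {0..<K}"
proof -
  let ?f = "\<lambda>d. (c * d + e) mod K"
  have inj: "inj_on ?f {a..<a + K}"
  proof (rule inj_onI)
    fix d d' assume d: "d \<in> {a..<a + K}" "d' \<in> {a..<a + K}" and "?f d = ?f d'"
    then have "K dvd c * (d - d')"
      by (simp add: mod_eq_dvd_iff algebra_simps)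
    then have "K dvd d - d'"
      using assms(2) by (simp add: coprime_commute coprime_dvd_mult_right_iff)
    moreover have "\<bar>d - d'\<bar> < K"
      using d by auto
    ultimately show "d = d'"
      using dvd_imp_le_int[of "d - d'" K] by force
  qed
  have "?f ` {a..<a + K} = {0..<K}"
    by (rule card_subset_eq) (use assms(1) in \<open>auto simp: card_image[OF inj]\<close>)
  with inj show ?thesis
    by (simp add: bij_betw_def)
qed

text \<open>Splitting the integers along a system of representatives \<open>r\<close> of the residues modulo \<open>M\<close>.\<close>

lemma infsum_residues:
  fixes f :: "int \<Rightarrow> complex" and r :: "'a \<Rightarrow> int"
  assumes "finite I" and "M > 0" and f: "f summable_on UNIV"
    and r: "bij_betw (\<lambda>d. r d mod int M) I {0..<int M}"
  shows "(\<Sum>\<^sub>\<infinity>n. f n) = (\<Sum>d\<in>I. \<Sum>\<^sub>\<infinity>k. f (int M * k + r d))"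
    and "d \<in> I \<Longrightarrow> (\<lambda>k. f (int M * k + r d)) summable_on UNIV"
proof -
  let ?g = "\<lambda>(d, k). int M * k + r d"
  have inj: "inj_on ?g (I \<times> UNIV)"
  proof (rule inj_onI, clarify)
    fix d d' k k' assume *: "d \<in> I" "d' \<in> I" "int M * k + r d = int M * k' + r d'"
    then have "(int M * k + r d) mod int M = (int M * k' + r d') mod int M"
      by simp
    then have "r d mod int M = r d' mod int M"
      by simp
    then have "d = d'"
      using r * by (auto simp: bij_betw_def inj_on_def)
    then show "d = d' \<and> k = k'"
      using * assms(2) by simp
  qed
  have surj: "?g ` (I \<times> UNIV) = UNIV"
  proof -
    have "n \<in> ?g ` (I \<times> UNIV)" for n
    proof -
      have "n mod int M \<in> (\<lambda>d. r d mod int M) ` I"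
        using r assms(2) by (auto simp: bij_betw_def)
      then obtain d where d: "d \<in> I" "n mod int M = r d mod int M"
        by auto
      then obtain k where "n - r d = int M * k"
        using mod_eq_dvd_iff by blast
      then show ?thesis
        using d by (intro image_eqI[of _ _ "(d, k)"]) auto
    qed
    then show ?thesis by blast
  qed
  have s: "(\<lambda>p. f (?g p)) summable_on I \<times> UNIV"
    using f summable_on_reindex_bij_betw[of ?g "I \<times> UNIV" UNIV f] inj surj
    by (simp add: bij_betw_def)
  have "(\<Sum>\<^sub>\<infinity>n. f n) = (\<Sum>\<^sub>\<infinity>p\<in>I \<times> UNIV. f (?g p))"
    using infsum_reindex_bij_betw[of ?g "I \<times> UNIV" UNIV f] inj surj
    by (simp add: bij_betw_def)
  also have "\<dots> = (\<Sum>\<^sub>\<infinity>d\<in>I. \<Sum>\<^sub>\<infinity>k. f (int M * k + r d))"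
    using infsum_Sigma'_banach[of "\<lambda>d k. f (int M * k + r d)" I "\<lambda>_. UNIV"] s
    by (simp add: case_prod_unfold)
  also have "\<dots> = (\<Sum>d\<in>I. \<Sum>\<^sub>\<infinity>k. f (int M * k + r d))"
    using assms(1) by simp
  finally show "(\<Sum>\<^sub>\<infinity>n. f n) = (\<Sum>d\<in>I. \<Sum>\<^sub>\<infinity>k. f (int M * k + r d))" .
  show "(\<lambda>k. f (int M * k + r d)) summable_on UNIV" if "d \<in> I"
  proof -
    have "f summable_on range (\<lambda>k. int M * k + r d)"
      using f by (rule summable_on_subset_banach) auto
    moreover have "inj (\<lambda>k. int M * k + r d)"
      using assms(2) by (auto simp: inj_on_def)
    ultimately show ?thesis
      by (simp add: summable_on_reindex o_def)
  qed
qed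

lemma infsum_shift_int:
  "(\<Sum>\<^sub>\<infinity>n::int. f (n + k)) = (\<Sum>\<^sub>\<infinity>n. f n)"
  by (rule infsum_reindex_bij_betw) (rule bij_betw_byWitness[where f' = "\<lambda>n. n - k"], auto)

lemma infsum_uminus_int:
  "(\<Sum>\<^sub>\<infinity>n::int. f (- n)) = (\<Sum>\<^sub>\<infinity>n. f n)"
  by (rule infsum_reindex_bij_betw) (rule bij_betw_byWitness[where f' = uminus], auto)

text \<open>
  The Weierstrass test for unordered sums: the finite partial sums converge locally uniformly.
\<close>

lemma holomorphic_infsum:
  fixes f :: "'a \<Rightarrow> complex \<Rightarrow> complex"
  assumes "open S" and f: "\<And>n. n \<in> I \<Longrightarrow> f n holomorphic_on S"
    and M: "\<And>n z. n \<in> I \<Longrightarrow> z \<in> S \<Longrightarrow> norm (f n z) \<le> M n" and "M summable_on I"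
  shows "(\<lambda>z. \<Sum>\<^sub>\<infinity>n\<in>I. f n z) holomorphic_on S"
proof -
  have "(\<lambda>z. \<Sum>\<^sub>\<infinity>n\<in>I. f n z) field_differentiable at z" if z: "z \<in> S" for z
  proof -
    obtain r where r: "r > 0" "cball z r \<subseteq> S"
      using open_contains_cball_eq[OF assms(1)] z by metis
    have ul: "uniform_limit (cball z r) (\<lambda>X y. \<Sum>n\<in>X. f n y) (\<lambda>z. \<Sum>\<^sub>\<infinity>n\<in>I. f n z) (finite_subsets_at_top I)"
    proof (rule Weierstrass_m_test_general[OF _ \<open>M summable_on I\<close>])
      fix x y assume "x \<in> I" "y \<in> cball z r"
      then show "norm (f x y) \<le> M x" using M[of x y] r(2) by auto
    qed
    have ev: "\<forall>\<^sub>F X in finite_subsets_at_top I. continuous_on (cball z r) (\<lambda>y. \<Sum>n\<in>X. f n y)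
        \<and> (\<lambda>y. \<Sum>n\<in>X. f n y) holomorphic_on ball z r"
    proof (rule eventually_finite_subsets_at_top_weakI)
      fix X assume X: "finite X" "X \<subseteq> I"
      have "(\<lambda>y. \<Sum>n\<in>X. f n y) holomorphic_on S"
        by (rule holomorphic_on_sum) (use X f in auto)
      then show "continuous_on (cball z r) (\<lambda>y. \<Sum>n\<in>X. f n y) \<and> (\<lambda>y. \<Sum>n\<in>X. f n y) holomorphic_on ball z r"
        using r(2) ball_subset_cball[of z r]
        by (intro conjI holomorphic_on_imp_continuous_on) (erule holomorphic_on_subset, blast)+
    qed
    have "(\<lambda>z. \<Sum>\<^sub>\<infinity>n\<in>I. f n z) holomorphic_on ball z r"
      by (rule holomorphic_uniform_limit[OF ev ul]) auto
    then show ?thesis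
      by (rule holomorphic_on_imp_differentiable_at) (use r in auto)
  qed
  then show ?thesis
    unfolding holomorphic_on_def by (metis field_differentiable_at_within)
qed

section \<open>The error function\<close>

lemma Efun_has_derivative: "(Efun has_real_derivative 2 * exp (- pi * x\<^sup>2)) (at x)"
proof -
  define a where "a = \<bar>x\<bar> + 1"
  have "((\<lambda>u. LBINT y=ereal 0..ereal u. exp (- pi * y\<^sup>2)) has_vector_derivative exp (- pi * x\<^sup>2)) (at x within {-a..a})"
    by (rule interval_integral_FTC2) (auto simp: a_def intro!: continuous_intros)
  moreover have "at x within {-a..a} = at x"
    by (rule at_within_interior) (auto simp: a_def)
  ultimately have "((\<lambda>u. LBINT y=ereal 0..ereal u. exp (- pi * y\<^sup>2)) has_real_derivative exp (- pi * x\<^sup>2)) (at x)"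
    by (simp add: has_real_derivative_iff_has_vector_derivative)
  from DERIV_cmult[OF this, of 2] show ?thesis
    by (simp add: Efun_def[abs_def] zero_ereal_def)
qed

lemma DERIV_Efun [derivative_intros]:
  "(g has_real_derivative g') (at x within S) \<Longrightarrow>
    ((\<lambda>x. Efun (g x)) has_real_derivative 2 * exp (- pi * (g x)\<^sup>2) * g') (at x within S)"
  by (rule DERIV_chain2[OF Efun_has_derivative])

lemma Efun_0 [simp]: "Efun 0 = 0"
  by (simp add: Efun_def flip: zero_ereal_def)

lemma Efun_minus: "Efun (- x) = - Efun x"
proof -
  have "((\<lambda>x. Efun (- x) + Efun x) has_real_derivative 0) (at x)" for x
    by (rule derivative_eq_intros refl | simp)+
  then have "Efun (- x) + Efun x = Efun (- 0) + Efun 0"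
    using DERIV_isconst_all[of "\<lambda>x. Efun (- x) + Efun x" x 0] by simp
  then show ?thesis by simp
qed

text \<open>
  The Gaussian integral, after the substitution \<open>u \<mapsto> u / sqrt \<pi>\<close>.
\<close>

lemma Efun_tendsto_1: "(Efun \<longlongrightarrow> 1) at_top"
proof -
  let ?f = "\<lambda>x::real. exp (- x\<^sup>2)"
  have int: "set_integrable lborel {0..} ?f" and val: "(LBINT x:{0..}. ?f x) = sqrt pi / 2"
    using gaussian_moment_0 by (auto simp: set_integrable_def set_lebesgue_integral_def has_bochner_integral_iff)
  have lim: "((\<lambda>y. LBINT x:{0..y}. ?f x) \<longlongrightarrow> (LBINT x:{0..}. ?f x)) at_top"
    using tendsto_set_lebesgue_integral_at_top[OF _ int] by auto
  have sqrt_pi: "c * sqrt pi / pi = c / sqrt pi" for c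
    by (metis divide_inverse pi_ge_zero sqrt_divide_self_eq times_divide_eq_right)
  have eq: "Efun y = 2 / sqrt pi * (LBINT x:{0..sqrt pi * y}. ?f x)" if y: "y \<ge> 0" for y
  proof -
    have D: "((\<lambda>y. Efun (y / sqrt pi)) has_real_derivative 2 / sqrt pi * exp (- x\<^sup>2)) (at x)" for x
      by (rule DERIV_cong, (rule derivative_eq_intros refl | simp)+)
         (simp add: power_divide sqrt_pi)
    have "(LBINT x=0..sqrt pi * y. 2 / sqrt pi * exp (- x\<^sup>2)) = Efun (sqrt pi * y / sqrt pi) - Efun (0 / sqrt pi)"
      unfolding zero_ereal_def
    proof (rule interval_integral_FTC_finite)
      show "((\<lambda>y. Efun (y / sqrt pi)) has_vector_derivative 2 / sqrt pi * exp (- x\<^sup>2)) (at x within S)" for x S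
        using D[of x] unfolding has_real_derivative_iff_has_vector_derivative by (rule has_vector_derivative_at_within)
    qed (intro continuous_intros)
    also have "(LBINT x=0..sqrt pi * y. 2 / sqrt pi * exp (- x\<^sup>2)) = 2 / sqrt pi * (LBINT x:{0..sqrt pi * y}. ?f x)"
      using y unfolding zero_ereal_def by (simp add: interval_integral_Icc)
    finally show ?thesis using y by simp
  qed
  have "filterlim (\<lambda>y. sqrt pi * y) at_top at_top"
    by (rule filterlim_tendsto_pos_mult_at_top[OF tendsto_const _ filterlim_ident]) auto
  from filterlim_compose[OF lim this]
  have "((\<lambda>y. 2 / sqrt pi * (LBINT x:{0..sqrt pi * y}. ?f x)) \<longlongrightarrow> 2 / sqrt pi * (sqrt pi / 2)) at_top"
    unfolding val by (intro tendsto_intros)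
  then have "((\<lambda>y. 2 / sqrt pi * (LBINT x:{0..sqrt pi * y}. ?f x)) \<longlongrightarrow> 1) at_top"
    by simp
  then show ?thesis
    by (rule Lim_transform_eventually) (use eq in \<open>auto simp: eventually_at_top_linorder intro!: exI[of _ 0]\<close>)
qed

text \<open>\<open>Efun x + exp (- \<pi> x\<^sup>2)\<close> increases from 1 up to \<open>x = 1 / \<pi>\<close> and decreases to the limit 1 afterwards.\<close>

lemma Efun_bounds:
  assumes "x \<ge> 0"
  shows "1 - exp (- pi * x\<^sup>2) \<le> Efun x" "Efun x \<le> 1"
proof -
  have D: "((\<lambda>x. Efun x + exp (- pi * x\<^sup>2)) has_real_derivative 2 * exp (- pi * x\<^sup>2) * (1 - pi * x)) (at x)" for x
    by (rule derivative_eq_intros refl | simp add: algebra_simps)+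
  have lim: "((\<lambda>x. Efun x + exp (- pi * x\<^sup>2)) \<longlongrightarrow> 1) at_top"
  proof -
    have "((\<lambda>x::real. exp (- pi * x\<^sup>2)) \<longlongrightarrow> 0) at_top"
      by (intro filterlim_compose[OF exp_at_bot] filterlim_tendsto_neg_mult_at_bot[OF tendsto_const] filterlim_pow_at_top filterlim_ident) auto
    from tendsto_add[OF Efun_tendsto_1 this] show ?thesis by simp
  qed
  show "1 - exp (- pi * x\<^sup>2) \<le> Efun x"
  proof (cases "x \<le> 1 / pi")
    case True
    have "Efun 0 + exp (- pi * 0\<^sup>2) \<le> Efun x + exp (- pi * x\<^sup>2)"
    proof (rule DERIV_nonneg_imp_nondecreasing[OF assms])
      fix y assume "0 \<le> y" "y \<le> x"
      then have "pi * y \<le> 1"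
        using mult_left_mono[of y "1 / pi" pi] True by simp
      then show "\<exists>d. ((\<lambda>x. Efun x + exp (- pi * x\<^sup>2)) has_real_derivative d) (at y) \<and> 0 \<le> d"
        using D[of y] by (intro exI conjI) auto
    qed
    then show ?thesis by simp
  next
    case False
    have "1 \<le> Efun x + exp (- pi * x\<^sup>2)"
    proof (rule tendsto_upperbound[OF lim])
      show "\<forall>\<^sub>F y in at_top. Efun y + exp (- pi * y\<^sup>2) \<le> Efun x + exp (- pi * x\<^sup>2)"
        unfolding eventually_at_top_linorder
      proof (intro exI[of _ x] allI impI)
        fix y assume "x \<le> y"
        then show "Efun y + exp (- pi * y\<^sup>2) \<le> Efun x + exp (- pi * x\<^sup>2)"
        proof (rule DERIV_nonpos_imp_nonincreasing)
          fix w assume "x \<le> w"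
          then have "1 \<le> pi * w"
            using mult_left_mono[of "1 / pi" w pi] False by simp
          then show "\<exists>d. ((\<lambda>x. Efun x + exp (- pi * x\<^sup>2)) has_real_derivative d) (at w) \<and> d \<le> 0"
            using D[of w] by (intro exI conjI) (auto simp: mult_le_0_iff)
        qed
      qed
    qed auto
    then show ?thesis by simp
  qed
  show "Efun x \<le> 1"
  proof (rule tendsto_lowerbound[OF Efun_tendsto_1])
    show "\<forall>\<^sub>F y in at_top. Efun x \<le> Efun y"
      unfolding eventually_at_top_linorder
    proof (intro exI[of _ x] allI impI)
      fix y assume "x \<le> y"
      then show "Efun x \<le> Efun y"
      proof (rule DERIV_nonneg_imp_nondecreasing)
        show "\<exists>d. (Efun has_real_derivative d) (at w) \<and> 0 \<le> d" for w
          using Efun_has_derivative[of w] by (intro exI conjI) auto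
      qed
    qed
  qed auto
qed

text \<open>
  The Gaussian tail that makes the series of the correction converge.
\<close>

lemma abs_sgn_minus_Efun_le: "\<bar>sgn x - Efun x\<bar> \<le> exp (- pi * x\<^sup>2)"
proof -
  consider "x > 0" | "x = 0" | "x < 0" by linarith
  then show ?thesis
  proof cases
    case 1 with Efun_bounds[of x] show ?thesis by auto
  next
    case 2 then show ?thesis by simp
  next
    case 3 with Efun_bounds[of "- x"] show ?thesis by (auto simp: Efun_minus)
  qed
qed

section \<open>Theta functions of degree \<open>N\<close>\<close>

text \<open>
  The summands of all \<open>Theta j N \<tau> z\<close> in one family indexed by the integers: \<open>Theta j\<close> takes those
  with index congruent to \<open>j\<close> modulo \<open>2 * N\<close> (\<open>Theta_eq\<close>).
\<close>

definition theta_term :: "nat \<Rightarrow> complex \<Rightarrow> complex \<Rightarrow> int \<Rightarrow> complex" where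
  "theta_term N \<tau> z k = e2pi (of_int k * z / 2 + (of_int k)\<^sup>2 / (4 * of_nat N) * \<tau>)"

lemma norm_theta_term:
  "norm (theta_term N \<tau> z k) = exp (- pi * of_int k * Im z - pi * Im \<tau> / (2 * real N) * (of_int k)\<^sup>2)"
proof -
  have "Im (of_int k * z / 2 + (of_int k)\<^sup>2 / (4 * of_nat N) * \<tau>)
      = of_int k * Im z / 2 + (of_int k)\<^sup>2 / (4 * real N) * Im \<tau>"
  proof -
    have "(of_int k)\<^sup>2 / (4 * of_nat N) = complex_of_real ((of_int k)\<^sup>2 / (4 * real N))"
      by simp
    then show ?thesis
      by (simp only: plus_complex.sel Im_complex_of_real times_complex.sel) simp
  qed
  then show ?thesis
    by (simp add: theta_term_def norm_e2pi field_simps)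
qed

lemma norm_theta_term_le:
  "norm (theta_term N \<tau> z k)
     \<le> exp (- (pi * Im \<tau> / (2 * real N)) * (of_int k)\<^sup>2 + pi * \<bar>Im z\<bar> * \<bar>of_int k\<bar>)"
proof -
  have "- (of_int k * Im z) \<le> \<bar>Im z\<bar> * \<bar>of_int k\<bar>"
    by (metis abs_ge_minus_self abs_mult mult.commute)
  from mult_left_mono[OF this pi_ge_zero] show ?thesis
    by (simp add: norm_theta_term algebra_simps)
qed

lemma summable_theta_term:
  assumes "Im \<tau> > 0" "N > 0"
  shows "theta_term N \<tau> z summable_on UNIV"
  by (rule summable_gauss_comparison[where K = 1 and a = "pi * Im \<tau> / (2 * real N)" and b = "pi * \<bar>Im z\<bar>"])
     (use assms norm_theta_term_le in auto)

lemma Theta_eq: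
  assumes "N > 0"
  shows "Theta j N \<tau> z = (\<Sum>\<^sub>\<infinity>n. theta_term N \<tau> z (2 * int N * n + j))"
  unfolding Theta_def Let_def theta_term_def qpow_def e2pi_add [symmetric]
  using assms by (intro infsum_cong arg_cong[of _ _ e2pi]) (simp add: field_simps power2_eq_square)

lemma Theta_shift:
  assumes "N > 0"
  shows "Theta (j + 2 * int N * k) N \<tau> z = Theta j N \<tau> z"
  unfolding Theta_eq[OF assms]
  using infsum_shift_int[of "\<lambda>n. theta_term N \<tau> z (2 * int N * n + j)" k]
  by (simp add: algebra_simps)

lemma Theta_mod:
  assumes "N > 0"
  shows "Theta (j mod (2 * int N)) N \<tau> z = Theta j N \<tau> z"
  using Theta_shift[OF assms, of "j mod (2 * int N)" "j div (2 * int N)" \<tau> z] by simp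

lemma Theta_bounded:
  assumes "N > 0"
  obtains K where "K > 0" "\<And>j. norm (Theta j N \<tau> z) \<le> K"
proof
  let ?K = "1 + (\<Sum>j\<in>{0..<2 * int N}. norm (Theta j N \<tau> z))"
  show "0 < ?K"
    by (simp add: add_pos_nonneg sum_nonneg)
  fix j
  have "norm (Theta (j mod (2 * int N)) N \<tau> z) \<le> (\<Sum>j\<in>{0..<2 * int N}. norm (Theta j N \<tau> z))"
    using assms by (intro member_le_sum) auto
  then show "norm (Theta j N \<tau> z) \<le> ?K"
    by (simp add: Theta_mod[OF assms])
qed

lemma Theta_uminus:
  assumes "N > 0"
  shows "Theta j N \<tau> (- z) = Theta (- j) N \<tau> z"
proof -
  have "Theta (- j) N \<tau> z = (\<Sum>\<^sub>\<infinity>n. theta_term N \<tau> z (2 * int N * (- n) + - j))"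
    unfolding Theta_eq[OF assms] by (rule infsum_uminus_int [symmetric])
  also have "\<dots> = Theta j N \<tau> (- z)"
    unfolding Theta_eq[OF assms] theta_term_def by (intro infsum_cong arg_cong[of _ _ e2pi])
      (simp add: field_simps power2_eq_square)
  finally show ?thesis ..
qed

lemma Theta_add_tau:
  assumes "N > 0"
  shows "Theta j N \<tau> (z + of_int p * \<tau>)
    = e2pi (- (of_nat N * of_int p * z / 2) - of_nat N * (of_int p)\<^sup>2 * \<tau> / 4) * Theta (j + int N * p) N \<tau> z"
  unfolding Theta_eq[OF assms] infsum_cmult_right'[symmetric] theta_term_def e2pi_add[symmetric]
  using assms by (intro infsum_cong arg_cong[of _ _ e2pi]) (simp add: field_simps power2_eq_square)

lemma Theta_add_int:
  assumes "N > 0"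
  shows "Theta j N \<tau> (z + of_int p) = e2pi (of_int (j * p) / 2) * Theta j N \<tau> z"
proof -
  have "theta_term N \<tau> (z + of_int p) (2 * int N * n + j)
      = e2pi (of_int (j * p) / 2) * theta_term N \<tau> z (2 * int N * n + j)" for n
    unfolding theta_term_def e2pi_add[symmetric]
    by (rule e2pi_eqI[of _ _ "int N * n * p"]) (simp add: field_simps)
  then show ?thesis
    unfolding Theta_eq[OF assms] infsum_cmult_right'[symmetric] by simp
qed

section \<open>The completed Appell function\<close>

definition lat :: "complex \<Rightarrow> complex set" where
  "lat \<tau> = {of_int p * \<tau> + of_int r | p r :: int. True}"

text \<open>
  The summands of \<open>Phi1\<close> as functions of \<open>u = z1 + z2\<close> and \<open>z = z1\<close>, since \<open>u\<close> is kept fixed in the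
  inversion. The parameter \<open>s\<close> ranges over all integers, since translations by \<open>\<tau>\<close> shift it.
\<close>

definition appell_term :: "nat \<Rightarrow> int \<Rightarrow> complex \<Rightarrow> complex \<Rightarrow> complex \<Rightarrow> int \<Rightarrow> complex" where
  "appell_term N s \<tau> u z j =
     e2pi (of_nat N * (of_int j * u + (of_int j)\<^sup>2 * \<tau>) - of_int s * (z + of_int j * \<tau>))
     / (1 - e2pi (z + of_int j * \<tau>))"

definition appell :: "nat \<Rightarrow> int \<Rightarrow> complex \<Rightarrow> complex \<Rightarrow> complex \<Rightarrow> complex" where
  "appell N s \<tau> u z = (\<Sum>\<^sub>\<infinity>j. appell_term N s \<tau> u z j)"

definition corr_arg :: "nat \<Rightarrow> complex \<Rightarrow> complex \<Rightarrow> int \<Rightarrow> real" where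
  "corr_arg N \<tau> v n = (of_int n + 2 * real N * Im v / Im \<tau>) * sqrt (Im \<tau> / real N)"

definition corr_exp :: "nat \<Rightarrow> complex \<Rightarrow> complex \<Rightarrow> int \<Rightarrow> complex" where
  "corr_exp N \<tau> v n = e2pi (- ((of_int n)\<^sup>2 / (4 * of_nat N) * \<tau>) - of_int n * v)"

text \<open>
  The summands of all \<open>Rfun j N \<tau> v\<close> with \<open>- s \<le> j < 2 * N - s\<close> in one family: the index \<open>n\<close> belongs
  to \<open>j\<close> modulo \<open>2 * N\<close> if it is congruent to \<open>- j\<close>, and the sign changes between \<open>s\<close> and \<open>s + 1\<close>.
\<close>

definition corr_term :: "nat \<Rightarrow> int \<Rightarrow> complex \<Rightarrow> complex \<Rightarrow> int \<Rightarrow> complex" where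
  "corr_term N s \<tau> v n =
     of_real (sgn (of_int n - of_int s - 1 / 2) - Efun (corr_arg N \<tau> v n)) * corr_exp N \<tau> v n"

definition corr :: "nat \<Rightarrow> int \<Rightarrow> complex \<Rightarrow> complex \<Rightarrow> complex \<Rightarrow> complex" where
  "corr N s \<tau> u v = 1 / 2 * (\<Sum>\<^sub>\<infinity>n. corr_term N s \<tau> v n * Theta (- n) N \<tau> u)"

definition capp :: "nat \<Rightarrow> int \<Rightarrow> complex \<Rightarrow> complex \<Rightarrow> complex \<Rightarrow> complex" where
  "capp N s \<tau> z1 z2 = appell N s \<tau> (z1 + z2) z1 + corr N s \<tau> (z1 + z2) ((z1 - z2) / 2)"

lemma norm_corr_exp:
  "norm (corr_exp N \<tau> v n) = exp (pi * Im \<tau> / (2 * real N) * (of_int n)\<^sup>2 + 2 * pi * of_int n * Im v)"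
proof -
  have "(of_int n)\<^sup>2 / (4 * of_nat N) = complex_of_real ((of_int n)\<^sup>2 / (4 * real N))"
    by simp
  then have "Im (- ((of_int n)\<^sup>2 / (4 * of_nat N) * \<tau>) - of_int n * v)
      = - ((of_int n)\<^sup>2 / (4 * real N) * Im \<tau>) - of_int n * Im v"
    by (simp only: minus_complex.sel uminus_complex.sel Im_complex_of_real times_complex.sel) simp
  then show ?thesis
    by (simp add: corr_exp_def norm_e2pi field_simps)
qed

lemma corr_arg_square:
  assumes "Im \<tau> > 0" "N > 0"
  shows "(corr_arg N \<tau> v n)\<^sup>2
    = Im \<tau> / real N * (of_int n)\<^sup>2 + 4 * of_int n * Im v + 4 * real N * (Im v)\<^sup>2 / Im \<tau>"
  using assms by (simp add: corr_arg_def power_mult_distrib field_simps power2_eq_square)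

text \<open>The Gaussian decay of \<open>1 - Efun\<close> beats the growth of \<open>corr_exp\<close>.\<close>

lemma gauss_corr_exp_le:
  assumes "Im \<tau> > 0" "N > 0" "\<bar>Im v\<bar> \<le> \<rho>"
  shows "exp (- pi * (corr_arg N \<tau> v n)\<^sup>2) * norm (corr_exp N \<tau> v n)
    \<le> exp (- (pi * Im \<tau> / (2 * real N)) * (of_int n)\<^sup>2 + 2 * pi * \<rho> * \<bar>of_int n\<bar>)"
proof -
  have "- (of_int n * Im v) \<le> \<bar>of_int n\<bar> * \<bar>Im v\<bar>"
    by (metis abs_ge_minus_self abs_mult)
  also have "\<dots> \<le> \<rho> * \<bar>of_int n\<bar>"
    using mult_right_mono[OF assms(3), of "\<bar>of_int n\<bar>"] by (simp add: mult.commute)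
  finally have 1: "2 * pi * - (of_int n * Im v) \<le> 2 * pi * (\<rho> * \<bar>of_int n\<bar>)"
    by (intro mult_left_mono) auto
  have 2: "0 \<le> pi * (4 * real N * (Im v)\<^sup>2 / Im \<tau>)"
    using assms by simp
  have "exp (- pi * (corr_arg N \<tau> v n)\<^sup>2) * norm (corr_exp N \<tau> v n)
     = exp (- (pi * Im \<tau> / (2 * real N)) * (of_int n)\<^sup>2 + 2 * pi * - (of_int n * Im v)
         - pi * (4 * real N * (Im v)\<^sup>2 / Im \<tau>))"
    unfolding corr_arg_square[OF assms(1,2)] norm_corr_exp exp_add[symmetric]
    using assms by (intro arg_cong[of _ _ exp]) (simp add: field_simps)
  also have "\<dots> \<le> exp (- (pi * Im \<tau> / (2 * real N)) * (of_int n)\<^sup>2 + 2 * pi * (\<rho> * \<bar>of_int n\<bar>))"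
    unfolding exp_le_cancel_iff using 1 2 by argo
  finally show ?thesis by (simp add: mult_ac)
qed

text \<open>
  Where the sign of \<open>corr_term\<close> agrees with the sign of \<open>corr_arg\<close>, the factor is bounded by
  \<open>abs_sgn_minus_Efun_le\<close>. The two signs differ for boundedly many indices only, and there a
  constant is enough. The bound is uniform on horizontal strips.
\<close>

lemma corr_term_le:
  assumes "Im \<tau> > 0" "N > 0"
  obtains K where "K > 0" "\<And>v n. \<bar>Im v\<bar> \<le> \<rho> \<Longrightarrow> norm (corr_term N s \<tau> v n)
    \<le> K * exp (- (pi * Im \<tau> / (2 * real N)) * (of_int n)\<^sup>2 + 2 * pi * \<rho> * \<bar>of_int n\<bar>)"
proof
  define a where "a = pi * Im \<tau> / (2 * real N)"
  have a: "a > 0" using assms by (simp add: a_def)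
  \<comment> \<open>For \<open>\<bar>n\<bar> > B\<close> both signs are the sign of \<open>n\<close>; for \<open>\<bar>n\<bar> \<le> B\<close> the factor \<open>exp (2 * a * B\<^sup>2)\<close>
    turns the growing Gaussian of \<open>corr_exp\<close> into the decaying one.\<close>
  define B where "B = \<bar>real_of_int s\<bar> + 1 + 2 * real N * \<bar>\<rho>\<bar> / Im \<tau>"
  let ?K = "1 + 2 * exp (2 * a * B\<^sup>2)"
  show "?K > 0" by (simp add: add_pos_pos)
  fix v n assume v: "\<bar>Im v\<bar> \<le> \<rho>"
  let ?G = "exp (- a * (of_int n)\<^sup>2 + 2 * pi * \<rho> * \<bar>of_int n\<bar>)"
  let ?x = "corr_arg N \<tau> v n"
  let ?e = "norm (corr_exp N \<tau> v n)"
  let ?s = "sgn (real_of_int n - of_int s - 1 / 2)"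
  have gr: "\<bar>sgn ?x - Efun ?x\<bar> * ?e \<le> ?G"
  proof -
    have "\<bar>sgn ?x - Efun ?x\<bar> * ?e \<le> exp (- pi * ?x\<^sup>2) * ?e"
      by (intro mult_right_mono abs_sgn_minus_Efun_le) auto
    also have "\<dots> \<le> ?G"
      unfolding a_def by (rule gauss_corr_exp_le[OF assms v])
    finally show ?thesis .
  qed
  have "\<bar>?s - sgn ?x\<bar> * ?e \<le> 2 * exp (2 * a * B\<^sup>2) * ?G"
  proof (cases "\<bar>real_of_int n\<bar> \<le> B")
    case True
    have "of_int n * Im v \<le> \<bar>of_int n\<bar> * \<bar>Im v\<bar>"
      by (metis abs_ge_self abs_mult)
    also have "\<dots> \<le> \<rho> * \<bar>of_int n\<bar>"
      using mult_right_mono[OF v, of "\<bar>of_int n\<bar>"] by (simp add: mult.commute)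
    finally have 1: "2 * pi * (of_int n * Im v) \<le> 2 * pi * (\<rho> * \<bar>of_int n\<bar>)"
      by (intro mult_left_mono) auto
    have "(of_int n)\<^sup>2 \<le> B\<^sup>2"
      using True by (metis abs_ge_zero power2_abs power_mono)
    then have 2: "a * (of_int n)\<^sup>2 \<le> a * B\<^sup>2"
      using a by simp
    have "?e \<le> exp (2 * a * B\<^sup>2 + (- a * (of_int n)\<^sup>2 + 2 * pi * \<rho> * \<bar>of_int n\<bar>))"
      unfolding norm_corr_exp a_def[symmetric] exp_le_cancel_iff using 1 2
      by (simp only: mult.assoc mult_minus_left)
    then have "?e \<le> exp (2 * a * B\<^sup>2) * ?G"
      by (simp add: exp_add)
    moreover have "\<bar>?s - sgn ?x\<bar> \<le> 2"
      by (auto simp: sgn_if)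
    ultimately have "\<bar>?s - sgn ?x\<bar> * ?e \<le> 2 * (exp (2 * a * B\<^sup>2) * ?G)"
      by (intro mult_mono) auto
    then show ?thesis by simp
  next
    case False
    have "\<bar>2 * real N * Im v / Im \<tau>\<bar> \<le> 2 * real N * \<bar>\<rho>\<bar> / Im \<tau>"
      using v assms by (auto simp: abs_mult intro!: divide_right_mono mult_left_mono)
    then have *: "\<bar>2 * real N * Im v / Im \<tau>\<bar> < \<bar>of_int n\<bar>" "\<bar>real_of_int s\<bar> + 1 < \<bar>of_int n\<bar>"
      using False unfolding B_def by (linarith | simp add: add_nonneg_nonneg)+
    have "sgn ?x = sgn (of_int n + 2 * real N * Im v / Im \<tau>)"
      using assms by (simp add: corr_arg_def sgn_mult)
    also have "sgn (of_int n + w) = ?s" if "\<bar>w\<bar> < \<bar>of_int n\<bar>" for w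
      using that *(2) by (cases "n > 0") (auto simp: sgn_if)
    from this[OF *(1)] have "sgn (of_int n + 2 * real N * Im v / Im \<tau>) = ?s" .
    finally show ?thesis by simp
  qed
  with gr have "\<bar>?s - sgn ?x\<bar> * ?e + \<bar>sgn ?x - Efun ?x\<bar> * ?e \<le> ?K * ?G"
    by (simp add: distrib_right)
  moreover have "norm (corr_term N s \<tau> v n) = \<bar>?s - Efun ?x\<bar> * ?e"
    by (simp only: corr_term_def norm_mult norm_of_real)
  moreover have "\<bar>?s - Efun ?x\<bar> * ?e \<le> (\<bar>?s - sgn ?x\<bar> + \<bar>sgn ?x - Efun ?x\<bar>) * ?e"
    by (intro mult_right_mono) auto
  ultimately show "norm (corr_term N s \<tau> v n)
      \<le> ?K * exp (- (pi * Im \<tau> / (2 * real N)) * (of_int n)\<^sup>2 + 2 * pi * \<rho> * \<bar>of_int n\<bar>)"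
    unfolding a_def[symmetric] distrib_right by linarith
qed

lemma summable_corr:
  assumes "Im \<tau> > 0" "N > 0"
  shows "(\<lambda>n. corr_term N s \<tau> v n * Theta (- n) N \<tau> u) summable_on UNIV"
proof -
  obtain K where K: "K > 0" "\<And>n. norm (corr_term N s \<tau> v n)
    \<le> K * exp (- (pi * Im \<tau> / (2 * real N)) * (of_int n)\<^sup>2 + 2 * pi * \<bar>Im v\<bar> * \<bar>of_int n\<bar>)"
    using corr_term_le[OF assms, where \<rho> = "\<bar>Im v\<bar>" and s = s] by (metis order_refl)
  obtain T where T: "T > 0" "\<And>j. norm (Theta j N \<tau> u) \<le> T"
    using Theta_bounded[OF assms(2)] by metis
  let ?a = "pi * Im \<tau> / (2 * real N)"
  have a: "?a > 0" using assms by simp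
  show "(\<lambda>n. corr_term N s \<tau> v n * Theta (- n) N \<tau> u) summable_on UNIV"
  proof (rule summable_gauss_comparison[OF a])
    fix n
    show "norm (corr_term N s \<tau> v n * Theta (- n) N \<tau> u)
        \<le> K * T * exp (- ?a * (of_int n)\<^sup>2 + 2 * pi * \<bar>Im v\<bar> * \<bar>of_int n\<bar>)"
      unfolding norm_mult
      using mult_mono[OF K(2)[of n] T(2)[of "- n"]] K(1) by (simp add: mult_ac)
  qed
qed

text \<open>Away from the real axis the denominators of the Appell function are bounded below.\<close>

lemma norm_one_minus_e2pi:
  assumes "\<bar>Im z\<bar> \<ge> 1"
  shows "norm (1 - e2pi z) \<ge> 1 / 2"
proof -
  have 2: "exp (2 * pi) \<ge> 2"
    using exp_ge_add_one_self[of "2 * pi"] pi_gt3 by linarith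
  show ?thesis
  proof (cases "Im z > 0")
    case True
    then have "exp (- 2 * pi * Im z) \<le> exp (- (2 * pi))"
      using assms by (simp add: mult_le_cancel_left1)
    also have "\<dots> \<le> 1 / 2"
      using 2 by (simp add: exp_minus field_simps)
    finally show ?thesis
      using norm_triangle_ineq2[of 1 "e2pi z"] by (simp add: norm_e2pi)
  next
    case False
    then have "exp (2 * pi) \<le> exp (- 2 * pi * Im z)"
      using assms mult_left_mono[of 1 "- Im z" "2 * pi"] by simp
    then have "2 \<le> norm (e2pi z)"
      unfolding norm_e2pi using 2 by linarith
    then show ?thesis
      using norm_triangle_ineq3[of 1 "e2pi z"] by simp
  qed
qed

lemma norm_appell_numerator:
  assumes "Im \<tau> > 0" "\<bar>Im z\<bar> \<le> \<rho>"
  shows "norm (e2pi (of_nat N * (of_int j * u + (of_int j)\<^sup>2 * \<tau>) - of_int s * (z + of_int j * \<tau>)))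
    \<le> exp (2 * pi * \<bar>of_int s\<bar> * \<rho>) * exp (- (2 * pi * real N * Im \<tau>) * (of_int j)\<^sup>2
        + 2 * pi * (real N * \<bar>Im u\<bar> + \<bar>of_int s\<bar> * Im \<tau>) * \<bar>of_int j\<bar>)"
proof -
  have 1: "- (of_int j * Im u) \<le> \<bar>Im u\<bar> * \<bar>of_int j\<bar>"
    by (metis abs_ge_minus_self abs_mult mult.commute)
  have 2: "of_int s * Im z \<le> \<bar>of_int s\<bar> * \<rho>"
  proof -
    have "of_int s * Im z \<le> \<bar>of_int s\<bar> * \<bar>Im z\<bar>" by (metis abs_ge_self abs_mult)
    also have "\<dots> \<le> \<bar>of_int s\<bar> * \<rho>" using assms by (intro mult_left_mono) auto
    finally show ?thesis .
  qed
  have 3: "of_int s * of_int j \<le> \<bar>real_of_int s\<bar> * \<bar>of_int j\<bar>"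
    by (metis abs_ge_self abs_mult)
  have im: "Im (of_nat N * (of_int j * u + (of_int j)\<^sup>2 * \<tau>) - of_int s * (z + of_int j * \<tau>))
    = real N * (of_int j * Im u + (of_int j)\<^sup>2 * Im \<tau>) - of_int s * (Im z + of_int j * Im \<tau>)"
  proof -
    have "(of_int j)\<^sup>2 = complex_of_real ((of_int j)\<^sup>2)" by simp
    then show ?thesis
      by (simp only: minus_complex.sel plus_complex.sel Im_complex_of_real times_complex.sel) simp
  qed
  have "- 2 * pi * (real N * (of_int j * Im u + (of_int j)\<^sup>2 * Im \<tau>) - of_int s * (Im z + of_int j * Im \<tau>))
    = 2 * pi * real N * (- (of_int j * Im u)) + 2 * pi * (of_int s * Im z)
      + 2 * pi * Im \<tau> * (of_int s * of_int j) - 2 * pi * real N * Im \<tau> * (of_int j)\<^sup>2"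
    by (simp add: algebra_simps)
  also have "\<dots> \<le> 2 * pi * real N * (\<bar>Im u\<bar> * \<bar>of_int j\<bar>) + 2 * pi * (\<bar>of_int s\<bar> * \<rho>)
      + 2 * pi * Im \<tau> * (\<bar>of_int s\<bar> * \<bar>of_int j\<bar>) - 2 * pi * real N * Im \<tau> * (of_int j)\<^sup>2"
    using assms(1) by (intro add_mono diff_mono mult_left_mono[OF 1] mult_left_mono[OF 2] mult_left_mono[OF 3]) auto
  also have "\<dots> = 2 * pi * \<bar>of_int s\<bar> * \<rho> + (- (2 * pi * real N * Im \<tau>) * (of_int j)\<^sup>2
        + 2 * pi * (real N * \<bar>Im u\<bar> + \<bar>of_int s\<bar> * Im \<tau>) * \<bar>of_int j\<bar>)"
    by (simp add: algebra_simps)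
  finally show ?thesis
    unfolding norm_e2pi im exp_add[symmetric] exp_le_cancel_iff .
qed

lemma abs_Im_add_int_mult_ge:
  assumes "Im \<tau> > 0" "\<bar>Im z\<bar> \<le> \<rho>" "\<bar>j\<bar> \<ge> \<lceil>(\<rho> + 1) / Im \<tau>\<rceil>"
  shows "\<bar>Im (z + of_int j * \<tau>)\<bar> \<ge> 1"
proof -
  have "(\<rho> + 1) / Im \<tau> \<le> \<bar>of_int j\<bar>"
    using assms(3) by linarith
  then have "\<rho> + 1 \<le> \<bar>of_int j * Im \<tau>\<bar>"
    using assms(1) by (simp add: abs_mult field_simps)
  then show ?thesis
    using assms(2) by simp
qed

lemma summable_appell:
  assumes "Im \<tau> > 0" "N > 0"
  shows "appell_term N s \<tau> u z summable_on UNIV"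
proof -
  define J where "J = \<lceil>(\<bar>Im z\<bar> + 1) / Im \<tau>\<rceil>"
  define D where "D j = norm (1 / (1 - e2pi (z + of_int j * \<tau>)))" for j
  define K where "K = 2 + (\<Sum>j\<in>{-J..J}. D j)"
  have K: "D j \<le> K" for j
  proof (cases "\<bar>j\<bar> \<ge> J")
    case True
    then have "norm (1 - e2pi (z + of_int j * \<tau>)) \<ge> 1 / 2"
      unfolding J_def by (intro norm_one_minus_e2pi abs_Im_add_int_mult_ge[OF assms(1) order_refl])
    then have "D j \<le> 2"
      unfolding D_def norm_divide using le_imp_inverse_le[of "1 / 2" "norm (1 - e2pi (z + of_int j * \<tau>))"]
      by (simp add: inverse_eq_divide)
    then show ?thesis
      unfolding K_def using sum_nonneg[of "{-J..J}" D] by (simp add: D_def)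
  next
    case False
    then have "D j \<le> (\<Sum>j\<in>{-J..J}. D j)"
      by (intro member_le_sum) (auto simp: D_def)
    then show ?thesis
      unfolding K_def by simp
  qed
  define L where "L = exp (2 * pi * \<bar>of_int s\<bar> * \<bar>Im z\<bar>)"
  show ?thesis
  proof (rule summable_gauss_comparison)
    show "2 * pi * real N * Im \<tau> > 0" using assms by simp
    fix j
    have "norm (appell_term N s \<tau> u z j)
      = norm (e2pi (of_nat N * (of_int j * u + (of_int j)\<^sup>2 * \<tau>) - of_int s * (z + of_int j * \<tau>))) * D j"
      by (simp add: appell_term_def D_def norm_divide)
    also have "\<dots> \<le> (L * exp (- (2 * pi * real N * Im \<tau>) * (of_int j)\<^sup>2
        + 2 * pi * (real N * \<bar>Im u\<bar> + \<bar>of_int s\<bar> * Im \<tau>) * \<bar>of_int j\<bar>)) * K"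
      unfolding L_def
      by (intro mult_mono K norm_appell_numerator[OF assms(1)]) (auto simp: D_def)
    finally show "norm (appell_term N s \<tau> u z j) \<le> (L * K) * exp (- (2 * pi * real N * Im \<tau>) * (of_int j)\<^sup>2
        + 2 * pi * (real N * \<bar>Im u\<bar> + \<bar>of_int s\<bar> * Im \<tau>) * \<bar>of_int j\<bar>)"
      by (simp only: mult_ac)
  qed
qed

lemma e2pi_eq_1_imp_lat: "e2pi (z + of_int j * \<tau>) = 1 \<Longrightarrow> z \<in> lat \<tau>"
proof -
  assume "e2pi (z + of_int j * \<tau>) = 1"
  then obtain r :: int where "z + of_int j * \<tau> = of_int r"
    unfolding e2pi_eq_1_iff by (elim Ints_cases)
  then have "z = of_int (- j) * \<tau> + of_int r"
    by (simp add: algebra_simps)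
  then show ?thesis
    unfolding lat_def by blast
qed

text \<open>
  Since \<open>(x powi (- s - 1) - x powi (- s)) / (1 - x) = x powi (- s - 1)\<close>, raising \<open>s\<close> by one adds a theta
  series to \<open>appell\<close>; it is cancelled by the one term that changes sign in \<open>corr\<close>. The argument
  \<open>z1\<close> has to avoid the lattice: for \<open>x = 1\<close> the quotient reads as 0 and the identity fails.
\<close>

lemma capp_Suc:
  assumes "Im \<tau> > 0" "N > 0" "z1 \<notin> lat \<tau>"
  shows "capp N (s + 1) \<tau> z1 z2 = capp N s \<tau> z1 z2"
proof -
  define u v where "u = z1 + z2" and "v = (z1 - z2) / 2"
  let ?d = "corr_exp N \<tau> v (s + 1) * Theta (- (s + 1)) N \<tau> u"
  define h where "h j = e2pi (of_nat N * (of_int j * u + (of_int j)\<^sup>2 * \<tau>) - of_int (s + 1) * (z1 + of_int j * \<tau>))" for j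
  have h: "h j = corr_exp N \<tau> v (s + 1) * theta_term N \<tau> u (2 * int N * j + - (s + 1))" for j
    unfolding h_def corr_exp_def theta_term_def e2pi_add[symmetric] u_def v_def
    using assms(2) by (intro arg_cong[of _ _ e2pi]) (simp add: field_simps power2_eq_square)
  have "appell_term N (s + 1) \<tau> u z1 j = appell_term N s \<tau> u z1 j + h j" for j
  proof -
    define x where "x = e2pi (z1 + of_int j * \<tau>)"
    define g where "g = e2pi (of_nat N * (of_int j * u + (of_int j)\<^sup>2 * \<tau>) - of_int s * (z1 + of_int j * \<tau>))"
    have x: "x \<noteq> 1" "x \<noteq> 0"
      using e2pi_eq_1_imp_lat assms(3) by (auto simp: x_def)
    have hj: "h j = g / x"
      unfolding h_def g_def x_def e2pi_diff[symmetric] by (simp add: algebra_simps)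
    have "appell_term N (s + 1) \<tau> u z1 j = h j / (1 - x)"
      by (simp add: appell_term_def h_def x_def)
    also have "\<dots> = g / (1 - x) + h j"
      unfolding hj using x by (simp add: field_simps)
    finally show ?thesis
      by (simp add: appell_term_def g_def x_def)
  qed
  moreover have "h summable_on UNIV"
  proof -
    have "(\<lambda>j. theta_term N \<tau> u (2 * int N * j + - (s + 1))) summable_on UNIV"
    proof -
      have "theta_term N \<tau> u summable_on range (\<lambda>j. 2 * int N * j + - (s + 1))"
        by (rule summable_on_subset_banach[OF summable_theta_term[OF assms(1,2)]]) auto
      moreover have "inj (\<lambda>j. 2 * int N * j + - (s + 1))"
        using assms(2) by (auto simp: inj_on_def)
      ultimately show ?thesis by (simp add: summable_on_reindex o_def)
    qed
    then show ?thesis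
      unfolding h by (rule summable_on_cmult_right)
  qed
  ultimately have "appell N (s + 1) \<tau> u z1 = appell N s \<tau> u z1 + (\<Sum>\<^sub>\<infinity>j. h j)"
    unfolding appell_def using infsum_add[OF summable_appell[OF assms(1,2)], of h s u z1]
    by (simp cong: infsum_cong)
  also have "(\<Sum>\<^sub>\<infinity>j. h j) = ?d"
    unfolding h infsum_cmult_right' Theta_eq[OF assms(2)] ..
  finally have 1: "appell N (s + 1) \<tau> u z1 = appell N s \<tau> u z1 + ?d" .
  have "corr_term N (s + 1) \<tau> v n * Theta (- n) N \<tau> u
      = corr_term N s \<tau> v n * Theta (- n) N \<tau> u + (if n = s + 1 then - 2 * ?d else 0)" for n
  proof -
    consider "n < s + 1" | "n = s + 1" | "n > s + 1" by linarith
    then show ?thesis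
    proof cases
      case 1
      then have "real_of_int n - of_int s - 1 / 2 < 0" by linarith
      with 1 show ?thesis by (simp add: corr_term_def sgn_if)
    next
      case 2
      then show ?thesis by (simp add: corr_term_def sgn_if algebra_simps)
    next
      case 3
      then have "real_of_int n - of_int s - 1 / 2 > 1" by linarith
      with 3 show ?thesis by (simp add: corr_term_def sgn_if)
    qed
  qed
  moreover have "(\<lambda>n. if n = s + 1 then - 2 * ?d else 0) summable_on UNIV"
    by (rule finite_nonzero_values_imp_summable_on) (rule finite_subset[of _ "{s + 1}"], auto)
  moreover have "(\<Sum>\<^sub>\<infinity>n. if n = s + 1 then - 2 * ?d else 0) = - 2 * ?d"
  proof -
    have "(\<Sum>\<^sub>\<infinity>n. if n = s + 1 then - 2 * ?d else 0) = (\<Sum>\<^sub>\<infinity>n\<in>{s + 1}. - 2 * ?d)"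
      by (rule infsum_cong_neutral) auto
    then show ?thesis by simp
  qed
  ultimately have 2: "corr N (s + 1) \<tau> u v = corr N s \<tau> u v - ?d"
    unfolding corr_def using infsum_add[OF summable_corr[OF assms(1,2)], of _ s v u] by simp
  show ?thesis
    using 1 2 by (simp add: capp_def u_def v_def)
qed

lemma capp_indep:
  assumes "Im \<tau> > 0" "N > 0" "z1 \<notin> lat \<tau>"
  shows "capp N s \<tau> z1 z2 = capp N 0 \<tau> z1 z2"
proof (induction s rule: int_induct[of _ 0])
  case (step2 i)
  then show ?case using capp_Suc[OF assms, of "i - 1"] by simp
qed (use capp_Suc[OF assms] in auto)

text \<open>Translations by \<open>\<tau>\<close> only change \<open>s\<close>, up to an exponential factor.\<close>

lemma capp_add_tau:
  assumes "Im \<tau> > 0" "N > 0"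
  shows "capp N s \<tau> (z1 + of_int a * \<tau>) (z2 + of_int b * \<tau>)
    = e2pi (- of_nat N * (of_int (a * b) * \<tau> + of_int b * z1 + of_int a * z2))
      * capp N (s + int N * (a - b)) \<tau> z1 z2"
proof -
  define u v where "u = z1 + z2" and "v = (z1 - z2) / 2"
  have z: "z1 = u / 2 + v" "z2 = u / 2 - v"
    by (simp_all add: u_def v_def field_simps)
  let ?e = "e2pi (- of_nat N * (of_int (a * b) * \<tau> + of_int b * z1 + of_int a * z2))"
  have "appell_term N s \<tau> (u + of_int (a + b) * \<tau>) (z1 + of_int a * \<tau>) (j + (- a))
      = ?e * appell_term N (s + int N * (a - b)) \<tau> u z1 j" for j
    unfolding appell_term_def times_divide_eq_right e2pi_add[symmetric] z
    by (intro arg_cong2[of _ _ _ _ "(/)"] arg_cong2[of _ _ _ _ "(-)"] arg_cong[of _ _ e2pi] refl)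
       (simp_all add: field_simps power2_eq_square)
  then have 1: "appell N s \<tau> (u + of_int (a + b) * \<tau>) (z1 + of_int a * \<tau>)
      = ?e * appell N (s + int N * (a - b)) \<tau> u z1"
    unfolding appell_def
    by (subst infsum_shift_int[of _ "- a", symmetric]) (simp only: infsum_cmult_right')
  have t: "corr_term N s \<tau> (v + of_int (a - b) / 2 * \<tau>) n * Theta (- n) N \<tau> (u + of_int (a + b) * \<tau>)
      = ?e * (corr_term N (s + int N * (a - b)) \<tau> v (n + int N * (a - b)) * Theta (- (n + int N * (a - b))) N \<tau> u)" for n
  proof -
    have "Theta (- n + int N * (a + b)) N \<tau> u = Theta (- (n + int N * (a - b))) N \<tau> u"
      using Theta_shift[OF assms(2), of "- (n + int N * (a - b))" a \<tau> u] by (simp add: algebra_simps)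
    moreover have "corr_arg N \<tau> (v + of_int (a - b) / 2 * \<tau>) n = corr_arg N \<tau> v (n + int N * (a - b))"
    proof -
      have "Im (v + of_int (a - b) / 2 * \<tau>) = Im v + of_int (a - b) / 2 * Im \<tau>"
        by simp
      then show ?thesis
        using assms by (simp add: corr_arg_def field_simps)
    qed
    moreover have "corr_exp N \<tau> (v + of_int (a - b) / 2 * \<tau>) n
        * e2pi (- (of_nat N * of_int (a + b) * u / 2) - of_nat N * (of_int (a + b))\<^sup>2 * \<tau> / 4)
      = ?e * corr_exp N \<tau> v (n + int N * (a - b))"
      unfolding corr_exp_def e2pi_add[symmetric] z using assms(2)
      by (intro arg_cong[of _ _ e2pi]) (simp add: field_simps power2_eq_square)
    ultimately show ?thesis
      unfolding Theta_add_tau[OF assms(2)] corr_term_def by simp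
  qed
  have 2: "corr N s \<tau> (u + of_int (a + b) * \<tau>) (v + of_int (a - b) / 2 * \<tau>)
      = ?e * corr N (s + int N * (a - b)) \<tau> u v"
    unfolding corr_def t infsum_cmult_right' infsum_shift_int[of "\<lambda>n. corr_term N _ \<tau> v n * Theta (- n) N \<tau> u"]
    by simp
  have 3: "z1 + of_int a * \<tau> + (z2 + of_int b * \<tau>) = u + of_int (a + b) * \<tau>"
    "(z1 + of_int a * \<tau> - (z2 + of_int b * \<tau>)) / 2 = v + of_int (a - b) / 2 * \<tau>"
    by (simp_all add: u_def v_def field_simps)
  show ?thesis
    unfolding capp_def 3 1 2 by (simp add: distrib_left u_def v_def)
qed

lemma capp_add_int:
  assumes "N > 0"
  shows "capp N s \<tau> (z1 + of_int a) (z2 + of_int b) = capp N s \<tau> z1 z2"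
proof -
  define u v where "u = z1 + z2" and "v = (z1 - z2) / 2"
  have "appell_term N s \<tau> (u + of_int (a + b)) (z1 + of_int a) j = appell_term N s \<tau> u z1 j" for j
    unfolding appell_term_def
  proof (intro arg_cong2[of _ _ _ _ "(/)"] arg_cong2[of _ _ _ _ "(-)"] refl)
    show "e2pi (of_nat N * (of_int j * (u + of_int (a + b)) + (of_int j)\<^sup>2 * \<tau>) - of_int s * (z1 + of_int a + of_int j * \<tau>))
      = e2pi (of_nat N * (of_int j * u + (of_int j)\<^sup>2 * \<tau>) - of_int s * (z1 + of_int j * \<tau>))"
      by (rule e2pi_eqI[of _ _ "int N * j * (a + b) - s * a"]) (simp add: algebra_simps)
    show "e2pi (z1 + of_int a + of_int j * \<tau>) = e2pi (z1 + of_int j * \<tau>)"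
      by (rule e2pi_eqI[of _ _ a]) simp
  qed
  then have 1: "appell N s \<tau> (u + of_int (a + b)) (z1 + of_int a) = appell N s \<tau> u z1"
    unfolding appell_def by (rule infsum_cong)
  have "corr_term N s \<tau> (v + of_int (a - b) / 2) n * Theta (- n) N \<tau> (u + of_int (a + b))
      = corr_term N s \<tau> v n * Theta (- n) N \<tau> u" for n
  proof -
    have "corr_exp N \<tau> (v + of_int (a - b) / 2) n * e2pi (of_int (- n * (a + b)) / 2) = corr_exp N \<tau> v n"
      unfolding corr_exp_def e2pi_add[symmetric]
      by (rule e2pi_eqI[of _ _ "- n * a"]) (simp add: field_simps)
    moreover have "corr_arg N \<tau> (v + of_int (a - b) / 2) n = corr_arg N \<tau> v n"
      by (simp add: corr_arg_def)
    ultimately show ?thesis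
      unfolding Theta_add_int[OF assms] corr_term_def by simp
  qed
  then have 2: "corr N s \<tau> (u + of_int (a + b)) (v + of_int (a - b) / 2) = corr N s \<tau> u v"
    unfolding corr_def by simp
  have 3: "z1 + of_int a + (z2 + of_int b) = u + of_int (a + b)"
    "(z1 + of_int a - (z2 + of_int b)) / 2 = v + of_int (a - b) / 2"
    by (simp_all add: u_def v_def field_simps)
  show ?thesis
    unfolding capp_def 3 1 2 by (simp add: u_def v_def)
qed

lemma Phi1_eq_appell: "Phi1 m s \<tau> z1 z2 = appell (m + 1) (int s) \<tau> (z1 + z2) z1"
  unfolding Phi1_def appell_def appell_term_def qpow_def
proof (intro infsum_cong arg_cong2[of _ _ _ _ "(/)"])
  fix j :: int
  show "e2pi (of_nat (m + 1) * of_int j * (z1 + z2)) * e2pi (- (of_nat s * z1))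
      * e2pi (of_real ((of_int j)\<^sup>2 * real (m + 1) - of_int j * real s) * \<tau>)
    = e2pi (of_nat (m + 1) * (of_int j * (z1 + z2) + (of_int j)\<^sup>2 * \<tau>) - of_int (int s) * (z1 + of_int j * \<tau>))"
    unfolding e2pi_add[symmetric] by (rule arg_cong[of _ _ e2pi]) (simp add: algebra_simps)
  show "1 - e2pi z1 * e2pi (of_real (of_int j) * \<tau>) = 1 - e2pi (z1 + of_int j * \<tau>)"
    by (simp add: e2pi_add)
qed

text \<open>For \<open>n \<equiv> - j\<close> modulo \<open>2 * N\<close> and \<open>- s \<le> j < 2 * N - s\<close> the sign in \<open>Rfun\<close> is that of \<open>n - s - 1 / 2\<close>.\<close>

lemma Rfun_eq_corr:
  assumes "N > 0" and j: "j \<in> {- s..<- s + 2 * int N}"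
  shows "Rfun j N \<tau> v = (\<Sum>\<^sub>\<infinity>k. corr_term N s \<tau> v (2 * int N * k + (- j)))"
proof -
  let ?A = "{n::int. [n = - j] (mod 2 * int N)}"
  have bij: "bij_betw (\<lambda>k. 2 * int N * k + (- j)) UNIV ?A"
  proof (rule bij_betw_byWitness[where f' = "\<lambda>n. (n + j) div (2 * int N)"])
    show "\<forall>n\<in>?A. 2 * int N * ((n + j) div (2 * int N)) + - j = n"
      by (auto simp: cong_iff_dvd_diff)
  qed (use assms(1) in \<open>auto simp: cong_iff_dvd_diff\<close>)
  have "Rfun j N \<tau> v = (\<Sum>\<^sub>\<infinity>n\<in>?A. corr_term N s \<tau> v n)"
    unfolding Rfun_def
  proof (rule infsum_cong)
    fix n assume "n \<in> ?A"
    then have "2 * int N dvd n + j"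
      by (simp add: cong_iff_dvd_diff)
    then obtain l where l: "n = 2 * int N * l - j"
      by (metis add_diff_cancel_right' dvdE)
    have "sgn (real_of_int n + 1 / 2 + of_int j - 2 * real N) = sgn (of_int n - of_int s - 1 / 2)"
    proof (cases "l \<ge> 1")
      case True
      then have "2 * int N * 1 \<le> 2 * int N * l"
        by (intro mult_left_mono) auto
      then have "n + j - 2 * int N \<ge> 0" "n - s \<ge> 1"
        using j unfolding l atLeastLessThan_iff by linarith+
      then have "real_of_int n + 1 / 2 + of_int j - 2 * real N > 0" "real_of_int n - of_int s - 1 / 2 > 0"
        by linarith+
      then show ?thesis by simp
    next
      case False
      then have "2 * int N * l \<le> 2 * int N * 0"
        by (intro mult_left_mono) auto
      then have "n + j \<le> 0" "n - s \<le> 0"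
        using j unfolding l atLeastLessThan_iff by linarith+
      then have "real_of_int n + 1 / 2 + of_int j - 2 * real N < 0" "real_of_int n - of_int s - 1 / 2 < 0"
        using assms(1) by linarith+
      then show ?thesis by simp
    qed
    moreover have "exp (- (of_real pi * \<i> * (of_int n)\<^sup>2 / (2 * of_nat N) * \<tau>) - 2 * of_real pi * \<i> * of_int n * v)
        = corr_exp N \<tau> v n"
      unfolding corr_exp_def e2pi_def using assms(1) by (intro arg_cong[of _ _ exp]) (simp add: field_simps)
    ultimately show "of_real (sgn (of_int n + 1 / 2 + of_int j - 2 * real N)
           - Efun ((of_int n + 2 * real N * Im v / Im \<tau>) * sqrt (Im \<tau> / real N)))
        * exp (- (of_real pi * \<i> * (of_int n)\<^sup>2 / (2 * of_nat N) * \<tau>)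
               - 2 * of_real pi * \<i> * of_int n * v) = corr_term N s \<tau> v n"
      by (simp add: corr_term_def corr_arg_def)
  qed
  then show ?thesis
    using infsum_reindex_bij_betw[OF bij, of "corr_term N s \<tau> v"] by simp
qed

text \<open>
  The sum over \<open>j\<close> in \<open>Phi_add\<close> meets every residue modulo \<open>2 * N\<close> once, so it is a single sum over
  the integers. The map \<open>(z1, z2) \<mapsto> (- z2, - z1)\<close> fixes \<open>(z1 - z2) / 2\<close> and changes the sign of
  \<open>z1 + z2\<close>, which exchanges \<open>Theta j\<close> and \<open>Theta (- j)\<close>.
\<close>

lemma Phi_mod_eq_capp:
  assumes "Im \<tau> > 0"
  shows "Phi_mod m s \<tau> z1 z2 t = e2pi (of_nat (m + 1) * t)
    * (capp (m + 1) (int s) \<tau> z1 z2 - capp (m + 1) (int s) \<tau> (- z2) (- z1))"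
proof -
  define N where "N = m + 1"
  have N: "N > 0" by (simp add: N_def)
  define u v where "u = z1 + z2" and "v = (z1 - z2) / 2"
  let ?c = "corr_term N (int s) \<tau> v"
  let ?I = "{- int s..<- int s + 2 * int N}"
  let ?T = "\<lambda>n. Theta (- n) N \<tau> u - Theta n N \<tau> u"
  have s1: "(\<lambda>n. ?c n * Theta (- n) N \<tau> u) summable_on UNIV"
    by (rule summable_corr[OF assms N])
  have s2: "(\<lambda>n. ?c n * Theta n N \<tau> u) summable_on UNIV"
    using summable_corr[OF assms N, of "int s" v "- u"] by (simp add: Theta_uminus[OF N])
  have s: "(\<lambda>n. ?c n * ?T n) summable_on UNIV"
    using summable_on_add[OF s1 summable_on_uminus[THEN iffD2, OF s2]] by (simp add: algebra_simps)
  have bij: "bij_betw (\<lambda>d. - d mod int (2 * N)) ?I {0..<int (2 * N)}"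
    using bij_betw_residues[of "int (2 * N)" "-1" 0 "- int s"] N by simp
  have "(\<Sum>j\<in>?I. Rfun j N \<tau> v * (Theta j N \<tau> u - Theta (- j) N \<tau> u))
      = (\<Sum>j\<in>?I. \<Sum>\<^sub>\<infinity>k. ?c (int (2 * N) * k + (- j)) * ?T (int (2 * N) * k + (- j)))"
  proof (rule sum.cong[OF refl])
    fix j assume j: "j \<in> ?I"
    have "?T (int (2 * N) * k + (- j)) = Theta j N \<tau> u - Theta (- j) N \<tau> u" for k
      using Theta_shift[OF N, of j "- k" \<tau> u] Theta_shift[OF N, of "- j" k \<tau> u] by (simp add: algebra_simps)
    then show "Rfun j N \<tau> v * (Theta j N \<tau> u - Theta (- j) N \<tau> u)
        = (\<Sum>\<^sub>\<infinity>k. ?c (int (2 * N) * k + (- j)) * ?T (int (2 * N) * k + (- j)))"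
      by (simp only: Rfun_eq_corr[OF N j] infsum_cmult_left') simp
  qed
  also have "\<dots> = (\<Sum>\<^sub>\<infinity>n. ?c n * ?T n)"
    by (rule infsum_residues(1)[OF _ _ s bij, symmetric]) (use N in auto)
  also have "\<dots> = (\<Sum>\<^sub>\<infinity>n. ?c n * Theta (- n) N \<tau> u) - (\<Sum>\<^sub>\<infinity>n. ?c n * Theta n N \<tau> u)"
    using infsum_add[OF s1 summable_on_uminus[THEN iffD2, OF s2]] by (simp add: infsum_uminus algebra_simps)
  also have "\<dots> = 2 * (corr N (int s) \<tau> u v - corr N (int s) \<tau> (- u) v)"
    by (simp add: corr_def Theta_uminus[OF N])
  finally have R: "(\<Sum>j\<in>?I. Rfun j N \<tau> v * (Theta j N \<tau> u - Theta (- j) N \<tau> u))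
      = 2 * (corr N (int s) \<tau> u v - corr N (int s) \<tau> (- u) v)" .
  have I: "{- int s..- int s + 2 * int m + 1} = ?I"
    by (auto simp: N_def)
  have uv: "- z2 + - z1 = - u" "(- z2 - - z1) / 2 = v"
    by (simp_all add: u_def v_def)
  have "Phi_add m s \<tau> z1 z2 t
      = e2pi (of_nat N * t) * (corr N (int s) \<tau> u v - corr N (int s) \<tau> (- u) v)"
    using R unfolding Phi_add_def I N_def[symmetric] u_def[symmetric] v_def[symmetric] by simp
  then show ?thesis
    unfolding Phi_mod_def Phi_def Phi1_eq_appell capp_def uv N_def[symmetric] u_def[symmetric] v_def[symmetric]
    by (simp add: algebra_simps)
qed

section \<open>Splitting the Appell function at level \<open>M\<close>\<close>

text \<open>
  The summands of the splitting. At \<open>z1 = - z + e\<close> and \<open>z2 = z + e\<close> they are, up to constant phases,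
  the two halves of \<open>Psi_mod\<close>.
\<close>

definition level_term :: "nat \<Rightarrow> nat \<Rightarrow> complex \<Rightarrow> complex \<Rightarrow> complex \<Rightarrow> int \<Rightarrow> int \<Rightarrow> complex" where
  "level_term N M \<tau> z1 z2 a b =
     e2pi (of_nat N / of_nat M * (of_int (a * b) * \<tau> + of_int b * z1 + of_int a * z2))
     * capp N 0 (of_nat M * \<tau>) (z1 + of_int a * \<tau>) (z2 + of_int b * \<tau>)"

lemma lat_add_tau_iff: "z + of_int a * \<tau> \<in> lat \<tau> \<longleftrightarrow> z \<in> lat \<tau>"
proof -
  have *: "z + of_int a * \<tau> \<in> lat \<tau>" if "z \<in> lat \<tau>" for z a
  proof -
    from that obtain p r :: int where "z = of_int p * \<tau> + of_int r"
      unfolding lat_def by auto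
    then have "z + of_int a * \<tau> = of_int (p + a) * \<tau> + of_int r"
      by (simp add: algebra_simps)
    then show ?thesis unfolding lat_def by blast
  qed
  show ?thesis
    using *[of "z + of_int a * \<tau>" "- a"] *[of z a] by auto
qed

lemma lat_mult_subset: "z \<in> lat (of_nat M * \<tau>) \<Longrightarrow> z \<in> lat \<tau>"
proof -
  assume "z \<in> lat (of_nat M * \<tau>)"
  then obtain p r :: int where "z = of_int p * (of_nat M * \<tau>) + of_int r"
    unfolding lat_def by auto
  then have "z = of_int (p * int M) * \<tau> + of_int r"
    by simp
  then show ?thesis unfolding lat_def by blast
qed

text \<open>
  The exponential factor is the one that offsets the translation behaviour of \<open>capp\<close> at \<open>M * \<tau>\<close>.
\<close>

lemma level_term_mod:
  assumes "Im \<tau> > 0" "N > 0" "M > 0" "z1 \<notin> lat \<tau>"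
  shows "level_term N M \<tau> z1 z2 (a + int M * k) (b + int M * l) = level_term N M \<tau> z1 z2 a b"
proof -
  have im: "Im (of_nat M * \<tau>) > 0" using assms by simp
  have z: "z1 + of_int a * \<tau> \<notin> lat (of_nat M * \<tau>)"
    using assms(4) lat_mult_subset lat_add_tau_iff by blast
  have e: "z1 + of_int (a + int M * k) * \<tau> = z1 + of_int a * \<tau> + of_int k * (of_nat M * \<tau>)"
    "z2 + of_int (b + int M * l) * \<tau> = z2 + of_int b * \<tau> + of_int l * (of_nat M * \<tau>)"
    by (simp_all add: algebra_simps)
  have "e2pi (of_nat N / of_nat M * (of_int ((a + int M * k) * (b + int M * l)) * \<tau>
          + of_int (b + int M * l) * z1 + of_int (a + int M * k) * z2))
        * e2pi (- of_nat N * (of_int (k * l) * (of_nat M * \<tau>) + of_int l * (z1 + of_int a * \<tau>) + of_int k * (z2 + of_int b * \<tau>)))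
      = e2pi (of_nat N / of_nat M * (of_int (a * b) * \<tau> + of_int b * z1 + of_int a * z2))"
    unfolding e2pi_add[symmetric] using assms(3) by (intro arg_cong[of _ _ e2pi]) (simp add: field_simps)
  from arg_cong[OF this, of "\<lambda>x. x * capp N 0 (of_nat M * \<tau>) (z1 + of_int a * \<tau>) (z2 + of_int b * \<tau>)"]
  show ?thesis
    unfolding level_term_def e capp_add_tau[OF im assms(2)]
      capp_indep[OF im assms(2) z, of "0 + int N * (k - l)"] by (simp only: mult.assoc)
qed

lemma infsum_finite_sum:
  fixes f :: "'a \<Rightarrow> 'b \<Rightarrow> complex"
  assumes "finite I" "\<And>d. d \<in> I \<Longrightarrow> f d summable_on A"
  shows "(\<Sum>\<^sub>\<infinity>n\<in>A. \<Sum>d\<in>I. f d n) = (\<Sum>d\<in>I. infsum (f d) A)"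
proof -
  have "(\<Sum>\<^sub>\<infinity>n\<in>A. \<Sum>d\<in>I. f d n) = (\<Sum>d\<in>I. infsum (f d) A) \<and> (\<lambda>n. \<Sum>d\<in>I. f d n) summable_on A"
    using assms by (induction I) (auto simp: infsum_add summable_on_add)
  then show ?thesis ..
qed

text \<open>
  In \<open>1 / (1 - X) = (\<Sum>k<M. X ^ k) / (1 - X ^ M)\<close> the exponents \<open>k\<close> are the residues of \<open>- N * d\<close>
  modulo \<open>M\<close>; the free parameter \<open>s\<close> absorbs the quotients.
\<close>

lemma appell_level:
  assumes "Im \<tau> > 0" "N > 0" "M > 0" "coprime N M" and z: "z1 \<notin> lat \<tau>"
  shows "appell N 0 (\<tau> / of_nat M) (u / of_nat M) (z1 / of_nat M)
    = (\<Sum>a\<in>{0..<int M}. \<Sum>d\<in>{0..<int M}.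
        e2pi (of_nat N / of_nat M * (of_int (a * (a - d)) * \<tau> + of_int a * u - of_int d * z1))
        * appell N (- (int N * d) div int M) (of_nat M * \<tau>) (u + of_int (2 * a - d) * \<tau>) (z1 + of_int a * \<tau>))"
proof -
  let ?M = "of_nat M :: complex"
  let ?D = "{0..<int M}"
  define S where "S d = - (int N * d) div int M" for d
  define k where "k d = - (int N * d) mod int M" for d
  have imM: "Im (\<tau> / ?M) > 0" "Im (?M * \<tau>) > 0"
    using assms by (simp_all add: Im_divide_of_nat)
  have bij1: "bij_betw (\<lambda>d. d mod int M) ?D {0..<int M}"
    using bij_betw_residues[of "int M" 1 0 0] assms(3) by simp
  \<comment> \<open>Here the coprimality of \<open>N\<close> and \<open>M\<close> enters.\<close>
  have bij2: "bij_betw k ?D {0..<int M}"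
    using bij_betw_residues[of "int M" "- int N" 0 0] assms(3,4) by (simp add: k_def[abs_def])
  have bij3: "bij_betw (\<lambda>d. nat (k d)) ?D {..<M}"
  proof -
    have "bij_betw nat {0..<int M} {..<M}"
      by (rule bij_betw_byWitness[where f' = int]) auto
    from bij_betw_trans[OF bij2 this] show ?thesis by (simp add: o_def)
  qed
  have Sk: "of_int (k d) = - (of_nat N * of_int d) - ?M * (of_int (S d) :: complex)" for d
  proof -
    have "k d = - (int N * d) - int M * S d"
      by (simp add: k_def S_def minus_mult_div_eq_mod)
    then show ?thesis by simp
  qed
  let ?p = "\<lambda>a d. e2pi (of_nat N / ?M * (of_int (a * (a - d)) * \<tau> + of_int a * u - of_int d * z1))"
  let ?A = "\<lambda>a d. appell_term N (S d) (?M * \<tau>) (u + of_int (2 * a - d) * \<tau>) (z1 + of_int a * \<tau>)"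
  have "appell N 0 (\<tau> / ?M) (u / ?M) (z1 / ?M)
      = (\<Sum>a\<in>?D. \<Sum>\<^sub>\<infinity>i. appell_term N 0 (\<tau> / ?M) (u / ?M) (z1 / ?M) (int M * i + a))"
    unfolding appell_def
    by (rule infsum_residues(1)[OF _ assms(3) summable_appell[OF imM(1) assms(2)] bij1]) auto
  also have "\<dots> = (\<Sum>a\<in>?D. \<Sum>d\<in>?D. ?p a d * appell N (S d) (?M * \<tau>) (u + of_int (2 * a - d) * \<tau>) (z1 + of_int a * \<tau>))"
  proof (rule sum.cong[OF refl])
    fix a assume "a \<in> ?D"
    \<comment> \<open>The geometric sum in \<open>X\<close>, with the exponents in the order \<open>nat (k d)\<close>.\<close>
    have "appell_term N 0 (\<tau> / ?M) (u / ?M) (z1 / ?M) (int M * i + a) = (\<Sum>d\<in>?D. ?p a d * ?A a d i)" for i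
    proof -
      define j where "j = int M * i + a"
      define X where "X = e2pi ((z1 + of_int j * \<tau>) / ?M)"
      define g where "g = e2pi (of_nat N / ?M * (of_int j * u + (of_int j)\<^sup>2 * \<tau>))"
      have XM: "X ^ M = e2pi (z1 + of_int j * \<tau>)"
        unfolding X_def e2pi_power using assms(3) by simp
      then have XM1: "X ^ M \<noteq> 1"
        using e2pi_eq_1_imp_lat z by auto
      then have X1: "X \<noteq> 1" by auto
      have dk: "g * X ^ nat (k d) / (1 - X ^ M) = ?p a d * ?A a d i" for d
      proof -
        have "g * X ^ nat (k d) = e2pi (of_nat N / ?M * (of_int j * u + (of_int j)\<^sup>2 * \<tau>) + of_int (k d) * ((z1 + of_int j * \<tau>) / ?M))"
          using assms(3) by (simp add: g_def X_def e2pi_power e2pi_add k_def)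
        also have "\<dots> = ?p a d * e2pi (of_nat N * (of_int i * (u + of_int (2 * a - d) * \<tau>) + (of_int i)\<^sup>2 * (?M * \<tau>))
            - of_int (S d) * (z1 + of_int a * \<tau> + of_int i * (?M * \<tau>)))"
          unfolding e2pi_add[symmetric] Sk j_def using assms(3)
          by (intro arg_cong[of _ _ e2pi]) (simp add: field_simps power2_eq_square)
        finally show ?thesis
          unfolding appell_term_def XM j_def by (simp add: algebra_simps)
      qed
      have "appell_term N 0 (\<tau> / ?M) (u / ?M) (z1 / ?M) j = g / (1 - X)"
        by (simp add: appell_term_def g_def X_def add_divide_distrib algebra_simps)
      also have "\<dots> = (\<Sum>l<M. g * X ^ l / (1 - X ^ M))"
      proof -
        define G where "G = (\<Sum>l<M. X ^ l)"
        have G: "1 - X ^ M = (1 - X) * G"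
          unfolding G_def by (rule one_diff_power_eq)
        have "G \<noteq> 0"
          using G XM1 by auto
        then have "g / (1 - X) = (g * G) / (1 - X ^ M)"
          unfolding G by simp
        then show ?thesis
          by (simp only: G_def sum_divide_distrib sum_distrib_left)
      qed
      also have "\<dots> = (\<Sum>d\<in>?D. g * X ^ nat (k d) / (1 - X ^ M))"
        by (rule sum.reindex_bij_betw[OF bij3, symmetric])
      finally show ?thesis
        unfolding dk j_def .
    qed
    then have "(\<Sum>\<^sub>\<infinity>i. appell_term N 0 (\<tau> / ?M) (u / ?M) (z1 / ?M) (int M * i + a)) = (\<Sum>\<^sub>\<infinity>i. \<Sum>d\<in>?D. ?p a d * ?A a d i)"
      by (rule infsum_cong)
    also have "\<dots> = (\<Sum>d\<in>?D. \<Sum>\<^sub>\<infinity>i. ?p a d * ?A a d i)"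
      by (intro infsum_finite_sum summable_on_cmult_right summable_appell imM assms(2)) auto
    finally show "(\<Sum>\<^sub>\<infinity>i. appell_term N 0 (\<tau> / ?M) (u / ?M) (z1 / ?M) (int M * i + a))
      = (\<Sum>d\<in>?D. ?p a d * appell N (S d) (?M * \<tau>) (u + of_int (2 * a - d) * \<tau>) (z1 + of_int a * \<tau>))"
      unfolding appell_def infsum_cmult_right' .
  qed
  finally show ?thesis
    unfolding S_def .
qed

text \<open>
  The index of summation is split by its residue \<open>a\<close> modulo \<open>M\<close>.
\<close>

lemma Theta_level:
  assumes "Im \<tau> > 0" "N > 0" "M > 0"
  shows "Theta (- (int M * n + int N * d)) N (\<tau> / of_nat M) (u / of_nat M)
    = (\<Sum>a\<in>{0..<int M}. e2pi (of_nat N / of_nat M * (of_int (2 * a - d) * u / 2 + (of_int (2 * a - d))\<^sup>2 * \<tau> / 4))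
        * Theta (- n) N (of_nat M * \<tau>) (u + of_int (2 * a - d) * \<tau>))"
proof -
  let ?M = "of_nat M :: complex"
  let ?K = "- (int M * n + int N * d)"
  let ?t = "\<lambda>i. theta_term N (\<tau> / ?M) (u / ?M) (2 * int N * i + ?K)"
  let ?f = "\<lambda>a. e2pi (of_nat N / ?M * (of_int (2 * a - d) * u / 2 + (of_int (2 * a - d))\<^sup>2 * \<tau> / 4))"
  have imM: "Im (\<tau> / ?M) > 0" "Im (?M * \<tau>) > 0"
    using assms by (simp_all add: Im_divide_of_nat)
  have bij1: "bij_betw (\<lambda>d. d mod int M) {0..<int M} {0..<int M}"
    using bij_betw_residues[of "int M" 1 0 0] assms(3) by simp
  have s: "?t summable_on UNIV"
  proof -
    have "theta_term N (\<tau> / ?M) (u / ?M) summable_on range (\<lambda>i. 2 * int N * i + ?K)"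
      by (rule summable_on_subset_banach[OF summable_theta_term[OF imM(1) assms(2)]]) auto
    moreover have "inj (\<lambda>i. 2 * int N * i + ?K)"
      using assms(2) by (auto simp: inj_on_def)
    ultimately show ?thesis by (simp add: summable_on_reindex o_def)
  qed
  have t: "?t (int M * i + a) = ?f a * theta_term N (?M * \<tau>) (u + of_int (2 * a - d) * \<tau>) (2 * int N * i + - n)" for a i
    unfolding theta_term_def e2pi_add[symmetric] using assms(2,3)
    by (intro arg_cong[of _ _ e2pi]) (simp add: field_simps power2_eq_square)
  have "Theta ?K N (\<tau> / ?M) (u / ?M) = (\<Sum>a\<in>{0..<int M}. \<Sum>\<^sub>\<infinity>i. ?t (int M * i + a))"
    unfolding Theta_eq[OF assms(2)] by (rule infsum_residues(1)[OF _ assms(3) s bij1]) auto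
  then show ?thesis
    unfolding t infsum_cmult_right' Theta_eq[OF assms(2)] .
qed

text \<open>
  The quotient \<open>S\<close> of \<open>- (N * d)\<close> by \<open>M\<close> in \<open>appell_level\<close> is also the place where the sign changes:
  \<open>M * n + N * d > 0\<close> holds iff \<open>n > S\<close>.
\<close>

lemma corr_term_level:
  assumes "Im \<tau> > 0" "N > 0" "M > 0"
  shows "corr_term N 0 (\<tau> / of_nat M) (v / of_nat M) (int M * n + int N * d)
    = e2pi (- (of_nat N / of_nat M * ((of_int d)\<^sup>2 * \<tau> / 4 + of_int d * v)))
      * corr_term N (- (int N * d) div int M) (of_nat M * \<tau>) (v + of_int d / 2 * \<tau>) n"
proof -
  let ?M = "of_nat M :: complex"
  define S where "S = - (int N * d) div int M"
  define k where "k = - (int N * d) mod int M"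
  have k: "0 \<le> k" "k < int M" "int N * d = - (int M * S) - k"
  proof -
    show "0 \<le> k" "k < int M" using assms(3) by (simp_all add: k_def)
    have "- (int N * d) = int M * S + k" by (simp add: S_def k_def)
    then show "int N * d = - (int M * S) - k" by simp
  qed
  have 1: "sgn (of_int (int M * n + int N * d) - of_int 0 - 1 / 2) = sgn (real_of_int n - of_int S - 1 / 2)"
  proof (cases "n \<ge> S + 1")
    case True
    then have "int M * 1 \<le> int M * (n - S)"
      by (intro mult_left_mono) auto
    then have "int M * n + int N * d \<ge> 1"
      using k unfolding k(3) right_diff_distrib by linarith
    then have "real_of_int (int M * n + int N * d) \<ge> 1"
      by linarith
    then show ?thesis
      using True by simp
  next
    case False
    then have "int M * (n - S) \<le> int M * 0"
      by (intro mult_left_mono) auto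
    then have "int M * n + int N * d \<le> 0"
      using k unfolding k(3) right_diff_distrib by linarith
    then have "real_of_int (int M * n + int N * d) \<le> 0"
      by linarith
    moreover have "real_of_int n - of_int S - 1 / 2 < 0"
      using False by linarith
    ultimately show ?thesis by simp
  qed
  have 2: "corr_arg N (\<tau> / ?M) (v / ?M) (int M * n + int N * d) = corr_arg N (?M * \<tau>) (v + of_int d / 2 * \<tau>) n"
  proof -
    have im: "Im (v + of_int d / 2 * \<tau>) = Im v + of_int d / 2 * Im \<tau>"
      by simp
    define r where "r = sqrt (Im \<tau> / (real M * real N))"
    have "sqrt (real M * Im \<tau> / real N) = sqrt ((real M)\<^sup>2 * (Im \<tau> / (real M * real N)))"
      using assms(3) by (simp add: power2_eq_square)
    also have "\<dots> = real M * r"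
      by (simp only: r_def real_sqrt_mult real_sqrt_abs abs_of_nat)
    finally have r: "sqrt (Im (?M * \<tau>) / real N) = real M * r" "sqrt (Im (\<tau> / ?M) / real N) = r"
      by (simp_all add: r_def Im_divide_of_nat)
    show ?thesis
      unfolding corr_arg_def im r using assms by (simp add: Im_divide_of_nat field_simps)
  qed
  have 3: "corr_exp N (\<tau> / ?M) (v / ?M) (int M * n + int N * d)
      = e2pi (- (of_nat N / ?M * ((of_int d)\<^sup>2 * \<tau> / 4 + of_int d * v))) * corr_exp N (?M * \<tau>) (v + of_int d / 2 * \<tau>) n"
    unfolding corr_exp_def e2pi_add[symmetric] using assms(2,3)
    by (intro arg_cong[of _ _ e2pi]) (simp add: field_simps power2_eq_square)
  show ?thesis
    unfolding corr_term_def 1 2 3 S_def by simp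
qed

lemma corr_level:
  assumes "Im \<tau> > 0" "N > 0" "M > 0" "coprime N M"
  shows "corr N 0 (\<tau> / of_nat M) (u / of_nat M) (v / of_nat M)
    = (\<Sum>a\<in>{0..<int M}. \<Sum>d\<in>{0..<int M}.
        e2pi (of_nat N / of_nat M * (of_int (a * (a - d)) * \<tau> + of_int (2 * a - d) * u / 2 - of_int d * v))
        * corr N (- (int N * d) div int M) (of_nat M * \<tau>) (u + of_int (2 * a - d) * \<tau>) (v + of_int d / 2 * \<tau>))"
proof -
  let ?M = "of_nat M :: complex"
  let ?D = "{0..<int M}"
  have imM: "Im (\<tau> / ?M) > 0" "Im (?M * \<tau>) > 0"
    using assms by (simp_all add: Im_divide_of_nat)
  define S where "S d = - (int N * d) div int M" for d
  have bij: "bij_betw (\<lambda>d. int N * d mod int M) ?D {0..<int M}"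
    using bij_betw_residues[of "int M" "int N" 0 0] assms(3,4) by simp
  let ?p = "\<lambda>a d. e2pi (of_nat N / ?M * (of_int (a * (a - d)) * \<tau> + of_int (2 * a - d) * u / 2 - of_int d * v))"
  let ?C = "\<lambda>a d n. corr_term N (S d) (?M * \<tau>) (v + of_int d / 2 * \<tau>) n * Theta (- n) N (?M * \<tau>) (u + of_int (2 * a - d) * \<tau>)"
  let ?h = "\<lambda>K. corr_term N 0 (\<tau> / ?M) (v / ?M) K * Theta (- K) N (\<tau> / ?M) (u / ?M)"
  have h: "?h (int M * n + int N * d) = (\<Sum>a\<in>?D. ?p a d * ?C a d n)" for n d
  proof -
    have p: "e2pi (- (of_nat N / ?M * ((of_int d)\<^sup>2 * \<tau> / 4 + of_int d * v)))
      * e2pi (of_nat N / ?M * (of_int (2 * a - d) * u / 2 + (of_int (2 * a - d))\<^sup>2 * \<tau> / 4)) = ?p a d" for a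
      unfolding e2pi_add[symmetric] using assms(3)
      by (intro arg_cong[of _ _ e2pi]) (simp add: field_simps power2_eq_square)
    show ?thesis
      unfolding corr_term_level[OF assms(1-3)] Theta_level[OF assms(1-3)] sum_distrib_left p[symmetric] S_def[symmetric]
      by (simp only: mult_ac)
  qed
  have "(\<Sum>\<^sub>\<infinity>K. ?h K) = (\<Sum>d\<in>?D. \<Sum>\<^sub>\<infinity>n. ?h (int M * n + int N * d))"
    by (rule infsum_residues(1)[OF _ assms(3) summable_corr[OF imM(1) assms(2)] bij]) auto
  also have "\<dots> = (\<Sum>d\<in>?D. \<Sum>a\<in>?D. ?p a d * (\<Sum>\<^sub>\<infinity>n. ?C a d n))"
    unfolding h infsum_cmult_right'[symmetric]
    by (intro sum.cong infsum_finite_sum summable_on_cmult_right summable_corr imM assms(2)) auto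
  also have "\<dots> = (\<Sum>a\<in>?D. \<Sum>d\<in>?D. ?p a d * (\<Sum>\<^sub>\<infinity>n. ?C a d n))"
    by (rule sum.swap)
  finally show ?thesis
    unfolding corr_def S_def[symmetric] by (simp add: sum_distrib_left mult_ac)
qed

text \<open>
  Both parts of \<open>capp\<close> split with the same exponential factors and the same values of \<open>s\<close>, which
  \<open>capp_indep\<close> then resets to 0.
\<close>

lemma capp_level:
  assumes "Im \<tau> > 0" "N > 0" "M > 0" "coprime N M" and z: "z1 \<notin> lat \<tau>"
  shows "capp N 0 (\<tau> / of_nat M) (z1 / of_nat M) (z2 / of_nat M)
    = (\<Sum>a\<in>{0..<int M}. \<Sum>b\<in>{0..<int M}. level_term N M \<tau> z1 z2 a b)"
proof -
  let ?M = "of_nat M :: complex"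
  let ?D = "{0..<int M}"
  define u v where "u = z1 + z2" and "v = (z1 - z2) / 2"
  define S where "S d = - (int N * d) div int M" for d
  have imM: "Im (?M * \<tau>) > 0"
    using assms by simp
  have M: "?M \<noteq> 0" using assms by simp
  let ?p = "\<lambda>a d. e2pi (of_nat N / ?M * (of_int (a * (a - d)) * \<tau> + of_int (a - d) * z1 + of_int a * z2))"
  have p: "of_int (a * (a - d)) * \<tau> + of_int a * u - of_int d * z1
      = of_int (a * (a - d)) * \<tau> + of_int (a - d) * z1 + of_int a * z2"
    "of_int (a * (a - d)) * \<tau> + of_int (2 * a - d) * u / 2 - of_int d * v
      = of_int (a * (a - d)) * \<tau> + of_int (a - d) * z1 + of_int a * z2" for a d
    by (simp_all add: u_def v_def field_simps)
  have lt: "level_term N M \<tau> z1 z2 a (a - d) = ?p a d * appell N (S d) (?M * \<tau>) (u + of_int (2 * a - d) * \<tau>) (z1 + of_int a * \<tau>)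
      + ?p a d * corr N (S d) (?M * \<tau>) (u + of_int (2 * a - d) * \<tau>) (v + of_int d / 2 * \<tau>)" for a d
  proof -
    have za: "z1 + of_int a * \<tau> \<notin> lat (?M * \<tau>)"
      using z lat_mult_subset lat_add_tau_iff by blast
    have e: "z1 + of_int a * \<tau> + (z2 + of_int (a - d) * \<tau>) = u + of_int (2 * a - d) * \<tau>"
      "(z1 + of_int a * \<tau> - (z2 + of_int (a - d) * \<tau>)) / 2 = v + of_int d / 2 * \<tau>"
      by (simp_all add: u_def v_def field_simps)
    show ?thesis
      unfolding level_term_def capp_indep[OF imM assms(2) za, of "S d", symmetric]
      unfolding capp_def e distrib_left by (simp add: add.assoc)
  qed
  have "capp N 0 (\<tau> / ?M) (z1 / ?M) (z2 / ?M)
      = appell N 0 (\<tau> / ?M) (u / ?M) (z1 / ?M) + corr N 0 (\<tau> / ?M) (u / ?M) (v / ?M)"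
    unfolding capp_def u_def v_def by (simp add: add_divide_distrib diff_divide_distrib mult.commute)
  also have "\<dots> = (\<Sum>a\<in>?D. \<Sum>d\<in>?D. level_term N M \<tau> z1 z2 a (a - d))"
    unfolding appell_level[OF assms] corr_level[OF assms(1-4)] lt sum.distrib S_def p ..
  also have "\<dots> = (\<Sum>a\<in>?D. \<Sum>b\<in>?D. level_term N M \<tau> z1 z2 a b)"
  proof (rule sum.cong[OF refl])
    fix a
    have bij: "bij_betw (\<lambda>d. (a - d) mod int M) ?D ?D"
      using bij_betw_residues[of "int M" "-1" a 0] assms(3) by simp
    have "level_term N M \<tau> z1 z2 a (a - d) = level_term N M \<tau> z1 z2 a ((a - d) mod int M)" for d
      using level_term_mod[OF assms(1-3) z, of z2 a 0 "(a - d) mod int M" "(a - d) div int M"] by simp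
    then show "(\<Sum>d\<in>?D. level_term N M \<tau> z1 z2 a (a - d)) = (\<Sum>b\<in>?D. level_term N M \<tau> z1 z2 a b)"
      using sum.reindex_bij_betw[OF bij, of "level_term N M \<tau> z1 z2 a"] by simp
  qed
  finally show ?thesis .
qed

section \<open>Lattices and a Liouville theorem\<close>

lemma lat_iff: "z \<in> lat \<tau> \<longleftrightarrow> (\<exists>j::int. z + of_int j * \<tau> \<in> \<int>)"
proof
  assume "z \<in> lat \<tau>"
  then obtain p r :: int where "z = of_int p * \<tau> + of_int r"
    unfolding lat_def by auto
  then have "z + of_int (- p) * \<tau> \<in> \<int>"
    by simp
  then show "\<exists>j::int. z + of_int j * \<tau> \<in> \<int>" ..
next
  assume "\<exists>j::int. z + of_int j * \<tau> \<in> \<int>"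
  then show "z \<in> lat \<tau>"
    using e2pi_eq_1_imp_lat by (auto simp: e2pi_eq_1_iff)
qed

lemma eventually_notin_Ints: "eventually (\<lambda>z. z \<notin> \<int>) (at (w::complex))"
proof -
  have "open (- (\<int> - {w}))"
    by (intro open_Compl closed_subset_Ints) auto
  then have "eventually (\<lambda>z. z \<in> - (\<int> - {w})) (at w)"
    by (rule eventually_at_in_open') auto
  moreover have "eventually (\<lambda>z. z \<noteq> w) (at w)"
    by (simp add: eventually_neq_at_within)
  ultimately show ?thesis
    by eventually_elim auto
qed

lemma far_notin_Ints:
  assumes "Im \<tau> > 0" "\<bar>Im z\<bar> \<le> \<rho>" "\<bar>j\<bar> \<ge> \<lceil>(\<rho> + 1) / Im \<tau>\<rceil>"
  shows "z + of_int j * \<tau> \<notin> \<int>"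
proof
  assume "z + of_int j * \<tau> \<in> \<int>"
  then obtain r :: int where "z + of_int j * \<tau> = of_int r"
    by (elim Ints_cases)
  then have "Im (z + of_int j * \<tau>) = 0"
    by (simp only: complex_Im_of_int)
  then show False
    using abs_Im_add_int_mult_ge[OF assms] by simp
qed

lemma eventually_notin_lat:
  assumes "Im \<tau> > 0"
  shows "eventually (\<lambda>z. z \<notin> lat \<tau>) (at w)"
proof -
  define J where "J = \<lceil>(\<bar>Im w\<bar> + 1 + 1) / Im \<tau>\<rceil>"
  have "eventually (\<lambda>z. z + of_int j * \<tau> \<notin> \<int>) (at w)" for j
  proof -
    have "filterlim (\<lambda>z. z + of_int j * \<tau>) (at (w + of_int j * \<tau>)) (at w)"
      by (rule filterlim_atI) (auto intro!: tendsto_intros simp: eventually_neq_at_within)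
    then show ?thesis
      using eventually_notin_Ints[of "w + of_int j * \<tau>"] unfolding filterlim_iff by blast
  qed
  then have 1: "eventually (\<lambda>z. \<forall>j\<in>{-J..J}. z + of_int j * \<tau> \<notin> \<int>) (at w)"
    by (intro eventually_ball_finite) auto
  have 2: "eventually (\<lambda>z. z \<in> ball w 1) (at w)"
    by (rule eventually_at_in_open') auto
  show ?thesis
    using 1 2
  proof eventually_elim
    case (elim z)
    have im: "\<bar>Im z\<bar> \<le> \<bar>Im w\<bar> + 1"
      using abs_Im_le_cmod[of "z - w"] elim(2) by (auto simp: dist_norm norm_minus_commute)
    have "z + of_int j * \<tau> \<notin> \<int>" for j
    proof (cases "j \<in> {-J..J}")
      case False
      then have "J \<le> \<bar>j\<bar>" by auto
      then show ?thesis
        unfolding J_def by (rule far_notin_Ints[OF assms im])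
    qed (use elim in auto)
    then show ?case unfolding lat_iff by blast
  qed
qed

lemma open_Compl_lat:
  assumes "Im \<tau> > 0"
  shows "open (- lat \<tau>)"
  unfolding open_subopen[of "- lat \<tau>"]
proof
  fix w assume w: "w \<in> - lat \<tau>"
  obtain S where "open S" "w \<in> S" "\<forall>z\<in>S. z \<noteq> w \<longrightarrow> z \<notin> lat \<tau>"
    using eventually_notin_lat[OF assms, of w] unfolding eventually_at_topological by auto
  then show "\<exists>T. open T \<and> w \<in> T \<and> T \<subseteq> - lat \<tau>"
    using w by (intro exI[of _ S]) auto
qed

text \<open>
  The hypotheses say that \<open>D\<close> extends to an entire function and that
  \<open>norm (D z) * exp (c * (Im (z - w))\<^sup>2)\<close> is periodic, hence bounded.
\<close>

lemma lattice_liouville: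
  fixes D :: "complex \<Rightarrow> complex" and c :: real
  assumes tau: "Im \<tau> > 0" and c: "c \<ge> 0"
    and hol: "\<And>z. z \<notin> lat \<tau> \<Longrightarrow> D field_differentiable (at z)"
    and lim: "\<And>p. p \<in> lat \<tau> \<Longrightarrow> ((\<lambda>z. (z - p) * D z) \<longlongrightarrow> 0) (at p)"
    and per1: "\<And>z. z \<notin> lat \<tau> \<Longrightarrow> norm (D (z + 1)) = norm (D z)"
    and pert: "\<And>z. z \<notin> lat \<tau> \<Longrightarrow>
      norm (D (z + \<tau>)) * exp (c * (Im (z + \<tau> - w))\<^sup>2) = norm (D z) * exp (c * (Im (z - w))\<^sup>2)"
  obtains k K where "\<And>z. z \<notin> lat \<tau> \<Longrightarrow> D z = k"
    "\<And>z. z \<notin> lat \<tau> \<Longrightarrow> norm k * exp (c * (Im (z - w))\<^sup>2) \<le> K"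
proof -
  define P where "P z = norm (D z) * exp (c * (Im (z - w))\<^sup>2)" for z
  have lat1: "z + of_int p * \<tau> + of_int r \<in> lat \<tau> \<longleftrightarrow> z \<in> lat \<tau>" for z p r
  proof -
    have *: "z + of_int p * \<tau> + of_int r + of_int j * \<tau> \<in> \<int> \<longleftrightarrow> z + of_int (j + p) * \<tau> \<in> \<int>" for j
      using Ints_add[of "z + of_int (j + p) * \<tau>" "of_int r"] Ints_diff[of "z + of_int (j + p) * \<tau> + of_int r" "of_int r"]
      by (auto simp: algebra_simps)
    show ?thesis
      unfolding lat_iff * by (metis diff_add_cancel)
  qed
  have P1: "P (z + of_int r) = P z" if "z \<notin> lat \<tau>" for z r
  proof (induction r rule: int_induct[of _ 0])
    case (step1 i)
    have "z + of_int i \<notin> lat \<tau>" using lat1[of z 0 i] that by simp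
    from per1[OF this] step1 show ?case by (simp add: P_def add.assoc)
  next
    case (step2 i)
    have "z + of_int (i - 1) \<notin> lat \<tau>" using lat1[of z 0 "i - 1"] that by simp
    from per1[OF this] step2 show ?case by (simp add: P_def add.assoc)
  qed simp
  have Pt: "P (z + of_int p * \<tau>) = P z" if "z \<notin> lat \<tau>" for z p
  proof (induction p rule: int_induct[of _ 0])
    case (step1 i)
    have "z + of_int i * \<tau> \<notin> lat \<tau>" using lat1[of z i 0] that by simp
    from pert[OF this] step1 show ?case by (simp add: P_def algebra_simps)
  next
    case (step2 i)
    have "z + of_int (i - 1) * \<tau> \<notin> lat \<tau>" using lat1[of z "i - 1" 0] that by simp
    from pert[OF this] step2 show ?case by (simp add: P_def algebra_simps)
  qed simp
  \<comment> \<open>The singularities of \<open>D\<close> are removable.\<close>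
  define g where "g z = (if z \<in> lat \<tau> then Lim (at z) D else D z)" for z
  have gD: "eventually (\<lambda>z. g z = D z) (at p)" for p
    using eventually_notin_lat[OF tau, of p] by eventually_elim (simp add: g_def)
  have g_hol: "g holomorphic_on UNIV"
    unfolding holomorphic_on_def
  proof
    fix p
    show "g field_differentiable at p within UNIV"
    proof (cases "p \<in> lat \<tau>")
      case False
      have "eventually (\<lambda>z. D z = g z) (nhds p)"
        unfolding eventually_nhds_conv_at using gD[of p] False
        by (auto simp: g_def elim: eventually_mono)
      then have "(g has_field_derivative x) (at p)" if "(D has_field_derivative x) (at p)" for x
        using that by (subst (asm) DERIV_cong_ev[OF refl _ refl]) auto
      then show ?thesis
        using hol[OF False] unfolding field_differentiable_def by auto
    next
      case True
      obtain S where S: "open S" "p \<in> S" "\<forall>z\<in>S. z \<noteq> p \<longrightarrow> z \<notin> lat \<tau>"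
        using eventually_notin_lat[OF tau, of p] unfolding eventually_at_topological by auto
      have "D holomorphic_on (S - {p})"
        unfolding holomorphic_on_def using S(3) hol by (auto intro: field_differentiable_at_within)
      then obtain h where h: "h holomorphic_on S" "\<forall>z\<in>S - {p}. h z = D z"
        using holomorphic_on_extend_lim[of D S p] lim[OF True] S by (auto simp: interior_open)
      have "(h \<longlongrightarrow> h p) (at p)"
        using holomorphic_on_imp_continuous_on[OF h(1)] S by (simp add: continuous_on_eq_continuous_at isCont_def)
      moreover have "eventually (\<lambda>z. h z = D z) (at p)"
        using eventually_at_in_open'[OF S(1,2)] eventually_neq_at_within[of p p UNIV]
        by eventually_elim (use h(2) in auto)
      ultimately have "(D \<longlongrightarrow> h p) (at p)"
        by (rule Lim_transform_eventually)
      then have "g p = h p"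
        using True by (simp add: g_def tendsto_Lim)
      then have "h z = g z" if "z \<in> S" for z
        using that h(2) S(3) by (cases "z = p") (auto simp: g_def)
      then have "g holomorphic_on S"
        using h(1) holomorphic_transform by blast
      then show ?thesis
        using S holomorphic_on_imp_differentiable_at by auto
    qed
  qed
  then have g_cont: "continuous_on UNIV g"
    by (rule holomorphic_on_imp_continuous_on)
  have "compact (g ` cball 0 (1 + norm \<tau>))"
    by (intro compact_continuous_image continuous_on_subset[OF g_cont]) auto
  then obtain B where B: "\<And>z. norm z \<le> 1 + norm \<tau> \<Longrightarrow> norm (g z) \<le> B"
    using compact_imp_bounded bounded_iff by (metis dist_0_norm imageI mem_cball)
  define K where "K = B * exp (c * (\<bar>Im w\<bar> + Im \<tau>)\<^sup>2)"
  have B0: "B \<ge> 0"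
    using order_trans[OF norm_ge_zero B[of 0]] by simp
  \<comment> \<open>The periodic function \<open>P\<close> is bounded by its values on a fundamental parallelogram.\<close>
  have PK: "P z \<le> K" if z: "z \<notin> lat \<tau>" for z
  proof -
    define p where "p = - \<lfloor>Im z / Im \<tau>\<rfloor>"
    define r where "r = - \<lfloor>Re (z + of_int p * \<tau>)\<rfloor>"
    define y where "y = z + of_int p * \<tau> + of_int r"
    have im: "Im y = Im z + of_int p * Im \<tau>" by (simp add: y_def)
    have "0 \<le> Im y" "Im y \<le> Im \<tau>"
    proof -
      have "of_int (- p) \<le> Im z / Im \<tau>" "Im z / Im \<tau> \<le> of_int (- p) + 1"
        by (simp_all add: p_def)
      then show "0 \<le> Im y" "Im y \<le> Im \<tau>"
        using tau unfolding im by (simp_all add: field_simps)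
    qed
    moreover have "0 \<le> Re y" "Re y \<le> 1"
      unfolding y_def plus_complex.sel(1)[of _ "of_int r"] by (simp_all add: r_def) linarith+
    ultimately have ny: "norm y \<le> 1 + norm \<tau>" "\<bar>Im (y - w)\<bar> \<le> \<bar>Im w\<bar> + Im \<tau>"
      using cmod_le[of y] abs_Im_le_cmod[of \<tau>] tau by auto
    have y: "y \<notin> lat \<tau>" using lat1[of z p r] z by (simp add: y_def)
    have "P z = P (z + of_int p * \<tau> + of_int r)"
      using P1[of "z + of_int p * \<tau>" r] Pt[OF z, of p] lat1[of z p 0] z by simp
    also have "\<dots> = norm (g y) * exp (c * (Im (y - w))\<^sup>2)"
      using y by (simp add: P_def g_def y_def)
    also have "\<dots> \<le> B * exp (c * (\<bar>Im w\<bar> + Im \<tau>)\<^sup>2)"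
    proof (intro mult_mono B ny)
      have "(Im (y - w))\<^sup>2 \<le> (\<bar>Im w\<bar> + Im \<tau>)\<^sup>2"
        using ny(2) by (metis abs_ge_zero power2_abs power_mono)
      then show "exp (c * (Im (y - w))\<^sup>2) \<le> exp (c * (\<bar>Im w\<bar> + Im \<tau>)\<^sup>2)"
        using c by (simp add: mult_left_mono)
    qed (use B0 in auto)
    finally show ?thesis by (simp add: K_def)
  qed
  have gK: "norm (g z) \<le> K" for z
  proof -
    have D_le: "norm (D y) \<le> K" if "y \<notin> lat \<tau>" for y
    proof -
      have "norm (D y) * 1 \<le> P y"
        unfolding P_def using c by (intro mult_left_mono) auto
      then show ?thesis using PK[OF that] by simp
    qed
    have "eventually (\<lambda>y. norm (g y) \<le> K) (at z)"
      using eventually_notin_lat[OF tau, of z] by eventually_elim (use D_le in \<open>simp add: g_def\<close>)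
    moreover have "(g \<longlongrightarrow> g z) (at z)"
      using g_cont by (simp add: continuous_on_eq_continuous_at isCont_def)
    ultimately show ?thesis
      using tendsto_upperbound[OF tendsto_norm] trivial_limit_at by blast
  qed
  have "g constant_on UNIV"
    using gK by (intro Liouville_theorem g_hol) (auto simp: bounded_iff)
  then obtain k where k: "\<And>z. g z = k"
    by (auto simp: constant_on_def)
  show thesis
  proof
    show "D z = k" if "z \<notin> lat \<tau>" for z
      using k[of z] that by (simp add: g_def)
    show "norm k * exp (c * (Im (z - w))\<^sup>2) \<le> K" if "z \<notin> lat \<tau>" for z
      using PK[OF that] k[of z] that by (simp add: P_def g_def)
  qed
qed

text \<open>
  For \<open>c > 0\<close> the function \<open>D\<close> is a section of a line bundle of negative degree over a torus: the
  bound tends to zero in the direction of \<open>\<tau>\<close>.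
\<close>

lemma negative_degree_eq_0:
  fixes D :: "complex \<Rightarrow> complex" and c :: real
  assumes tau: "Im \<tau> > 0" and c: "c > 0"
    and hol: "\<And>z. z \<notin> lat \<tau> \<Longrightarrow> D field_differentiable (at z)"
    and lim: "\<And>p. p \<in> lat \<tau> \<Longrightarrow> ((\<lambda>z. (z - p) * D z) \<longlongrightarrow> 0) (at p)"
    and per1: "\<And>z. z \<notin> lat \<tau> \<Longrightarrow> norm (D (z + 1)) = norm (D z)"
    and pert: "\<And>z. z \<notin> lat \<tau> \<Longrightarrow>
      norm (D (z + \<tau>)) * exp (c * (Im (z + \<tau> - w))\<^sup>2) = norm (D z) * exp (c * (Im (z - w))\<^sup>2)"
    and z: "z \<notin> lat \<tau>"
  shows "D z = 0"
proof -
  obtain k K where k: "\<And>z. z \<notin> lat \<tau> \<Longrightarrow> D z = k"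
    and K: "\<And>z. z \<notin> lat \<tau> \<Longrightarrow> norm k * exp (c * (Im (z - w))\<^sup>2) \<le> K"
    using lattice_liouville[OF tau less_imp_le[OF c] hol lim per1 pert] by metis
  have le: "norm k \<le> K * exp (- (c * (Im (z - w) + real n * Im \<tau>)\<^sup>2))" for n
  proof -
    have y: "z + of_int (int n) * \<tau> \<notin> lat \<tau>" using lat_add_tau_iff[of z "int n"] z by simp
    have im: "Im (z + of_int (int n) * \<tau> - w) = Im (z - w) + real n * Im \<tau>" by simp
    show ?thesis
      using K[OF y] unfolding im by (simp add: exp_minus field_simps)
  qed
  have "filterlim (\<lambda>n. Im (z - w) + real n * Im \<tau>) at_top sequentially"
    by (intro filterlim_tendsto_add_at_top[OF tendsto_const]
        filterlim_at_top_mult_tendsto_pos[OF tendsto_const tau] filterlim_real_sequentially)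
  then have "filterlim (\<lambda>n. - (c * (Im (z - w) + real n * Im \<tau>)\<^sup>2)) at_bot sequentially"
    unfolding filterlim_uminus_at_bot
    by (simp add: filterlim_tendsto_pos_mult_at_top[OF tendsto_const c] filterlim_pow_at_top)
  then have "(\<lambda>n. K * exp (- (c * (Im (z - w) + real n * Im \<tau>)\<^sup>2))) \<longlonglongrightarrow> K * 0"
    by (intro tendsto_intros filterlim_compose[OF exp_at_bot])
  then have "norm k \<le> K * 0"
    by (rule tendsto_lowerbound) (use le in auto)
  then show ?thesis
    using k[OF z] by simp
qed

section \<open>The derivatives of the completed Appell function\<close>

text \<open>
  Termwise differentiation of a function that need not be holomorphic; \<open>A\<close> and \<open>B\<close> are the Wirtinger
  derivatives of the summands with respect to \<open>x\<close> and to \<open>cnj x\<close>.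
\<close>

lemma has_derivative_infsum_int:
  fixes f A B :: "int \<Rightarrow> complex \<Rightarrow> complex" and M :: "int \<Rightarrow> real"
  assumes "convex S" "open S"
    and D: "\<And>n x. x \<in> S \<Longrightarrow> (f n has_derivative (\<lambda>h. A n x * h + B n x * cnj h)) (at x)"
    and A: "\<And>n x. x \<in> S \<Longrightarrow> norm (A n x) \<le> M n" and B: "\<And>n x. x \<in> S \<Longrightarrow> norm (B n x) \<le> M n"
    and M: "M summable_on UNIV" and f: "\<And>x. x \<in> S \<Longrightarrow> (\<lambda>n. f n x) summable_on UNIV"
    and x: "x \<in> S"
  shows "((\<lambda>x. \<Sum>\<^sub>\<infinity>n. f n x) has_derivative
    (\<lambda>h. (\<Sum>\<^sub>\<infinity>n. A n x) * h + (\<Sum>\<^sub>\<infinity>n. B n x) * cnj h)) (at x)"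
proof -
  let ?d = "int_decode"
  have sums: "(\<lambda>i. F (?d i)) sums (\<Sum>\<^sub>\<infinity>n. F n)" if "F summable_on UNIV" for F :: "int \<Rightarrow> complex"
  proof -
    have "((\<lambda>i. F (?d i)) has_sum (\<Sum>\<^sub>\<infinity>n. F n)) UNIV"
      using has_sum_reindex_bij_betw[OF bij_int_decode, of F "\<Sum>\<^sub>\<infinity>n. F n"] that by simp
    then show ?thesis by (rule has_sum_imp_sums)
  qed
  have M': "summable (\<lambda>i. M (?d i))"
    using M summable_on_reindex_bij_betw[OF bij_int_decode, of M] by (intro summable_on_imp_summable) simp
  have sumA: "(\<lambda>n. A n x) summable_on UNIV" if "x \<in> S" for x
    using A[OF that] by (intro abs_summable_summable[OF Infinite_Sum.abs_summable_on_comparison_test'[OF M]])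
  have sumB: "(\<lambda>n. B n x) summable_on UNIV" if "x \<in> S" for x
    using B[OF that] by (intro abs_summable_summable[OF Infinite_Sum.abs_summable_on_comparison_test'[OF M]])
  have ul: "uniform_limit S (\<lambda>n x. \<Sum>i<n. F (?d i) x) (\<lambda>x. \<Sum>\<^sub>\<infinity>n. F n x) sequentially"
    if le: "\<And>n x. x \<in> S \<Longrightarrow> norm (F n x) \<le> M n" and s: "\<And>x. x \<in> S \<Longrightarrow> (\<lambda>n. F n x) summable_on UNIV"
    for F :: "int \<Rightarrow> complex \<Rightarrow> complex"
  proof -
    have "uniform_limit S (\<lambda>n x. \<Sum>i<n. F (?d i) x) (\<lambda>x. \<Sum>i. F (?d i) x) sequentially"
      by (rule Weierstrass_m_test[OF _ M']) (use le in auto)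
    moreover have "(\<Sum>i. F (?d i) x) = (\<Sum>\<^sub>\<infinity>n. F n x)" if "x \<in> S" for x
      using sums[OF s[OF that]] by (simp add: sums_iff)
    ultimately show ?thesis
      by (metis (no_types, lifting) uniform_limit_cong')
  qed
  let ?g' = "\<lambda>x h. (\<Sum>\<^sub>\<infinity>n. A n x) * h + (\<Sum>\<^sub>\<infinity>n. B n x) * cnj h"
  have "\<exists>g. \<forall>x\<in>S. (\<lambda>i. f (?d i) x) sums g x \<and> (g has_derivative ?g' x) (at x within S)"
  proof (rule has_derivative_series[OF assms(1)])
    show "(f (?d i) has_derivative (\<lambda>h. A (?d i) x * h + B (?d i) x * cnj h)) (at x within S)" if "x \<in> S" for i x
      using D[OF that] by (rule has_derivative_at_withinI)
    show "\<forall>\<^sub>F n in sequentially. \<forall>x\<in>S. \<forall>h. norm ((\<Sum>i<n. A (?d i) x * h + B (?d i) x * cnj h) - ?g' x h) \<le> e * norm h"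
      if e: "e > 0" for e
    proof -
      have "\<forall>\<^sub>F n in sequentially. \<forall>x\<in>S. norm ((\<Sum>i<n. A (?d i) x) - (\<Sum>\<^sub>\<infinity>n. A n x)) < e / 2"
        "\<forall>\<^sub>F n in sequentially. \<forall>x\<in>S. norm ((\<Sum>i<n. B (?d i) x) - (\<Sum>\<^sub>\<infinity>n. B n x)) < e / 2"
        by (rule uniform_limitD[OF ul[OF A sumA], unfolded dist_norm] uniform_limitD[OF ul[OF B sumB], unfolded dist_norm];
            use e in simp)+
      then show ?thesis
      proof eventually_elim
        case (elim n)
        show ?case
        proof (intro ballI allI)
          fix x h assume x: "x \<in> S"
          let ?a = "(\<Sum>i<n. A (?d i) x) - (\<Sum>\<^sub>\<infinity>n. A n x)" and ?b = "(\<Sum>i<n. B (?d i) x) - (\<Sum>\<^sub>\<infinity>n. B n x)"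
          have "norm ((\<Sum>i<n. A (?d i) x * h + B (?d i) x * cnj h) - ?g' x h) = norm (?a * h + ?b * cnj h)"
            by (simp add: sum.distrib sum_distrib_right[symmetric] sum_distrib_left[symmetric] algebra_simps)
          also have "\<dots> \<le> norm ?a * norm h + norm ?b * norm h"
            by (metis complex_mod_cnj norm_mult norm_triangle_ineq)
          also have "\<dots> \<le> e / 2 * norm h + e / 2 * norm h"
            using elim x by (intro add_mono mult_right_mono) (auto intro: less_imp_le)
          finally show "norm ((\<Sum>i<n. A (?d i) x * h + B (?d i) x * cnj h) - ?g' x h) \<le> e * norm h"
            by simp
        qed
      qed
    qed
    show "x \<in> S" by (rule x)
    show "(\<lambda>i. f (?d i) x) sums (\<Sum>\<^sub>\<infinity>n. f n x)"
      by (rule sums[OF f[OF x]])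
  qed
  then obtain g where g: "\<And>x. x \<in> S \<Longrightarrow> (\<lambda>i. f (?d i) x) sums g x" "\<And>x. x \<in> S \<Longrightarrow> (g has_derivative ?g' x) (at x within S)"
    by blast
  have eq: "g y = (\<Sum>\<^sub>\<infinity>n. f n y)" if "y \<in> S" for y
    using sums_unique2[OF g(1)[OF that] sums[OF f[OF that]]] .
  have "(g has_derivative ?g' x) (at x)"
    using g(2)[OF x] at_within_open[OF x assms(2)] by simp
  then show ?thesis
    by (rule has_derivative_transform_within_open[OF _ assms(2) x eq])
qed

text \<open>
  The pairing of the complex conjugate vector \<open>Theta j N \<tau> (2 * v)\<close> with \<open>Theta (- j) N \<tau> u\<close>, where \<open>j\<close>
  runs modulo \<open>2 * N\<close> (\<open>dbar_theta_eq_sum\<close>).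
\<close>

definition dbar_theta :: "nat \<Rightarrow> complex \<Rightarrow> complex \<Rightarrow> complex \<Rightarrow> complex" where
  "dbar_theta N \<tau> u v = (\<Sum>\<^sub>\<infinity>n. cnj (theta_term N \<tau> (2 * v) n) * Theta (- n) N \<tau> u)"

text \<open>
  The derivative of \<open>corr N s \<tau> u\<close> with respect to \<open>cnj v\<close>, for every \<open>s\<close>.
\<close>

definition corr_dbar :: "nat \<Rightarrow> complex \<Rightarrow> complex \<Rightarrow> complex \<Rightarrow> complex" where
  "corr_dbar N \<tau> u v = - \<i> * of_real (real N / Im \<tau> * sqrt (Im \<tau> / real N)
     * exp (- (4 * pi * real N * (Im v)\<^sup>2 / Im \<tau>))) * dbar_theta N \<tau> u v"

text \<open>
  Completing the square: the Gaussian that arises from differentiating \<open>Efun\<close> turns the holomorphic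
  \<open>corr_exp\<close> into the complex conjugate of a theta summand.
\<close>

lemma gauss_mult_corr_exp:
  assumes "Im \<tau> > 0" "N > 0"
  shows "of_real (exp (- pi * (corr_arg N \<tau> v n)\<^sup>2)) * corr_exp N \<tau> v n
    = of_real (exp (- (4 * pi * real N * (Im v)\<^sup>2 / Im \<tau>))) * cnj (theta_term N \<tau> (2 * v) n)"
proof -
  define r where "r = (of_int n)\<^sup>2 / (4 * real N)"
  have r: "(of_int n)\<^sup>2 / (4 * of_nat N) = complex_of_real r"
    by (simp add: r_def)
  define Q where "Q = - (4 * pi * real N * (Im v)\<^sup>2 / Im \<tau>)"
  have sq: "- pi * (corr_arg N \<tau> v n)\<^sup>2 = Q - 4 * pi * (r * Im \<tau>) - 4 * pi * (of_int n * Im v)"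
    unfolding corr_arg_square[OF assms] r_def Q_def using assms by (simp add: field_simps)
  have "of_real (Q - 4 * pi * (r * Im \<tau>) - 4 * pi * (of_int n * Im v)) + 2 * of_real pi * \<i> * (- (of_real r * \<tau>) - of_int n * v)
    = of_real Q + cnj (2 * of_real pi * \<i> * (of_int n * (2 * v) / 2 + of_real r * \<tau>))"
    by (rule complex_eqI) (simp_all add: algebra_simps)
  from arg_cong[OF this, of exp]
  have "exp (of_real (Q - 4 * pi * (r * Im \<tau>) - 4 * pi * (of_int n * Im v)))
      * exp (2 * of_real pi * \<i> * (- (of_real r * \<tau>) - of_int n * v))
    = exp (of_real Q) * cnj (exp (2 * of_real pi * \<i> * (of_int n * (2 * v) / 2 + of_real r * \<tau>)))"
    by (simp only: exp_add exp_cnj)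
  then show ?thesis
    unfolding corr_exp_def theta_term_def e2pi_def r sq Q_def[symmetric] exp_of_real .
qed

text \<open>
  The only nonholomorphic dependence on \<open>v\<close> is that of \<open>corr_arg\<close> on \<open>Im v\<close>, so that the derivative with
  respect to \<open>cnj v\<close> comes from \<open>Efun\<close> alone.
\<close>

lemma corr_has_derivative:
  assumes "Im \<tau> > 0" "N > 0"
  obtains A where "(corr N 0 \<tau> u has_derivative (\<lambda>h. A * h + corr_dbar N \<tau> u v * cnj h)) (at v)"
proof -
  define R where "R = norm v + 1"
  define q where "q = 2 * real N / Im \<tau> * sqrt (Im \<tau> / real N)"
  have q: "q \<ge> 0" using assms by (simp add: q_def)
  define a where "a = pi * Im \<tau> / (2 * real N)"
  have a: "a > 0" using assms by (simp add: a_def)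
  define G where "G n = exp (- a * (of_int n)\<^sup>2 + 2 * pi * R * \<bar>of_int n\<bar>)" for n :: int
  define P where "P n v = of_real (q * exp (- pi * (corr_arg N \<tau> v n)\<^sup>2)) * corr_exp N \<tau> v n" for n v
  define A where "A n v = (- (2 * of_real pi * \<i> * of_int n) * corr_term N 0 \<tau> v n + \<i> * P n v) * Theta (- n) N \<tau> u" for n v
  define B where "B n v = - \<i> * P n v * Theta (- n) N \<tau> u" for n v
  obtain K where K: "K > 0" "\<And>v n. \<bar>Im v\<bar> \<le> R \<Longrightarrow> norm (corr_term N 0 \<tau> v n) \<le> K * G n"
    using corr_term_le[OF assms, where \<rho> = R and s = 0] unfolding G_def a_def by metis
  obtain T where T: "T > 0" "\<And>j. norm (Theta j N \<tau> u) \<le> T"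
    using Theta_bounded[OF assms(2)] by metis
  define M where "M n = (2 * pi * K + q) * T * exp (- a * (of_int n)\<^sup>2 + (2 * pi * R + 1) * \<bar>of_int n\<bar>)" for n :: int
  have M: "M summable_on UNIV"
    unfolding M_def by (intro summable_on_cmult_right summable_gauss a)
  have G1: "G n * \<bar>of_int n\<bar> \<le> exp (- a * (of_int n)\<^sup>2 + (2 * pi * R + 1) * \<bar>of_int n\<bar>)"
    and G2: "G n \<le> exp (- a * (of_int n)\<^sup>2 + (2 * pi * R + 1) * \<bar>of_int n\<bar>)" for n
  proof -
    have e: "exp (- a * (of_int n)\<^sup>2 + (2 * pi * R + 1) * \<bar>of_int n\<bar>) = G n * exp \<bar>of_int n\<bar>"
      by (simp add: G_def distrib_right flip: exp_add)
    have "\<bar>real_of_int n\<bar> \<le> exp \<bar>of_int n\<bar>"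
      using exp_ge_add_one_self[of "\<bar>real_of_int n\<bar>"] by linarith
    then show "G n * \<bar>of_int n\<bar> \<le> exp (- a * (of_int n)\<^sup>2 + (2 * pi * R + 1) * \<bar>of_int n\<bar>)"
      unfolding e by (simp add: G_def)
    show "G n \<le> exp (- a * (of_int n)\<^sup>2 + (2 * pi * R + 1) * \<bar>of_int n\<bar>)"
      unfolding e by (simp add: G_def)
  qed
  have P: "norm (P n x) \<le> q * G n" if "\<bar>Im x\<bar> \<le> R" for n x
  proof -
    have "norm (P n x) = q * (exp (- pi * (corr_arg N \<tau> x n)\<^sup>2) * norm (corr_exp N \<tau> x n))"
      using q by (simp add: P_def norm_mult)
    also have "\<dots> \<le> q * G n"
      unfolding G_def a_def by (intro mult_left_mono gauss_corr_exp_le assms that q)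
    finally show ?thesis .
  qed
  have im: "\<bar>Im x\<bar> \<le> R" if "x \<in> ball 0 R" for x
    using that abs_Im_le_cmod[of x] by auto
  have D: "((\<lambda>v. corr_term N 0 \<tau> v n * Theta (- n) N \<tau> u) has_derivative (\<lambda>h. A n x * h + B n x * cnj h)) (at x)" for n x
  proof -
    have 1: "((\<lambda>v. Efun (corr_arg N \<tau> v n)) has_derivative (\<lambda>h. 2 * exp (- pi * (corr_arg N \<tau> x n)\<^sup>2) * (q * Im h))) (at x)"
    proof (rule has_derivative_compose[where f = "\<lambda>v. corr_arg N \<tau> v n" and g = Efun
          and f' = "\<lambda>h. q * Im h" and g' = "\<lambda>y. 2 * exp (- pi * (corr_arg N \<tau> x n)\<^sup>2) * y"])
      show "((\<lambda>v. corr_arg N \<tau> v n) has_derivative (\<lambda>h. q * Im h)) (at x)"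
        unfolding corr_arg_def q_def using assms
        by (auto intro!: derivative_eq_intros simp: field_simps)
      show "(Efun has_derivative (\<lambda>y. 2 * exp (- pi * (corr_arg N \<tau> x n)\<^sup>2) * y)) (at (corr_arg N \<tau> x n))"
        using Efun_has_derivative[of "corr_arg N \<tau> x n"] unfolding has_field_derivative_def .
    qed
    have "((\<lambda>v. corr_exp N \<tau> v n) has_field_derivative - (2 * of_real pi * \<i> * of_int n) * corr_exp N \<tau> x n) (at x)"
      unfolding corr_exp_def by (auto intro!: derivative_eq_intros)
    then have 2: "((\<lambda>v. corr_exp N \<tau> v n) has_derivative (\<lambda>h. - (2 * of_real pi * \<i> * of_int n) * corr_exp N \<tau> x n * h)) (at x)"
      unfolding has_field_derivative_def .
    have h: "\<i> * h - \<i> * cnj h = - 2 * of_real (Im h)" for h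
      by (simp add: complex_eq_iff)
    have "((\<lambda>v. of_real (sgn (of_int n - of_int 0 - 1 / 2) - Efun (corr_arg N \<tau> v n)) * corr_exp N \<tau> v n * Theta (- n) N \<tau> u)
      has_derivative (\<lambda>h. (of_real (sgn (of_int n - of_int 0 - 1 / 2) - Efun (corr_arg N \<tau> x n))
          * (- (2 * of_real pi * \<i> * of_int n) * corr_exp N \<tau> x n * h)
        + of_real (0 - 2 * exp (- pi * (corr_arg N \<tau> x n)\<^sup>2) * (q * Im h)) * corr_exp N \<tau> x n) * Theta (- n) N \<tau> u)) (at x)"
      by (intro has_derivative_mult_left has_derivative_mult has_derivative_of_real has_derivative_diff has_derivative_const 1 2)
    moreover have "(of_real (sgn (of_int n - of_int 0 - 1 / 2) - Efun (corr_arg N \<tau> x n))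
          * (- (2 * of_real pi * \<i> * of_int n) * corr_exp N \<tau> x n * h)
        + of_real (0 - 2 * exp (- pi * (corr_arg N \<tau> x n)\<^sup>2) * (q * Im h)) * corr_exp N \<tau> x n) * Theta (- n) N \<tau> u
      = A n x * h + B n x * cnj h" for h
    proof -
      have "of_real (0 - 2 * exp (- pi * (corr_arg N \<tau> x n)\<^sup>2) * (q * Im h)) * corr_exp N \<tau> x n
        = P n x * (- 2 * of_real (Im h))"
        by (simp add: P_def)
      also have "\<dots> = \<i> * P n x * h - \<i> * P n x * cnj h"
        unfolding h[symmetric] by (simp add: algebra_simps)
      finally have e: "of_real (0 - 2 * exp (- pi * (corr_arg N \<tau> x n)\<^sup>2) * (q * Im h)) * corr_exp N \<tau> x n
        = \<i> * P n x * h - \<i> * P n x * cnj h" .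
      show ?thesis
        unfolding e unfolding A_def B_def corr_term_def by (simp add: algebra_simps)
    qed
    ultimately show ?thesis
      unfolding corr_term_def by simp
  qed
  have nA: "norm (A n x) \<le> M n" and nB: "norm (B n x) \<le> M n" if x: "x \<in> ball 0 R" for n x
  proof -
    let ?E = "exp (- a * (of_int n)\<^sup>2 + (2 * pi * R + 1) * \<bar>of_int n\<bar>)"
    have 1: "norm (P n x) \<le> q * ?E"
      using P[OF im[OF x], of n] mult_left_mono[OF G2[of n] q] by linarith
    have "norm (- (2 * of_real pi * \<i> * of_int n) * corr_term N 0 \<tau> x n) = 2 * pi * (\<bar>of_int n\<bar> * norm (corr_term N 0 \<tau> x n))"
      by (simp add: norm_mult)
    also have "\<dots> \<le> 2 * pi * (\<bar>of_int n\<bar> * (K * G n))"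
      using K(2)[OF im[OF x], of n] by (intro mult_left_mono) auto
    also have "\<dots> = 2 * pi * K * (G n * \<bar>of_int n\<bar>)"
      by simp
    also have "\<dots> \<le> 2 * pi * K * ?E"
      using K(1) by (intro mult_left_mono G1) auto
    finally have 2: "norm (- (2 * of_real pi * \<i> * of_int n) * corr_term N 0 \<tau> x n) \<le> 2 * pi * K * ?E" .
    have "norm (- (2 * of_real pi * \<i> * of_int n) * corr_term N 0 \<tau> x n + \<i> * P n x) \<le> (2 * pi * K + q) * ?E"
    proof (rule order_trans[OF norm_triangle_ineq])
      have "norm (\<i> * P n x) \<le> q * ?E"
        using 1 by (simp only: norm_mult norm_ii mult_1)
      from add_mono[OF 2 this]
      show "norm (- (2 * of_real pi * \<i> * of_int n) * corr_term N 0 \<tau> x n) + norm (\<i> * P n x) \<le> (2 * pi * K + q) * ?E"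
        by (simp only: distrib_right)
    qed
    then have "norm (A n x) \<le> ((2 * pi * K + q) * ?E) * T"
      unfolding A_def norm_mult[of _ "Theta (- n) N \<tau> u"] using T q K(1)
      by (intro mult_mono) auto
    then show "norm (A n x) \<le> M n"
      by (simp add: M_def mult_ac)
    have "norm (B n x) \<le> (q * ?E) * T"
      unfolding B_def norm_mult[of _ "Theta (- n) N \<tau> u"] using T q 1
      by (intro mult_mono) (auto simp: norm_mult)
    also have "\<dots> \<le> ((2 * pi * K + q) * ?E) * T"
      using T K(1) by (intro mult_right_mono) auto
    finally show "norm (B n x) \<le> M n"
      by (simp add: M_def mult_ac)
  qed
  have v: "v \<in> ball 0 R"
    by (simp add: R_def)
  have *: "((\<lambda>v. \<Sum>\<^sub>\<infinity>n. corr_term N 0 \<tau> v n * Theta (- n) N \<tau> u) has_derivative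
      (\<lambda>h. (\<Sum>\<^sub>\<infinity>n. A n v) * h + (\<Sum>\<^sub>\<infinity>n. B n v) * cnj h)) (at v)"
    by (rule has_derivative_infsum_int[OF convex_ball open_ball D nA nB M summable_corr[OF assms] v])
  have B: "1 / 2 * (\<Sum>\<^sub>\<infinity>n. B n v) = corr_dbar N \<tau> u v"
  proof -
    have Bn: "B n v = - \<i> * of_real (q * exp (- (4 * pi * real N * (Im v)\<^sup>2 / Im \<tau>)))
        * (cnj (theta_term N \<tau> (2 * v) n) * Theta (- n) N \<tau> u)" for n
      unfolding B_def P_def of_real_mult using gauss_mult_corr_exp[OF assms, of v n] by simp
    show ?thesis
      unfolding Bn infsum_cmult_right' corr_dbar_def dbar_theta_def by (simp add: q_def)
  qed
  have "(corr N 0 \<tau> u has_derivative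
      (\<lambda>h. 1 / 2 * ((\<Sum>\<^sub>\<infinity>n. A n v) * h + (\<Sum>\<^sub>\<infinity>n. B n v) * cnj h))) (at v)"
    using has_derivative_mult_right[OF *, of "1 / 2"] unfolding corr_def[abs_def] .
  then have "(corr N 0 \<tau> u has_derivative
      (\<lambda>h. (1 / 2 * (\<Sum>\<^sub>\<infinity>n. A n v)) * h + (1 / 2 * (\<Sum>\<^sub>\<infinity>n. B n v)) * cnj h)) (at v)"
    by (simp add: algebra_simps)
  then show thesis
    unfolding B by (rule that)
qed

text \<open>
  In a horizontal strip all but finitely many summands are free of poles, and their sum converges
  uniformly.
\<close>

lemma appell_split:
  assumes "Im \<tau> > 0" "N > 0"
  obtains J :: int and H where "H holomorphic_on {z. \<bar>Im z\<bar> < \<rho>}"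
    "\<And>z. \<bar>Im z\<bar> < \<rho> \<Longrightarrow> appell N 0 \<tau> u z = (\<Sum>j\<in>{-J..J}. appell_term N 0 \<tau> u z j) + H z"
    "\<And>z j. \<bar>Im z\<bar> < \<rho> \<Longrightarrow> j \<notin> {-J..J} \<Longrightarrow> z + of_int j * \<tau> \<notin> \<int>"
proof
  define J where "J = \<lceil>(\<rho> + 1) / Im \<tau>\<rceil>"
  let ?S = "{z. \<bar>Im z\<bar> < \<rho>}"
  let ?I = "- {-J..J}"
  define H where "H z = (\<Sum>\<^sub>\<infinity>j\<in>?I. appell_term N 0 \<tau> u z j)" for z
  show far: "z + of_int j * \<tau> \<notin> \<int>" if "\<bar>Im z\<bar> < \<rho>" "j \<notin> {-J..J}" for z j
  proof -
    have "J \<le> \<bar>j\<bar>" using that(2) by auto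
    then show ?thesis
      unfolding J_def by (rule far_notin_Ints[OF assms(1) less_imp_le[OF that(1)]])
  qed
  let ?G = "\<lambda>j. 2 * exp (- (2 * pi * real N * Im \<tau>) * (of_int j)\<^sup>2 + 2 * pi * (real N * \<bar>Im u\<bar>) * \<bar>of_int j\<bar>)"
  show "H holomorphic_on ?S"
    unfolding H_def
  proof (rule holomorphic_infsum)
    show "open ?S"
      by (intro open_Collect_less continuous_intros)
    fix j assume j: "j \<in> ?I"
    have "1 - e2pi (z + of_int j * \<tau>) \<noteq> 0" if "z \<in> ?S" for z
      using far[of z j] that j by (auto simp: e2pi_eq_1_iff)
    then show "(\<lambda>z. appell_term N 0 \<tau> u z j) holomorphic_on ?S"
      unfolding appell_term_def by (intro holomorphic_intros) auto
    fix z assume z: "z \<in> ?S"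
    have "J \<le> \<bar>j\<bar>" using j by auto
    then have "norm (1 - e2pi (z + of_int j * \<tau>)) \<ge> 1 / 2"
      unfolding J_def using z by (intro norm_one_minus_e2pi abs_Im_add_int_mult_ge[OF assms(1)]) auto
    then have le: "inverse (norm (1 - e2pi (z + of_int j * \<tau>))) \<le> 2"
      using le_imp_inverse_le[of "1 / 2"] by fastforce
    let ?n = "e2pi (of_nat N * (of_int j * u + (of_int j)\<^sup>2 * \<tau>) - of_int 0 * (z + of_int j * \<tau>))"
    have "norm (appell_term N 0 \<tau> u z j) = norm ?n * inverse (norm (1 - e2pi (z + of_int j * \<tau>)))"
      unfolding appell_term_def norm_divide by (simp add: divide_inverse)
    also have "\<dots> \<le> exp (- (2 * pi * real N * Im \<tau>) * (of_int j)\<^sup>2 + 2 * pi * (real N * \<bar>Im u\<bar>) * \<bar>of_int j\<bar>) * 2"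
      using norm_appell_numerator[OF assms(1) order_refl, of N j u 0 z] by (intro mult_mono le) auto
    finally show "norm (appell_term N 0 \<tau> u z j) \<le> ?G j"
      by simp
  next
    show "?G summable_on ?I"
      by (rule summable_on_subset_banach[OF summable_on_cmult_right[OF summable_gauss]]) (use assms in auto)
  qed
  fix z
  have "(\<Sum>\<^sub>\<infinity>j\<in>{-J..J} \<union> ?I. appell_term N 0 \<tau> u z j)
      = (\<Sum>\<^sub>\<infinity>j\<in>{-J..J}. appell_term N 0 \<tau> u z j) + (\<Sum>\<^sub>\<infinity>j\<in>?I. appell_term N 0 \<tau> u z j)"
    by (intro infsum_Un_disjoint summable_on_subset_banach[OF summable_appell[OF assms]]) auto
  then show "appell N 0 \<tau> u z = (\<Sum>j\<in>{-J..J}. appell_term N 0 \<tau> u z j) + H z"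
    by (simp add: appell_def H_def)
qed

lemma appell_differentiable:
  assumes "Im \<tau> > 0" "N > 0" and z: "z \<notin> lat \<tau>"
  shows "appell N 0 \<tau> u field_differentiable (at z)"
proof -
  obtain J H where H: "H holomorphic_on {w. \<bar>Im w\<bar> < \<bar>Im z\<bar> + 1}"
    "\<And>w. \<bar>Im w\<bar> < \<bar>Im z\<bar> + 1 \<Longrightarrow> appell N 0 \<tau> u w = (\<Sum>j\<in>{-J..J}. appell_term N 0 \<tau> u w j) + H w"
    using appell_split[OF assms(1,2), of "\<bar>Im z\<bar> + 1"] by metis
  let ?S = "{w. \<bar>Im w\<bar> < \<bar>Im z\<bar> + 1} \<inter> - lat \<tau>"
  have S: "open ?S"
    by (intro open_Int open_Compl_lat assms(1) open_Collect_less continuous_intros)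
  have "1 - e2pi (w + of_int j * \<tau>) \<noteq> 0" if "w \<in> ?S" for w j
    using that e2pi_eq_1_imp_lat by auto
  then have "(\<lambda>w. (\<Sum>j\<in>{-J..J}. appell_term N 0 \<tau> u w j) + H w) holomorphic_on ?S"
    unfolding appell_term_def
    by (intro holomorphic_intros holomorphic_on_subset[OF H(1)]) auto
  then have "appell N 0 \<tau> u holomorphic_on ?S"
    by (rule holomorphic_transform) (use H(2) in auto)
  then show ?thesis
    using S z by (intro holomorphic_on_imp_differentiable_at) auto
qed

text \<open>
  Exactly one summand, the one with index \<open>i\<close>, has a pole at \<open>p\<close>.
\<close>

lemma appell_residue:
  assumes "Im \<tau> > 0" "N > 0" and p: "p = of_int r - of_int i * \<tau>"
  shows "((\<lambda>z. (z - p) * appell N 0 \<tau> u z)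
    \<longlongrightarrow> - e2pi (of_nat N * (of_int i * u + (of_int i)\<^sup>2 * \<tau>)) / (2 * of_real pi * \<i>)) (at p)"
proof -
  define \<rho> where "\<rho> = \<bar>Im p\<bar> + 1"
  obtain J H where H: "H holomorphic_on {w. \<bar>Im w\<bar> < \<rho>}"
    "\<And>w. \<bar>Im w\<bar> < \<rho> \<Longrightarrow> appell N 0 \<tau> u w = (\<Sum>j\<in>{-J..J}. appell_term N 0 \<tau> u w j) + H w"
    "\<And>z j. \<bar>Im z\<bar> < \<rho> \<Longrightarrow> j \<notin> {-J..J} \<Longrightarrow> z + of_int j * \<tau> \<notin> \<int>"
    using appell_split[OF assms(1,2), of \<rho>] by metis
  have S: "open {w. \<bar>Im w\<bar> < \<rho>}" "p \<in> {w. \<bar>Im w\<bar> < \<rho>}"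
    by (auto simp: \<rho>_def intro!: open_Collect_less continuous_intros)
  have i: "i \<in> {-J..J}"
    using H(3)[of p i] S(2) by (auto simp: p)
  let ?c = "e2pi (of_nat N * (of_int i * u + (of_int i)\<^sup>2 * \<tau>))"
  let ?l = "\<lambda>j. if j = i then - ?c / (2 * of_real pi * \<i>) else 0"
  have lim_id: "((\<lambda>z. z - p) \<longlongrightarrow> 0) (at p)"
    by (rule tendsto_eq_intros refl | simp)+
  have "((\<lambda>z. (z - p) * appell_term N 0 \<tau> u z j) \<longlongrightarrow> ?l j) (at p)" for j
  proof (cases "j = i")
    case True
    have "((\<lambda>z. e2pi (z - p)) has_field_derivative 2 * of_real pi * \<i>) (at p)"
      by (auto intro!: derivative_eq_intros)
    then have "((\<lambda>z. (e2pi (z - p) - e2pi (p - p)) / (z - p)) \<longlongrightarrow> 2 * of_real pi * \<i>) (at p)"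
      unfolding has_field_derivative_iff .
    then have "((\<lambda>z. - ?c / ((e2pi (z - p) - e2pi (p - p)) / (z - p))) \<longlongrightarrow> - ?c / (2 * of_real pi * \<i>)) (at p)"
      by (intro tendsto_intros) auto
    moreover have "- ?c / ((e2pi (z - p) - e2pi (p - p)) / (z - p)) = (z - p) * appell_term N 0 \<tau> u z j" for z
    proof -
      have "e2pi (z + of_int j * \<tau>) = e2pi (z - p)"
        by (rule e2pi_eqI[of _ _ r]) (simp add: p True)
      then show ?thesis
        by (simp add: appell_term_def True divide_simps algebra_simps)
    qed
    ultimately show ?thesis using True by simp
  next
    case False
    have "e2pi (p + of_int j * \<tau>) \<noteq> 1"
    proof
      assume "e2pi (p + of_int j * \<tau>) = 1"
      then obtain k :: int where "of_int r - of_int i * \<tau> + of_int j * \<tau> = of_int k"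
        unfolding e2pi_eq_1_iff p by (elim Ints_cases)
      then have "Im (of_int r - of_int i * \<tau> + of_int j * \<tau>) = 0"
        by (simp only: complex_Im_of_int)
      then have "(of_int j - of_int i) * Im \<tau> = 0"
        by (simp add: algebra_simps)
      then show False using assms(1) False by simp
    qed
    then have "((\<lambda>z. (z - p) * appell_term N 0 \<tau> u z j) \<longlongrightarrow> 0 * appell_term N 0 \<tau> u p j) (at p)"
      unfolding appell_term_def e2pi_def by (intro tendsto_mult[OF lim_id] tendsto_intros) auto
    then show ?thesis using False by simp
  qed
  moreover have "(H \<longlongrightarrow> H p) (at p)"
    using holomorphic_on_imp_continuous_on[OF H(1)] S by (simp add: continuous_on_eq_continuous_at isCont_def)
  ultimately have lim: "((\<lambda>z. (\<Sum>j\<in>{-J..J}. (z - p) * appell_term N 0 \<tau> u z j) + (z - p) * H z)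
      \<longlongrightarrow> (\<Sum>j\<in>{-J..J}. ?l j) + 0 * H p) (at p)"
    by (intro tendsto_intros lim_id) auto
  have val: "(\<Sum>j\<in>{-J..J}. ?l j) + 0 * H p = - ?c / (2 * of_real pi * \<i>)"
    using i by (simp add: sum.delta)
  have ev: "\<forall>\<^sub>F z in at p. (\<Sum>j\<in>{-J..J}. (z - p) * appell_term N 0 \<tau> u z j) + (z - p) * H z = (z - p) * appell N 0 \<tau> u z"
    using eventually_at_in_open'[OF S] by eventually_elim (simp add: H(2) sum_distrib_left distrib_left)
  show ?thesis
    by (rule Lim_transform_eventually[OF lim[unfolded val] ev])
qed

section \<open>The inversion of the completed Appell function\<close>

lemma lat_inversion_iff:
  assumes "\<tau> \<noteq> 0"
  shows "z / \<tau> \<in> lat (- 1 / \<tau>) \<longleftrightarrow> z \<in> lat \<tau>"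
proof
  assume "z / \<tau> \<in> lat (- 1 / \<tau>)"
  then obtain p r :: int where "z / \<tau> = of_int p * (- 1 / \<tau>) + of_int r"
    unfolding lat_def by auto
  then have "z = of_int r * \<tau> + of_int (- p)"
    using assms by (simp add: field_simps)
  then show "z \<in> lat \<tau>" unfolding lat_def by blast
next
  assume "z \<in> lat \<tau>"
  then obtain p r :: int where "z = of_int p * \<tau> + of_int r"
    unfolding lat_def by auto
  then have "z / \<tau> = of_int (- r) * (- 1 / \<tau>) + of_int p"
    using assms by (simp add: field_simps)
  then show "z / \<tau> \<in> lat (- 1 / \<tau>)" unfolding lat_def by blast
qed

lemma Im_inversion: "Im (- 1 / \<tau>) = Im \<tau> / (norm \<tau>)\<^sup>2"
  by (simp add: Im_divide cmod_power2)

text \<open>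
  Inversion changes \<open>(Im v)\<^sup>2 / Im \<tau>\<close>, the exponent in \<open>corr_dbar\<close>, by the imaginary part of the
  holomorphic function \<open>v\<^sup>2 / \<tau>\<close>.
\<close>

lemma Im_square_inversion:
  assumes "Im \<tau> > 0"
  shows "Im (v\<^sup>2 / \<tau>) + (Im (v / \<tau>))\<^sup>2 * (norm \<tau>)\<^sup>2 / Im \<tau> = (Im v)\<^sup>2 / Im \<tau>"
proof -
  define x y a t where "x = Re v" and "y = Im v" and "a = Re \<tau>" and "t = Im \<tau>"
  have t: "t > 0" using assms by (simp add: t_def)
  define R where "R = a\<^sup>2 + t\<^sup>2"
  have R: "R > 0" using t by (simp add: R_def sum_power2_gt_zero_iff)
  have 1: "Im (v / \<tau>) = (y * a - x * t) / R"
    by (simp add: Im_divide x_def y_def a_def t_def R_def)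
  have 2: "Im (v\<^sup>2 / \<tau>) = (2 * x * y * a - (x\<^sup>2 - y\<^sup>2) * t) / R"
    by (simp add: Im_divide Re_power2 Im_power2 x_def y_def a_def t_def R_def)
  have 3: "(norm \<tau>)\<^sup>2 = R"
    by (simp add: cmod_power2 R_def a_def t_def)
  have "(2 * x * y * a - (x\<^sup>2 - y\<^sup>2) * t) * t + (y * a - x * t)\<^sup>2 = y\<^sup>2 * R"
    by (simp add: R_def power2_eq_square algebra_simps)
  then have "(2 * x * y * a - (x\<^sup>2 - y\<^sup>2) * t) * t / (R * t) + (y * a - x * t)\<^sup>2 / (R * t) = y\<^sup>2 * R / (R * t)"
    by (simp only: add_divide_distrib[symmetric])
  then show ?thesis
    unfolding 1 2 3 y_def[symmetric] t_def[symmetric] using R t by (simp add: power_divide power2_eq_square)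
qed

lemma e2pi_mult_cnj: "e2pi w * cnj (e2pi w) = of_real (exp (- 4 * pi * Im w))"
proof -
  have "e2pi w * cnj (e2pi w) = of_real ((norm (e2pi w))\<^sup>2)"
    by (simp only: complex_norm_square)
  also have "(norm (e2pi w))\<^sup>2 = exp (- 4 * pi * Im w)"
    by (simp add: norm_e2pi power2_eq_square flip: exp_add)
  finally show ?thesis .
qed

text \<open>
  The antiholomorphic derivatives of the two sides of the inversion formula agree: with
  \<open>z1 * z2 = u\<^sup>2 / 4 - v\<^sup>2\<close>, the left-hand side is the derivative of the transformed correction times the
  holomorphic factor, and \<open>cnj (1 / \<tau>)\<close> comes from the chain rule. The hypothesis is the inversion of
  the theta functions; it is discharged in \<open>dbar_theta_inversion\<close>.
\<close>

lemma corr_dbar_inversion: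
  assumes "Im \<tau> > 0" "N > 0"
    and W: "dbar_theta N (- 1 / \<tau>) (u / \<tau>) (v / \<tau>)
      = of_real (norm \<tau>) * e2pi (of_nat N * u\<^sup>2 / (4 * \<tau>)) * cnj (e2pi (of_nat N * v\<^sup>2 / \<tau>)) * dbar_theta N \<tau> u v"
  shows "e2pi (- of_nat N * (u\<^sup>2 / 4 - v\<^sup>2) / \<tau>) * corr_dbar N (- 1 / \<tau>) (u / \<tau>) (v / \<tau>) * cnj (1 / \<tau>)
    = \<tau> * corr_dbar N \<tau> u v"
proof -
  define r where "r = norm \<tau>"
  have tau: "\<tau> \<noteq> 0" using assms(1) by auto
  then have r: "r > 0" by (simp add: r_def)
  define C where "C = real N / Im \<tau> * sqrt (Im \<tau> / real N)"
  have C: "real N / (Im \<tau> / r\<^sup>2) * sqrt (Im \<tau> / r\<^sup>2 / real N) = r * C"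
  proof -
    have "sqrt (Im \<tau> / r\<^sup>2 / real N) = sqrt (Im \<tau> / real N / r\<^sup>2)"
      by (simp add: field_simps)
    also have "\<dots> = sqrt (Im \<tau> / real N) / r"
      using r by (simp only: real_sqrt_divide real_sqrt_abs abs_of_pos)
    finally show ?thesis
      using r by (simp add: C_def field_simps power2_eq_square)
  qed
  define E where "E = exp (- (4 * pi * real N * (Im v)\<^sup>2 / Im \<tau>))"
  define E' where "E' = exp (- (4 * pi * real N * (Im (v / \<tau>))\<^sup>2 / (Im \<tau> / r\<^sup>2)))"
  have EE: "exp (- 4 * pi * Im (of_nat N * v\<^sup>2 / \<tau>)) * E' = E"
  proof -
    have "Im (of_nat N * v\<^sup>2 / \<tau>) = real N * Im (v\<^sup>2 / \<tau>)"
      by (metis Im_complex_of_real Re_complex_of_real add.right_neutral mult_zero_left of_real_of_nat_eq times_complex.sel(2) times_divide_eq_right)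
    then have "- 4 * pi * Im (of_nat N * v\<^sup>2 / \<tau>) + - (4 * pi * real N * (Im (v / \<tau>))\<^sup>2 / (Im \<tau> / r\<^sup>2))
        = - (4 * pi * real N) * (Im (v\<^sup>2 / \<tau>) + (Im (v / \<tau>))\<^sup>2 * (norm \<tau>)\<^sup>2 / Im \<tau>)"
      by (simp add: r_def algebra_simps)
    also have "\<dots> = - (4 * pi * real N * (Im v)\<^sup>2 / Im \<tau>)"
      unfolding Im_square_inversion[OF assms(1)] by simp
    finally show ?thesis
      unfolding E_def E'_def exp_add[symmetric] by (rule arg_cong)
  qed
  have e: "e2pi (- of_nat N * (u\<^sup>2 / 4 - v\<^sup>2) / \<tau>) * e2pi (of_nat N * u\<^sup>2 / (4 * \<tau>)) = e2pi (of_nat N * v\<^sup>2 / \<tau>)"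
    unfolding e2pi_add[symmetric] using tau by (intro arg_cong[of _ _ e2pi]) (simp add: field_simps)
  have rr: "of_real r * of_real r * cnj (1 / \<tau>) = \<tau>"
    using tau complex_norm_square[of \<tau>] by (simp add: r_def power2_eq_square field_simps)
  have "e2pi (- of_nat N * (u\<^sup>2 / 4 - v\<^sup>2) / \<tau>) * corr_dbar N (- 1 / \<tau>) (u / \<tau>) (v / \<tau>) * cnj (1 / \<tau>)
    = e2pi (- of_nat N * (u\<^sup>2 / 4 - v\<^sup>2) / \<tau>) * (- \<i> * (of_real r * of_real C * of_real E')
      * (of_real r * e2pi (of_nat N * u\<^sup>2 / (4 * \<tau>)) * cnj (e2pi (of_nat N * v\<^sup>2 / \<tau>)) * dbar_theta N \<tau> u v)) * cnj (1 / \<tau>)"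
    unfolding corr_dbar_def Im_inversion r_def[symmetric] C E'_def[symmetric] W of_real_mult ..
  also have "\<dots> = - \<i> * (of_real r * of_real r * cnj (1 / \<tau>)) * of_real C
      * (((e2pi (- of_nat N * (u\<^sup>2 / 4 - v\<^sup>2) / \<tau>) * e2pi (of_nat N * u\<^sup>2 / (4 * \<tau>))) * cnj (e2pi (of_nat N * v\<^sup>2 / \<tau>))) * of_real E')
      * dbar_theta N \<tau> u v"
    by (simp only: mult_ac)
  also have "\<dots> = - \<i> * \<tau> * of_real C * of_real E * dbar_theta N \<tau> u v"
    unfolding rr unfolding e e2pi_mult_cnj of_real_mult[symmetric] EE by (simp only: of_real_mult mult_ac)
  also have "\<dots> = \<tau> * corr_dbar N \<tau> u v"
    unfolding corr_dbar_def C_def[symmetric] E_def[symmetric] of_real_mult by (simp only: mult_ac)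
  finally show ?thesis .
qed

text \<open>
  The antiholomorphic derivatives cancel, so the real derivative is complex linear.
\<close>

lemma capp_inversion_corr_differentiable:
  assumes "Im \<tau> > 0" "N > 0"
    and W: "\<And>v. dbar_theta N (- 1 / \<tau>) (u / \<tau>) (v / \<tau>)
      = of_real (norm \<tau>) * e2pi (of_nat N * u\<^sup>2 / (4 * \<tau>)) * cnj (e2pi (of_nat N * v\<^sup>2 / \<tau>)) * dbar_theta N \<tau> u v"
  shows "(\<lambda>z. \<tau> * corr N 0 \<tau> u (z - u / 2)
    - e2pi (- of_nat N * (z * (u - z)) / \<tau>) * corr N 0 (- 1 / \<tau>) (u / \<tau>) ((z - u / 2) / \<tau>)) field_differentiable (at z)"
proof -
  have tau: "\<tau> \<noteq> 0" using assms(1) by auto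
  have im: "Im (- 1 / \<tau>) > 0"
    unfolding Im_inversion using assms(1) tau by simp
  define v where "v = z - u / 2"
  let ?k = "\<lambda>z. e2pi (- of_nat N * (z * (u - z)) / \<tau>)"
  let ?c1 = "corr N 0 \<tau> u" and ?c2 = "corr N 0 (- 1 / \<tau>) (u / \<tau>)"
  let ?G1 = "corr_dbar N \<tau> u v" and ?G2 = "corr_dbar N (- 1 / \<tau>) (u / \<tau>) (v / \<tau>)"
  obtain A1 where A1: "(?c1 has_derivative (\<lambda>h. A1 * h + ?G1 * cnj h)) (at v)"
    using corr_has_derivative[OF assms(1,2)] by metis
  obtain A2 where A2: "(?c2 has_derivative (\<lambda>h. A2 * h + ?G2 * cnj h)) (at (v / \<tau>))"
    using corr_has_derivative[OF im assms(2)] by metis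
  have 1: "((\<lambda>z. ?c1 (z - u / 2)) has_derivative (\<lambda>h. A1 * h + ?G1 * cnj h)) (at z)"
    by (rule has_derivative_compose[where f = "\<lambda>z. z - u / 2" and f' = "\<lambda>h. h" and g = ?c1])
       (auto intro!: derivative_eq_intros A1[unfolded v_def] simp: v_def)
  have 2: "((\<lambda>z. ?c2 ((z - u / 2) / \<tau>)) has_derivative (\<lambda>h. A2 * (h / \<tau>) + ?G2 * cnj (h / \<tau>))) (at z)"
    by (rule has_derivative_compose[where f = "\<lambda>z. (z - u / 2) / \<tau>" and f' = "\<lambda>h. h / \<tau>" and g = ?c2
          and g' = "\<lambda>h. A2 * h + ?G2 * cnj h"])
       (use A2 tau in \<open>auto intro!: derivative_eq_intros simp: v_def\<close>)
  have "?k holomorphic_on UNIV"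
    using tau by (intro holomorphic_intros) auto
  then obtain k' where "(?k has_field_derivative k') (at z)"
    using holomorphic_on_imp_differentiable_at[of ?k UNIV z] unfolding field_differentiable_def by auto
  then have 3: "(?k has_derivative (\<lambda>h. k' * h)) (at z)"
    unfolding has_field_derivative_def .
  have kG: "?k z * ?G2 * cnj (1 / \<tau>) = \<tau> * ?G1"
  proof -
    have "z * (u - z) = u\<^sup>2 / 4 - v\<^sup>2"
      by (simp add: v_def power2_eq_square field_simps)
    then show ?thesis
      using corr_dbar_inversion[OF assms(1,2) W] by simp
  qed
  have "((\<lambda>z. \<tau> * ?c1 (z - u / 2) - ?k z * ?c2 ((z - u / 2) / \<tau>)) has_derivative
     (\<lambda>h. \<tau> * (A1 * h + ?G1 * cnj h)
        - (?k z * (A2 * (h / \<tau>) + ?G2 * cnj (h / \<tau>)) + k' * h * ?c2 ((z - u / 2) / \<tau>)))) (at z)"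
    by (intro has_derivative_diff has_derivative_mult has_derivative_mult_right 1 2 3)
  moreover have "\<tau> * (A1 * h + ?G1 * cnj h)
        - (?k z * (A2 * (h / \<tau>) + ?G2 * cnj (h / \<tau>)) + k' * h * ?c2 ((z - u / 2) / \<tau>))
      = (\<tau> * A1 - ?k z * A2 / \<tau> - k' * ?c2 ((z - u / 2) / \<tau>)) * h" for h
  proof -
    have "?k z * (?G2 * cnj (h / \<tau>)) = (?k z * ?G2 * cnj (1 / \<tau>)) * cnj h"
      by simp
    also have "\<dots> = \<tau> * ?G1 * cnj h"
      by (simp only: kG)
    finally have "?k z * (?G2 * cnj (h / \<tau>)) = \<tau> * ?G1 * cnj h" .
    then have "\<tau> * (A1 * h + ?G1 * cnj h)
        - (?k z * (A2 * (h / \<tau>)) + ?k z * (?G2 * cnj (h / \<tau>)) + k' * h * ?c2 ((z - u / 2) / \<tau>))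
      = (\<tau> * A1 - ?k z * A2 / \<tau> - k' * ?c2 ((z - u / 2) / \<tau>)) * h"
      by (simp only:) (simp add: algebra_simps)
    then show ?thesis
      by (simp only: distrib_left)
  qed
  ultimately show ?thesis
    unfolding field_differentiable_def has_field_derivative_def by auto
qed

text \<open>
  For fixed \<open>u = z1 + z2\<close> the difference \<open>D\<close> of the two sides is differentiable off the lattice, its
  residues vanish, and its translation behaviour is that of negative degree.
\<close>

lemma capp_inversion:
  assumes "Im \<tau> > 0" "N > 0"
    and W: "\<And>u v. dbar_theta N (- 1 / \<tau>) (u / \<tau>) (v / \<tau>)
      = of_real (norm \<tau>) * e2pi (of_nat N * u\<^sup>2 / (4 * \<tau>)) * cnj (e2pi (of_nat N * v\<^sup>2 / \<tau>)) * dbar_theta N \<tau> u v"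
    and z1: "z1 \<notin> lat \<tau>"
  shows "capp N 0 (- 1 / \<tau>) (z1 / \<tau>) (z2 / \<tau>) = \<tau> * e2pi (of_nat N * (z1 * z2) / \<tau>) * capp N 0 \<tau> z1 z2"
proof -
  have tau: "\<tau> \<noteq> 0" using assms(1) by auto
  have im: "Im (- 1 / \<tau>) > 0"
    unfolding Im_inversion using assms(1) tau by simp
  define u where "u = z1 + z2"
  let ?k = "\<lambda>z. e2pi (- of_nat N * (z * (u - z)) / \<tau>)"
  let ?c1 = "\<lambda>z. capp N 0 \<tau> z (u - z)" and ?c2 = "\<lambda>z. capp N 0 (- 1 / \<tau>) (z / \<tau>) ((u - z) / \<tau>)"
  define D where "D z = \<tau> * ?c1 z - ?k z * ?c2 z" for z
  define K where "K z = \<tau> * corr N 0 \<tau> u (z - u / 2) - ?k z * corr N 0 (- 1 / \<tau>) (u / \<tau>) ((z - u / 2) / \<tau>)" for z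
  have D: "D z = \<tau> * appell N 0 \<tau> u z - ?k z * appell N 0 (- 1 / \<tau>) (u / \<tau>) (z / \<tau>) + K z" for z
  proof -
    have e: "z + (u - z) = u" "(z - (u - z)) / 2 = z - u / 2" "z / \<tau> + (u - z) / \<tau> = u / \<tau>"
      "(z / \<tau> - (u - z) / \<tau>) / 2 = (z - u / 2) / \<tau>"
      using tau by (simp_all add: field_simps)
    show ?thesis
      unfolding D_def K_def capp_def e by (simp add: algebra_simps)
  qed
  have K: "K field_differentiable (at z)" for z
    unfolding K_def by (rule capp_inversion_corr_differentiable[OF assms(1,2) W])
  have "D z1 = 0"
  proof (rule negative_degree_eq_0[OF assms(1), where D = D and z = z1 and w = "u / 2" and c = "2 * pi * real N / Im \<tau>"])
    show "2 * pi * real N / Im \<tau> > 0" using assms by simp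
    show "z1 \<notin> lat \<tau>" by (rule z1)
  next
    fix z assume z: "z \<notin> lat \<tau>"
    have "(\<lambda>z. appell N 0 (- 1 / \<tau>) (u / \<tau>) (z / \<tau>)) field_differentiable (at z)"
    proof -
      have "appell N 0 (- 1 / \<tau>) (u / \<tau>) field_differentiable (at (z / \<tau>))"
        using z lat_inversion_iff[OF tau] by (intro appell_differentiable im assms(2)) auto
      moreover have "(\<lambda>z. z / \<tau>) field_differentiable (at z)"
        by (intro derivative_intros) (use tau in auto)
      ultimately show ?thesis
        using field_differentiable_compose[of "\<lambda>z. z / \<tau>" z "appell N 0 (- 1 / \<tau>) (u / \<tau>)"] by (simp add: o_def)
    qed
    moreover have "?k field_differentiable (at z)"
    proof (rule holomorphic_on_imp_differentiable_at)
      show "?k holomorphic_on UNIV"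
        using tau by (intro holomorphic_intros) auto
    qed auto
    ultimately have "(\<lambda>z. \<tau> * appell N 0 \<tau> u z - ?k z * appell N 0 (- 1 / \<tau>) (u / \<tau>) (z / \<tau>) + K z) field_differentiable (at z)"
      by (intro field_differentiable_add field_differentiable_diff field_differentiable_mult
          field_differentiable_const appell_differentiable assms z K)
    then show "D field_differentiable (at z)"
      unfolding D[abs_def] .
  next
    fix p assume "p \<in> lat \<tau>"
    then obtain i' r :: int where "p = of_int i' * \<tau> + of_int r"
      unfolding lat_def by auto
    then obtain i r :: int where p: "p = of_int r - of_int i * \<tau>"
      by (metis add.commute diff_minus_eq_add minus_mult_left of_int_minus)
    \<comment> \<open>The pole \<open>p\<close> belongs to the summand \<open>i\<close> at \<open>\<tau>\<close> and to the summand \<open>r\<close> at \<open>- 1 / \<tau>\<close>; the two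
      residues cancel.\<close>
    define R where "R = - e2pi (of_nat N * (of_int i * u + (of_int i)\<^sup>2 * \<tau>)) / (2 * of_real pi * \<i>)"
    define R' where "R' = - e2pi (of_nat N * (of_int r * (u / \<tau>) + (of_int r)\<^sup>2 * (- 1 / \<tau>))) / (2 * of_real pi * \<i>)"
    have 1: "((\<lambda>z. (z - p) * appell N 0 \<tau> u z) \<longlongrightarrow> R) (at p)"
      unfolding R_def by (rule appell_residue[OF assms(1,2) p])
    have pt: "p / \<tau> = of_int (- i) - of_int r * (- 1 / \<tau>)"
      using tau by (simp add: p field_simps)
    have f: "filterlim (\<lambda>z. z / \<tau>) (at (p / \<tau>)) (at p)"
      using tau by (intro filterlim_atI tendsto_intros) (auto simp: eventually_at_filter)
    have 2: "((\<lambda>z. (z / \<tau> - p / \<tau>) * appell N 0 (- 1 / \<tau>) (u / \<tau>) (z / \<tau>)) \<longlongrightarrow> R') (at p)"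
      unfolding R'_def by (rule filterlim_compose[OF appell_residue[OF im assms(2) pt] f])
    have k: "(?k \<longlongrightarrow> ?k p) (at p)"
      unfolding e2pi_def using tau by (intro tendsto_intros)
    have "((\<lambda>z. z - p) \<longlongrightarrow> 0) (at p)"
      by (rule tendsto_eq_intros refl | simp)+
    moreover have "(K \<longlongrightarrow> K p) (at p)"
      using field_differentiable_imp_continuous_at[OF K] by (simp add: isCont_def)
    ultimately have "((\<lambda>z. \<tau> * ((z - p) * appell N 0 \<tau> u z)
        - \<tau> * ?k z * ((z / \<tau> - p / \<tau>) * appell N 0 (- 1 / \<tau>) (u / \<tau>) (z / \<tau>)) + (z - p) * K z)
        \<longlongrightarrow> \<tau> * R - \<tau> * ?k p * R' + 0 * K p) (at p)"
      by (intro tendsto_intros 1 2 k)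
    moreover have "\<tau> * ((z - p) * appell N 0 \<tau> u z)
        - \<tau> * ?k z * ((z / \<tau> - p / \<tau>) * appell N 0 (- 1 / \<tau>) (u / \<tau>) (z / \<tau>)) + (z - p) * K z = (z - p) * D z" for z
    proof -
      have "\<tau> * (z / \<tau> - p / \<tau>) = z - p"
        using tau by (simp add: field_simps)
      moreover have "\<tau> * ?k z * ((z / \<tau> - p / \<tau>) * appell N 0 (- 1 / \<tau>) (u / \<tau>) (z / \<tau>))
          = (\<tau> * (z / \<tau> - p / \<tau>)) * (?k z * appell N 0 (- 1 / \<tau>) (u / \<tau>) (z / \<tau>))"
        by (simp only: mult_ac)
      ultimately have e: "\<tau> * ?k z * ((z / \<tau> - p / \<tau>) * appell N 0 (- 1 / \<tau>) (u / \<tau>) (z / \<tau>))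
          = (z - p) * (?k z * appell N 0 (- 1 / \<tau>) (u / \<tau>) (z / \<tau>))"
        by (simp only:)
      show ?thesis
        unfolding D e by (simp only: distrib_left right_diff_distrib mult_ac)
    qed
    moreover have "?k p * R' = R"
    proof -
      have "?k p * e2pi (of_nat N * (of_int r * (u / \<tau>) + (of_int r)\<^sup>2 * (- 1 / \<tau>)))
          = e2pi (of_nat N * (of_int i * u + (of_int i)\<^sup>2 * \<tau>))"
        unfolding e2pi_add[symmetric] p using tau
        by (intro e2pi_eqI[of _ _ "- 2 * int N * r * i"]) (simp add: field_simps power2_eq_square)
      then show ?thesis
        unfolding R_def R'_def by simp
    qed
    ultimately show "((\<lambda>z. (z - p) * D z) \<longlongrightarrow> 0) (at p)"
      by (simp add: mult.assoc)
  next
    fix z assume z: "z \<notin> lat \<tau>"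
    then have zt: "z / \<tau> \<notin> lat (- 1 / \<tau>)"
      using lat_inversion_iff[OF tau] by simp
    \<comment> \<open>Translation by 1 is trivial for \<open>?c1\<close>, while in \<open>?c2\<close> it is a translation by the period
      \<open>- 1 / \<tau>\<close>; for translation by \<open>\<tau>\<close> the roles are exchanged.\<close>
    have "?c1 (z + 1) = ?c1 z"
      using capp_add_int[OF assms(2), of 0 \<tau> z 1 "u - z" "- 1"] by (simp add: algebra_simps)
    moreover have "?k (z + 1) * ?c2 (z + 1) = ?k z * ?c2 z"
    proof -
      have e: "(z + 1) / \<tau> = z / \<tau> + of_int (- 1) * (- 1 / \<tau>)" "(u - (z + 1)) / \<tau> = (u - z) / \<tau> + of_int 1 * (- 1 / \<tau>)"
        using tau by (simp_all add: field_simps)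
      have x: "?k (z + 1) * e2pi (- of_nat N * (of_int (- 1 * 1) * (- 1 / \<tau>) + of_int 1 * (z / \<tau>) + of_int (- 1) * ((u - z) / \<tau>))) = ?k z"
        unfolding e2pi_add[symmetric] using tau by (intro arg_cong[of _ _ e2pi]) (simp add: field_simps)
      show ?thesis
        unfolding e capp_add_tau[OF im assms(2)] capp_indep[OF im assms(2) zt, of "0 + int N * (- 1 - 1)"]
        using arg_cong[OF x, of "\<lambda>y. y * ?c2 z"] by (simp only: mult.assoc)
    qed
    ultimately show "norm (D (z + 1)) = norm (D z)"
      by (simp add: D_def)
  next
    fix z assume z: "z \<notin> lat \<tau>"
    let ?e = "e2pi (- of_nat N * (u - 2 * z - \<tau>))"
    have "?c1 (z + \<tau>) = ?e * ?c1 z"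
    proof -
      have e: "z + \<tau> = z + of_int 1 * \<tau>" "u - (z + \<tau>) = u - z + of_int (- 1) * \<tau>"
        by simp_all
      show ?thesis
        unfolding e(2) unfolding e(1) capp_add_tau[OF assms(1,2)] capp_indep[OF assms(1,2) z, of "0 + int N * (1 - - 1)"]
        by (intro arg_cong2[of _ _ _ _ "(*)"] arg_cong[of _ _ e2pi] refl) (simp add: algebra_simps)
    qed
    moreover have "?c2 (z + \<tau>) = ?c2 z"
    proof -
      have e: "(z + \<tau>) / \<tau> = z / \<tau> + of_int 1" "(u - (z + \<tau>)) / \<tau> = (u - z) / \<tau> + of_int (- 1)"
        using tau by (simp_all add: field_simps)
      show ?thesis unfolding e capp_add_int[OF assms(2)] ..
    qed
    moreover have "?k (z + \<tau>) = ?e * ?k z"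
      unfolding e2pi_add[symmetric] using tau by (intro arg_cong[of _ _ e2pi]) (simp add: field_simps)
    ultimately have "D (z + \<tau>) = ?e * D z"
      by (simp add: D_def algebra_simps)
    moreover have "norm ?e * exp (2 * pi * real N / Im \<tau> * (Im (z + \<tau> - u / 2))\<^sup>2)
        = exp (2 * pi * real N / Im \<tau> * (Im (z - u / 2))\<^sup>2)"
    proof -
      define y where "y = Im (z - u / 2)"
      have 1: "Im (- of_nat N * (u - 2 * z - \<tau>)) = real N * (2 * y + Im \<tau>)"
        by (simp add: y_def algebra_simps)
      have 2: "Im (z + \<tau> - u / 2) = y + Im \<tau>"
        by (simp add: y_def)
      show ?thesis
        unfolding norm_e2pi 1 2 y_def[symmetric] exp_add[symmetric] using assms(1)
        by (intro arg_cong[of _ _ exp]) (simp add: field_simps power2_eq_square)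
    qed
    ultimately show "norm (D (z + \<tau>)) * exp (2 * pi * real N / Im \<tau> * (Im (z + \<tau> - u / 2))\<^sup>2)
        = norm (D z) * exp (2 * pi * real N / Im \<tau> * (Im (z - u / 2))\<^sup>2)"
      by (simp add: norm_mult mult_ac)
  qed
  then have "?k z1 * ?c2 z1 = \<tau> * ?c1 z1"
    by (simp add: D_def)
  moreover have "u - z1 = z2" by (simp add: u_def)
  ultimately have "e2pi (- (of_nat N * (z1 * z2) / \<tau>)) * capp N 0 (- 1 / \<tau>) (z1 / \<tau>) (z2 / \<tau>) = \<tau> * capp N 0 \<tau> z1 z2"
    by simp
  then show ?thesis
    unfolding e2pi_minus by (simp add: field_simps)
qed

section \<open>The Jacobi triple product\<close>

definition theta0_term :: "complex \<Rightarrow> complex \<Rightarrow> int \<Rightarrow> complex" where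
  "theta0_term \<tau> z n = e2pi ((of_int n)\<^sup>2 * \<tau> / 2 + of_int n * z)"

definition theta0 :: "complex \<Rightarrow> complex \<Rightarrow> complex" where
  "theta0 \<tau> z = (\<Sum>\<^sub>\<infinity>n. theta0_term \<tau> z n)"

text \<open>
  The infinite \<open>q\<close>-Pochhammer symbol of \<open>q * x\<close>.
\<close>

definition euler :: "complex \<Rightarrow> complex \<Rightarrow> complex" where
  "euler q x = (\<Prod>n. 1 - q ^ (n + 1) * x)"

lemma norm_theta0_term:
  "norm (theta0_term \<tau> z n) = exp (- (pi * Im \<tau>) * (of_int n)\<^sup>2 - 2 * pi * of_int n * Im z)"
proof -
  have "Im ((of_int n)\<^sup>2 * \<tau> / 2 + of_int n * z) = (of_int n)\<^sup>2 * Im \<tau> / 2 + of_int n * Im z"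
  proof -
    have "(of_int n)\<^sup>2 = complex_of_real ((of_int n)\<^sup>2)" by simp
    then show ?thesis
      by (simp only: plus_complex.sel Im_complex_of_real times_complex.sel) (simp add: Im_divide_numeral)
  qed
  then show ?thesis
    by (simp add: theta0_term_def norm_e2pi field_simps)
qed

lemma norm_theta0_term_le:
  assumes "t \<le> Im \<tau>" "\<bar>Im z\<bar> \<le> \<rho>"
  shows "norm (theta0_term \<tau> z n) \<le> exp (- (pi * t) * (of_int n)\<^sup>2 + 2 * pi * \<rho> * \<bar>of_int n\<bar>)"
proof -
  have "- (of_int n * Im z) \<le> \<bar>of_int n\<bar> * \<bar>Im z\<bar>"
    by (metis abs_ge_minus_self abs_mult)
  also have "\<dots> \<le> \<rho> * \<bar>of_int n\<bar>"
    using mult_right_mono[OF assms(2), of "\<bar>of_int n\<bar>"] by (simp add: mult.commute)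
  finally have 1: "2 * pi * - (of_int n * Im z) \<le> 2 * pi * (\<rho> * \<bar>of_int n\<bar>)"
    by (intro mult_left_mono) auto
  have 2: "pi * t * (of_int n)\<^sup>2 \<le> pi * Im \<tau> * (of_int n)\<^sup>2"
    using assms(1) by (intro mult_right_mono mult_left_mono) auto
  show ?thesis
    unfolding norm_theta0_term exp_le_cancel_iff using 1 2 by (simp only: mult.assoc mult_minus_left mult_minus_right)
qed

lemma summable_theta0:
  assumes "Im \<tau> > 0"
  shows "theta0_term \<tau> z summable_on UNIV" and "(\<lambda>n. norm (theta0_term \<tau> z n)) summable_on UNIV"
proof -
  have a: "pi * Im \<tau> > 0" using assms by simp
  show "theta0_term \<tau> z summable_on UNIV"
    by (rule summable_gauss_comparison[OF a, where K = 1 and b = "2 * pi * \<bar>Im z\<bar>"])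
       (use norm_theta0_term_le[OF order_refl order_refl] in auto)
  show "(\<lambda>n. norm (theta0_term \<tau> z n)) summable_on UNIV"
    by (rule Infinite_Sum.abs_summable_on_comparison_test'[OF summable_gauss[OF a, where b = "2 * pi * \<bar>Im z\<bar>"]])
       (use norm_theta0_term_le[OF order_refl order_refl] in auto)
qed

context
  fixes q :: complex
  assumes q: "norm q < 1"
begin

lemma summable_euler: "summable (\<lambda>n. norm (q ^ (n + 1)) * c)"
proof -
  have "summable (\<lambda>n. norm q * c * norm q ^ n)"
    using q by (intro summable_mult summable_geometric) auto
  then show ?thesis by (simp add: norm_power norm_mult mult_ac)
qed

lemma convergent_prod_euler: "convergent_prod (\<lambda>n. 1 - q ^ (n + 1) * x)"
  using summable_euler[of "norm x"]
  by (intro abs_convergent_prod_imp_convergent_prod summable_imp_abs_convergent_prod)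
     (simp add: norm_mult)

lemma euler_LIMSEQ: "(\<lambda>K. \<Prod>n<K. 1 - q ^ (n + 1) * x) \<longlonglongrightarrow> euler q x"
  unfolding euler_def using convergent_prod_LIMSEQ[OF convergent_prod_euler] LIMSEQ_lessThan_iff_atMost by blast

lemma euler_nonzero: "(\<And>n. q ^ (n + 1) * x \<noteq> 1) \<Longrightarrow> euler q x \<noteq> 0"
  unfolding euler_def by (rule prodinf_nonzero[OF convergent_prod_euler]) (metis eq_iff_diff_eq_0)

lemma power_neq_1: "q ^ (n + 1) \<noteq> 1"
proof
  assume "q ^ (n + 1) = 1"
  then have "norm q ^ (n + 1) = 1"
    by (metis norm_one norm_power)
  moreover have "norm q ^ (n + 1) \<le> norm q"
    using q power_le_one[of "norm q" n] by (simp add: mult_left_le)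
  ultimately show False using q by simp
qed

lemma continuous_on_euler: "continuous_on UNIV (euler q)"
proof -
  have "continuous_on (cball 0 R) (euler q)" for R
  proof -
    have "uniformly_convergent_on (cball 0 R) (\<lambda>N x. \<Sum>n<N. norm ((1 - q ^ (n + 1) * x) - 1))"
      by (rule Weierstrass_m_test'[OF _ summable_euler[of R]])
         (auto simp: norm_mult intro!: mult_left_mono)
    then have "uniformly_convergent_on (cball 0 R) (\<lambda>K x. \<Prod>n<K. 1 - q ^ (n + 1) * x)"
      by (intro uniformly_convergent_on_prod' continuous_intros) auto
    then have "uniform_limit (cball 0 R) (\<lambda>K x. \<Prod>n<K. 1 - q ^ (n + 1) * x)
        (\<lambda>x. lim (\<lambda>K. \<Prod>n<K. 1 - q ^ (n + 1) * x)) sequentially"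
      by (simp add: uniformly_convergent_uniform_limit_iff)
    moreover have "lim (\<lambda>K. \<Prod>n<K. 1 - q ^ (n + 1) * x) = euler q x" for x
      by (rule limI[OF euler_LIMSEQ])
    ultimately have "uniform_limit (cball 0 R) (\<lambda>K x. \<Prod>n<K. 1 - q ^ (n + 1) * x) (euler q) sequentially"
      by simp
    then show ?thesis
      by (rule uniform_limit_theorem[rotated]) (auto intro!: always_eventually continuous_intros)
  qed
  then have "isCont (euler q) x" for x
    by (rule continuous_on_interior[of "cball 0 (norm x + 1)"]) simp
  then show ?thesis
    by (simp add: continuous_at_imp_continuous_on)
qed

end

text \<open>
  The finite \<open>q\<close>-Pochhammer symbol of \<open>q\<close>, that is, \<open>(1 - q) ^ n\<close> times the \<open>q\<close>-factorial.
\<close>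

definition qfac :: "complex \<Rightarrow> nat \<Rightarrow> complex" where
  "qfac q n = (\<Prod>i<n. 1 - q ^ (i + 1))"

text \<open>
  The Gaussian binomial coefficients, defined by the \<open>q\<close>-analogue of Pascal's rule.
\<close>

fun qbin :: "complex \<Rightarrow> nat \<Rightarrow> nat \<Rightarrow> complex" where
  "qbin q n 0 = 1"
| "qbin q 0 (Suc k) = 0"
| "qbin q (Suc n) (Suc k) = qbin q n k + q ^ Suc k * qbin q n (Suc k)"

lemma qbin_eq_0: "n < k \<Longrightarrow> qbin q n k = 0"
  by (induction q n k rule: qbin.induct) auto

lemma qfac_Suc: "qfac q (Suc n) = qfac q n * (1 - q ^ Suc n)"
  by (simp add: qfac_def)

lemma qbin_qfac: "k \<le> n \<Longrightarrow> qbin q n k * qfac q k * qfac q (n - k) = qfac q n"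
proof (induction q n k rule: qbin.induct)
  case (3 q n k)
  show ?case
  proof (cases "k = n")
    case True
    have q0: "qfac q 0 = 1"
      by (simp add: qfac_def)
    have 1: "qbin q n n * qfac q n = qfac q n"
      using "3.IH"(1) True by (simp only: q0 le_refl diff_self_eq_0 mult_1_right)
    have "qbin q (Suc n) (Suc k) * qfac q (Suc k) * qfac q (Suc n - Suc k)
        = (qbin q n n * qfac q n) * (1 - q ^ Suc n)"
      by (simp add: True qbin_eq_0 qfac_Suc q0 mult.assoc del: power_Suc)
    also have "\<dots> = qfac q (Suc n)"
      by (simp only: 1 qfac_Suc)
    finally show ?thesis .
  next
    case False
    with "3.prems" have k: "k \<le> n" "Suc k \<le> n" by auto
    then obtain d where d: "n = Suc k + d"
      using le_Suc_ex by blast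
    have 1: "qbin q n k * qfac q k * (qfac q d * (1 - q ^ Suc d)) = qfac q n"
      using "3.IH"(1) k by (simp add: d qfac_Suc Suc_diff_le)
    have 2: "qbin q n (Suc k) * (qfac q k * (1 - q ^ Suc k)) * qfac q d = qfac q n"
      using "3.IH"(2) k by (simp add: d qfac_Suc)
    have "qbin q (Suc n) (Suc k) * qfac q (Suc k) * qfac q (Suc n - Suc k)
      = (qbin q n k + q ^ Suc k * qbin q n (Suc k)) * (qfac q k * (1 - q ^ Suc k)) * (qfac q d * (1 - q ^ Suc d))"
      by (simp add: d qfac_Suc Suc_diff_le del: power_Suc)
    also have "\<dots> = (1 - q ^ Suc k) * (qbin q n k * qfac q k * (qfac q d * (1 - q ^ Suc d)))
        + q ^ Suc k * (1 - q ^ Suc d) * (qbin q n (Suc k) * (qfac q k * (1 - q ^ Suc k)) * qfac q d)"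
      by (simp add: algebra_simps del: power_Suc)
    also have "\<dots> = (1 - q ^ Suc k) * qfac q n + q ^ Suc k * (1 - q ^ Suc d) * qfac q n"
      by (simp only: 1 2)
    also have "\<dots> = qfac q n * (1 - q ^ (Suc k + Suc d))"
      by (simp add: algebra_simps power_add)
    also have "\<dots> = qfac q (Suc n)"
      by (simp add: qfac_Suc d)
    finally show ?thesis .
  qed
qed (simp_all add: qfac_def)

lemma q_binomial: "(\<Prod>i<n. 1 + x * q ^ i) = (\<Sum>k\<le>n. q ^ (k choose 2) * qbin q n k * x ^ k)"
proof (induction n arbitrary: x)
  case 0
  then show ?case by (simp add: numeral_2_eq_2)
next
  case (Suc n)
  define a where "a k = q ^ (k choose 2) * qbin q n k * (x * q) ^ k" for k
  have "(\<Prod>i<Suc n. 1 + x * q ^ i) = (1 + x) * (\<Prod>i<n. 1 + (x * q) * q ^ i)"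
    by (subst prod.lessThan_Suc_shift) (simp add: mult_ac)
  also have "\<dots> = (1 + x) * (\<Sum>k\<le>n. a k)"
    unfolding Suc.IH a_def ..
  also have "\<dots> = (\<Sum>k\<le>Suc n. a k) + (\<Sum>k\<le>n. x * a k)"
    by (simp add: a_def qbin_eq_0 distrib_right sum_distrib_left sum.distrib)
  also have "\<dots> = a 0 + (\<Sum>k\<le>n. a (Suc k) + x * a k)"
    by (simp only: sum.atMost_Suc_shift sum.distrib add.assoc)
  finally have 1: "(\<Prod>i<Suc n. 1 + x * q ^ i) = a 0 + (\<Sum>k\<le>n. a (Suc k) + x * a k)" .
  have t: "a (Suc k) + x * a k = q ^ (Suc k choose 2) * qbin q (Suc n) (Suc k) * x ^ Suc k" for k
  proof -
    have c: "Suc k choose 2 = k + (k choose 2)"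
      by (simp add: numeral_2_eq_2)
    show ?thesis
      unfolding a_def c by (simp add: power_add power_mult_distrib algebra_simps)
  qed
  have a0: "a 0 = q ^ (0 choose 2) * qbin q (Suc n) 0 * x ^ 0"
    by (simp add: a_def numeral_2_eq_2)
  show ?case
    unfolding 1 t a0 sum.atMost_Suc_shift[of _ n] ..
qed

lemma prod_lessThan_add: "(\<Prod>i<a + b. f i) = (\<Prod>i<a. f i) * (\<Prod>i<b. f (a + i))" for f :: "nat \<Rightarrow> complex"
  by (induction b) (simp_all add: mult.assoc)

text \<open>The finite form of the triple product is the \<open>q\<close>-binomial theorem for an even number of factors.\<close>

lemma finite_triple_product:
  "(\<Prod>n<K. (1 + e2pi (z + (of_nat n + 1 / 2) * \<tau>)) * (1 + e2pi (- z + (of_nat n + 1 / 2) * \<tau>)))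
    = (\<Sum>k\<le>2 * K. qbin (e2pi \<tau>) (2 * K) k * theta0_term \<tau> z (int k - int K))"
proof -
  \<comment> \<open>The factors of the \<open>q\<close>-binomial product for \<open>x\<close> are those of the triple product, except that half of
    them are inverted; \<open>C\<close> collects the monomials that this takes.\<close>
  define x where "x = e2pi (z + (1 / 2 - of_nat K) * \<tau>)"
  define C where "C = e2pi (of_nat K * z - (of_nat K)\<^sup>2 * \<tau> / 2)"
  define f where "f i = 1 + x * e2pi \<tau> ^ i" for i
  have f: "f i = 1 + e2pi (z + (of_nat i + 1 / 2 - of_nat K) * \<tau>)" for i
    unfolding f_def x_def e2pi_power e2pi_add[symmetric] by (simp add: algebra_simps)
  have "(\<Prod>i<2 * K. f i) = (\<Prod>i<K. f i) * (\<Prod>i<K. f (K + i))"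
    unfolding mult_2 by (rule prod_lessThan_add)
  also have "(\<Prod>i<K. f (K + i)) = (\<Prod>i<K. 1 + e2pi (z + (of_nat i + 1 / 2) * \<tau>))"
    unfolding f by (simp add: algebra_simps)
  also have "(\<Prod>i<K. f i) = (\<Prod>i<K. f (K - Suc i))"
    by (rule prod.nat_diff_reindex[symmetric])
  also have "\<dots> = (\<Prod>i<K. e2pi (z - (of_nat i + 1 / 2) * \<tau>) * (1 + e2pi (- z + (of_nat i + 1 / 2) * \<tau>)))"
  proof (rule prod.cong[OF refl])
    fix i assume "i \<in> {..<K}"
    then have "of_nat (K - Suc i) = (of_nat K - of_nat i - 1 :: complex)"
      by (simp add: of_nat_diff)
    then have "of_nat (K - Suc i) + 1 / 2 - of_nat K = - (of_nat i + 1 / 2 :: complex)"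
      by (simp only:) simp
    then have "f (K - Suc i) = 1 + e2pi (z - (of_nat i + 1 / 2) * \<tau>)"
      unfolding f by (simp only: mult_minus_left add_uminus_conv_diff)
    moreover have "e2pi (z - (of_nat i + 1 / 2) * \<tau>) * e2pi (- z + (of_nat i + 1 / 2) * \<tau>) = 1"
      unfolding e2pi_add[symmetric] by (simp add: algebra_simps)
    ultimately show "f (K - Suc i) = e2pi (z - (of_nat i + 1 / 2) * \<tau>) * (1 + e2pi (- z + (of_nat i + 1 / 2) * \<tau>))"
      by (simp add: distrib_left)
  qed
  also have "\<dots> = (\<Prod>i<K. e2pi (z - (of_nat i + 1 / 2) * \<tau>)) * (\<Prod>i<K. 1 + e2pi (- z + (of_nat i + 1 / 2) * \<tau>))"
    by (rule prod.distrib)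
  also have "(\<Prod>i<K. e2pi (z - (of_nat i + 1 / 2) * \<tau>)) = C"
    unfolding C_def
  proof (induction K)
    case (Suc K)
    show ?case
      unfolding prod.lessThan_Suc Suc e2pi_add[symmetric]
      by (rule arg_cong[of _ _ e2pi]) (simp add: field_simps power2_eq_square)
  qed simp
  finally have 1: "(\<Prod>i<2 * K. f i) = C * (\<Prod>n<K. (1 + e2pi (z + (of_nat n + 1 / 2) * \<tau>)) * (1 + e2pi (- z + (of_nat n + 1 / 2) * \<tau>)))"
    by (simp add: prod.distrib mult_ac)
  have t: "e2pi \<tau> ^ (k choose 2) * qbin (e2pi \<tau>) (2 * K) k * x ^ k
      = C * (qbin (e2pi \<tau>) (2 * K) k * theta0_term \<tau> z (int k - int K))" for k
  proof -
    have k: "of_nat (k choose 2) = (of_nat k * (of_nat k - 1) / 2 :: complex)"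
    proof -
      have "real (k choose 2) = real k * (real k - 1) / 2"
        by (cases k) (simp_all add: choose_two real_of_nat_div field_simps)
      then have "complex_of_real (real (k choose 2)) = complex_of_real (real k * (real k - 1) / 2)"
        by (rule arg_cong)
      then show ?thesis by simp
    qed
    have "e2pi \<tau> ^ (k choose 2) * x ^ k = C * theta0_term \<tau> z (int k - int K)"
      unfolding C_def theta0_term_def x_def e2pi_power e2pi_add[symmetric] k
      by (intro arg_cong[of _ _ e2pi]) (simp add: field_simps power2_eq_square)
    then show ?thesis by (simp add: mult_ac)
  qed
  have "(\<Prod>i<2 * K. f i) = C * (\<Sum>k\<le>2 * K. qbin (e2pi \<tau>) (2 * K) k * theta0_term \<tau> z (int k - int K))"
    unfolding f_def q_binomial t sum_distrib_left ..
  then show ?thesis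
    unfolding 1 by (simp add: C_def)
qed

lemma norm_e2pi_less_1: "Im \<tau> > 0 \<Longrightarrow> norm (e2pi \<tau>) < 1"
  by (simp add: norm_e2pi)

text \<open>
  After multiplication by \<open>qfac\<close> the coefficients of the finite triple product are bounded and tend
  to 1, so the limit may be taken termwise by dominated convergence.
\<close>

lemma triple_product_LIMSEQ:
  assumes "Im \<tau> > 0"
  shows "(\<lambda>K. qfac (e2pi \<tau>) K
    * (\<Prod>n<K. (1 + e2pi (z + (of_nat n + 1 / 2) * \<tau>)) * (1 + e2pi (- z + (of_nat n + 1 / 2) * \<tau>)))) \<longlonglongrightarrow> theta0 \<tau> z"
proof -
  define q where "q = e2pi \<tau>"
  have q: "norm q < 1" using assms by (simp add: q_def norm_e2pi_less_1)
  define \<phi> where "\<phi> = euler q 1"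
  have lim: "qfac q \<longlonglongrightarrow> \<phi>"
    using euler_LIMSEQ[OF q, of 1] by (simp add: qfac_def[abs_def] \<phi>_def)
  have nz: "\<phi> \<noteq> 0"
    unfolding \<phi>_def using power_neq_1[OF q] by (intro euler_nonzero[OF q]) auto
  have qnz: "qfac q n \<noteq> 0" for n
    unfolding qfac_def using power_neq_1[OF q] by (auto simp: prod_zero_iff)
  obtain A where A: "A > 0" "\<And>n. norm (qfac q n) \<le> A"
    using convergent_imp_Bseq[OF convergentI[OF lim]] by (auto simp: Bseq_def)
  obtain B where B: "B > 0" "\<And>n. norm (inverse (qfac q n)) \<le> B"
    using convergent_imp_Bseq[OF convergentI[OF tendsto_inverse[OF lim nz]]] by (auto simp: Bseq_def)
  \<comment> \<open>The coefficient of \<open>theta0_term \<tau> z j\<close> in the product of \<open>K\<close> factors.\<close>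
  define g where "g K j = (if \<bar>j\<bar> \<le> int K then qfac q K * qfac q (2 * K) * inverse (qfac q (nat (int K + j))) * inverse (qfac q (nat (int K - j))) else 0)" for K j
  have g: "norm (g K j) \<le> A * A * B * B" for K j
  proof (cases "\<bar>j\<bar> \<le> int K")
    case True
    then show ?thesis
      unfolding g_def using A B by (simp only: norm_mult if_True) (intro mult_mono; simp add: less_imp_le)
  next
    case False
    then show ?thesis using A(1) B(1) by (simp add: g_def)
  qed
  have glim: "(\<lambda>K. g K j) \<longlonglongrightarrow> 1" for j
  proof -
    have f1: "filterlim (\<lambda>K. nat (int K + i)) sequentially sequentially" for i
    proof (rule filterlim_at_top_mono)
      show "filterlim (\<lambda>K. K - nat \<bar>i\<bar>) sequentially sequentially"
        by (rule filterlim_minus_const_nat_at_top)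
    qed (auto intro!: always_eventually)
    have f2: "filterlim (\<lambda>K::nat. 2 * K) sequentially sequentially"
      by (rule mult_nat_left_at_top) simp
    have "(\<lambda>K. qfac q K * qfac q (2 * K) * inverse (qfac q (nat (int K + j))) * inverse (qfac q (nat (int K + - j))))
        \<longlonglongrightarrow> \<phi> * \<phi> * inverse \<phi> * inverse \<phi>"
      by (intro tendsto_intros lim nz filterlim_compose[OF lim f1] filterlim_compose[OF lim f2])
    moreover have "\<forall>\<^sub>F K in sequentially. qfac q K * qfac q (2 * K) * inverse (qfac q (nat (int K + j))) * inverse (qfac q (nat (int K + - j))) = g K j"
      unfolding eventually_sequentially by (rule exI[of _ "nat \<bar>j\<bar>"]) (auto simp: g_def)
    ultimately have "(\<lambda>K. g K j) \<longlonglongrightarrow> \<phi> * \<phi> * inverse \<phi> * inverse \<phi>"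
      by (rule Lim_transform_eventually)
    moreover have "\<phi> * \<phi> * inverse \<phi> * inverse \<phi> = 1"
      using nz by (simp add: field_simps)
    ultimately show ?thesis
      by (simp only:)
  qed
  let ?t = "theta0_term \<tau> z"
  have sum: "qfac q K * (\<Sum>k\<le>2 * K. qbin q (2 * K) k * ?t (int k - int K)) = (\<Sum>\<^sub>\<infinity>j. g K j * ?t j)" for K
  proof -
    have gk: "qfac q K * qbin q (2 * K) k = g K (int k - int K)" if "k \<le> 2 * K" for k
    proof -
      have "nat (int K - (int k - int K)) = 2 * K - k"
        using that by linarith
      moreover have "qbin q (2 * K) k = qfac q (2 * K) * inverse (qfac q k) * inverse (qfac q (2 * K - k))"
        using qbin_qfac[OF that, of q] qnz by (simp add: field_simps)
      ultimately show ?thesis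
        using that by (simp add: g_def)
    qed
    have "qfac q K * (\<Sum>k\<le>2 * K. qbin q (2 * K) k * ?t (int k - int K)) = (\<Sum>k\<le>2 * K. g K (int k - int K) * ?t (int k - int K))"
      unfolding sum_distrib_left by (rule sum.cong[OF refl]) (use gk in \<open>simp flip: mult.assoc\<close>)
    also have "\<dots> = (\<Sum>j\<in>{- int K..int K}. g K j * ?t j)"
      by (rule sum.reindex_bij_witness[of _ "\<lambda>j. nat (j + int K)" "\<lambda>k. int k - int K"]) auto
    also have "\<dots> = (\<Sum>\<^sub>\<infinity>j\<in>{- int K..int K}. g K j * ?t j)"
      by simp
    also have "\<dots> = (\<Sum>\<^sub>\<infinity>j. g K j * ?t j)"
      by (rule infsum_cong_neutral) (auto simp: g_def)
    finally show ?thesis .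
  qed
  have "uniform_limit UNIV (\<lambda>X K. \<Sum>j\<in>X. g K j * ?t j) (\<lambda>K. \<Sum>\<^sub>\<infinity>j. g K j * ?t j) (finite_subsets_at_top UNIV)"
  proof (rule Weierstrass_m_test_general)
    show "(\<lambda>j. A * A * B * B * norm (?t j)) summable_on UNIV"
      by (intro summable_on_cmult_right summable_theta0 assms)
  qed (use g in \<open>auto simp: norm_mult intro!: mult_right_mono\<close>)
  moreover have "\<forall>\<^sub>F X in finite_subsets_at_top UNIV. (\<lambda>K. \<Sum>j\<in>X. g K j * ?t j) \<longlonglongrightarrow> (\<Sum>j\<in>X. 1 * ?t j)"
    by (intro always_eventually allI tendsto_intros glim)
  moreover have "((\<lambda>X. \<Sum>j\<in>X. 1 * ?t j) \<longlongrightarrow> theta0 \<tau> z) (finite_subsets_at_top UNIV)"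
    unfolding theta0_def using infsum_tendsto[OF summable_theta0(1)[OF assms]] by simp
  ultimately have "(\<lambda>K. \<Sum>\<^sub>\<infinity>j. g K j * ?t j) \<longlonglongrightarrow> theta0 \<tau> z"
    using swap_uniform_limit'[of "\<lambda>X K. \<Sum>j\<in>X. g K j * ?t j" "\<lambda>X. \<Sum>j\<in>X. 1 * ?t j" sequentially
        "finite_subsets_at_top UNIV" "theta0 \<tau> z" UNIV] by simp
  then show ?thesis
    unfolding finite_triple_product sum[symmetric] q_def .
qed

text \<open>The argument is normalized such that the zeros are the points of the lattice.\<close>

lemma theta0_eq_product:
  assumes "Im \<tau> > 0"
  shows "theta0 \<tau> (z + 1 / 2 + \<tau> / 2)
    = (1 - e2pi (- z)) * euler (e2pi \<tau>) 1 * euler (e2pi \<tau>) (e2pi z) * euler (e2pi \<tau>) (e2pi (- z))"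
proof -
  define q where "q = e2pi \<tau>"
  have q: "norm q < 1" using assms by (simp add: q_def norm_e2pi_less_1)
  let ?z = "z + 1 / 2 + \<tau> / 2"
  let ?P = "\<lambda>x K. \<Prod>n<K. 1 - q ^ (n + 1) * x"
  have half: "e2pi (1 / 2) = - 1" "e2pi (- 1 / 2) = - 1"
    by (simp_all add: e2pi_def exp_minus exp_pi_i' mult.commute)
  have f1: "1 + e2pi (?z + (of_nat n + 1 / 2) * \<tau>) = 1 - q ^ (n + 1) * e2pi z" for n
  proof -
    have "e2pi (?z + (of_nat n + 1 / 2) * \<tau>) = e2pi (1 / 2) * (e2pi (of_nat (n + 1) * \<tau>) * e2pi z)"
      unfolding e2pi_add[symmetric] by (intro arg_cong[of _ _ e2pi]) (simp add: field_simps)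
    then show ?thesis by (simp only: half q_def e2pi_power) simp
  qed
  have f2: "1 + e2pi (- ?z + (of_nat n + 1 / 2) * \<tau>) = 1 - q ^ n * e2pi (- z)" for n
  proof -
    have "e2pi (- ?z + (of_nat n + 1 / 2) * \<tau>) = e2pi (- 1 / 2) * (e2pi (of_nat n * \<tau>) * e2pi (- z))"
      unfolding e2pi_add[symmetric] by (intro arg_cong[of _ _ e2pi]) (simp add: field_simps)
    then show ?thesis by (simp only: half q_def e2pi_power) simp
  qed
  have f3: "(\<Prod>n<K. 1 - q ^ n * e2pi (- z)) * (1 - q ^ K * e2pi (- z)) = (1 - e2pi (- z)) * ?P (e2pi (- z)) K" for K
  proof -
    have "(\<Prod>n<Suc K. 1 - q ^ n * e2pi (- z)) = (1 - e2pi (- z)) * ?P (e2pi (- z)) K"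
      by (subst prod.lessThan_Suc_shift) simp
    then show ?thesis by simp
  qed
  have "(\<lambda>K. qfac q K * (\<Prod>n<K. (1 - q ^ (n + 1) * e2pi z) * (1 - q ^ n * e2pi (- z)))) \<longlonglongrightarrow> theta0 \<tau> ?z"
    using triple_product_LIMSEQ[OF assms, of ?z] unfolding f1 f2 q_def[symmetric] .
  moreover have "(\<lambda>K. 1 - q ^ K * e2pi (- z)) \<longlonglongrightarrow> 1 - 0 * e2pi (- z)"
    by (intro tendsto_intros LIMSEQ_power_zero q)
  ultimately have "(\<lambda>K. (qfac q K * (\<Prod>n<K. (1 - q ^ (n + 1) * e2pi z) * (1 - q ^ n * e2pi (- z)))) * (1 - q ^ K * e2pi (- z)))
      \<longlonglongrightarrow> theta0 \<tau> ?z * (1 - 0 * e2pi (- z))"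
    by (rule tendsto_mult)
  moreover have "(qfac q K * (\<Prod>n<K. (1 - q ^ (n + 1) * e2pi z) * (1 - q ^ n * e2pi (- z)))) * (1 - q ^ K * e2pi (- z))
      = (1 - e2pi (- z)) * ?P 1 K * ?P (e2pi z) K * ?P (e2pi (- z)) K" for K
    using arg_cong[OF f3[of K], of "\<lambda>y. qfac q K * ?P (e2pi z) K * y"]
    by (simp add: prod.distrib qfac_def mult_ac)
  ultimately have "(\<lambda>K. (1 - e2pi (- z)) * ?P 1 K * ?P (e2pi z) K * ?P (e2pi (- z)) K) \<longlonglongrightarrow> theta0 \<tau> ?z"
    by simp
  moreover have "(\<lambda>K. (1 - e2pi (- z)) * ?P 1 K * ?P (e2pi z) K * ?P (e2pi (- z)) K)
      \<longlonglongrightarrow> (1 - e2pi (- z)) * euler q 1 * euler q (e2pi z) * euler q (e2pi (- z))"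
    by (intro tendsto_mult tendsto_const euler_LIMSEQ q)
  ultimately show ?thesis
    unfolding q_def[symmetric] using LIMSEQ_unique by blast
qed

lemma euler_1_nonzero: "Im \<tau> > 0 \<Longrightarrow> euler (e2pi \<tau>) 1 \<noteq> 0"
  using power_neq_1[OF norm_e2pi_less_1] by (intro euler_nonzero norm_e2pi_less_1) auto

lemma theta0_nonzero:
  assumes "Im \<tau> > 0" "z \<notin> lat \<tau>"
  shows "theta0 \<tau> (z + 1 / 2 + \<tau> / 2) \<noteq> 0"
proof -
  have e: "e2pi (z + of_int j * \<tau>) \<noteq> 1" for j
    using e2pi_eq_1_imp_lat assms(2) by blast
  have 1: "e2pi \<tau> ^ (n + 1) * e2pi z \<noteq> 1" for n
    using e[of "int (n + 1)"] unfolding e2pi_power e2pi_add[symmetric] by (simp add: algebra_simps)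
  have 2: "e2pi \<tau> ^ n * e2pi (- z) \<noteq> 1" for n
  proof
    assume "e2pi \<tau> ^ n * e2pi (- z) = 1"
    then have "e2pi (z + of_int (- int n) * \<tau>) = 1"
      unfolding e2pi_power e2pi_add[symmetric]
      using e2pi_minus[of "of_nat n * \<tau> + - z"] by (simp add: algebra_simps)
    then show False using e by blast
  qed
  show ?thesis
    unfolding theta0_eq_product[OF assms(1)] using 2[of 0] euler_1_nonzero[OF assms(1)]
      euler_nonzero[OF norm_e2pi_less_1[OF assms(1)] 1] euler_nonzero[OF norm_e2pi_less_1[OF assms(1)] 2]
    by auto
qed

text \<open>
  The zero at \<open>1 / 2 + \<tau> / 2\<close> is simple.
\<close>

lemma theta0_limit_0:
  assumes "Im \<tau> > 0"
  shows "((\<lambda>z. theta0 \<tau> (z + 1 / 2 + \<tau> / 2) / z) \<longlongrightarrow> 2 * of_real pi * \<i> * euler (e2pi \<tau>) 1 ^ 3) (at 0)"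
proof -
  let ?E = "euler (e2pi \<tau>)"
  have "((\<lambda>z. 1 - e2pi (- z)) has_field_derivative 2 * of_real pi * \<i>) (at 0)"
    by (auto intro!: derivative_eq_intros)
  then have 1: "((\<lambda>z. (1 - e2pi (- z)) / z) \<longlongrightarrow> 2 * of_real pi * \<i>) (at 0)"
    by (simp add: has_field_derivative_iff)
  have E: "(?E \<longlongrightarrow> ?E x) (nhds x)" for x
    using continuous_on_euler[OF norm_e2pi_less_1[OF assms]]
    by (simp add: continuous_on_eq_continuous_at isCont_def tendsto_at_iff_tendsto_nhds)
  have e: "((\<lambda>z. e2pi (c * z)) \<longlongrightarrow> 1) (at 0)" for c
  proof -
    have "((\<lambda>z. e2pi (c * z)) \<longlongrightarrow> e2pi (c * 0)) (at 0)"
      unfolding e2pi_def by (intro tendsto_intros)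
    then show ?thesis by simp
  qed
  have 2: "((\<lambda>z. ?E (e2pi z)) \<longlongrightarrow> ?E 1) (at 0)"
    using filterlim_compose[OF E e[of 1]] by simp
  have 3: "((\<lambda>z. ?E (e2pi (- z))) \<longlongrightarrow> ?E 1) (at 0)"
    using filterlim_compose[OF E e[of "- 1"]] by simp
  have "((\<lambda>z. (1 - e2pi (- z)) / z * ?E 1 * ?E (e2pi z) * ?E (e2pi (- z))) \<longlongrightarrow> 2 * of_real pi * \<i> * ?E 1 * ?E 1 * ?E 1) (at 0)"
    by (intro tendsto_mult tendsto_const 1 2 3)
  then show ?thesis
    unfolding theta0_eq_product[OF assms] by (simp add: power3_eq_cube mult_ac)
qed

section \<open>The inversion of the theta function\<close>

lemma theta0_add_int: "theta0 \<tau> (z + of_int p) = theta0 \<tau> z"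
  unfolding theta0_def theta0_term_def
proof (rule infsum_cong)
  fix n :: int
  show "e2pi ((of_int n)\<^sup>2 * \<tau> / 2 + of_int n * (z + of_int p)) = e2pi ((of_int n)\<^sup>2 * \<tau> / 2 + of_int n * z)"
    by (rule e2pi_eqI[of _ _ "n * p"]) (simp add: algebra_simps)
qed

lemma theta0_add_tau: "theta0 \<tau> (z + \<tau>) = e2pi (- \<tau> / 2 - z) * theta0 \<tau> z"
proof -
  have "theta0_term \<tau> (z + \<tau>) n = e2pi (- \<tau> / 2 - z) * theta0_term \<tau> z (n + 1)" for n
    unfolding theta0_term_def e2pi_add[symmetric]
    by (intro arg_cong[of _ _ e2pi]) (simp add: field_simps power2_eq_square)
  then have "theta0 \<tau> (z + \<tau>) = (\<Sum>\<^sub>\<infinity>n. e2pi (- \<tau> / 2 - z) * theta0_term \<tau> z (n + 1))"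
    by (simp add: theta0_def)
  then show ?thesis
    unfolding infsum_cmult_right' infsum_shift_int theta0_def .
qed

lemma theta0_uminus: "theta0 \<tau> (- z) = theta0 \<tau> z"
proof -
  have "theta0 \<tau> (- z) = (\<Sum>\<^sub>\<infinity>n. theta0_term \<tau> z (- n))"
    by (simp add: theta0_def theta0_term_def)
  then show ?thesis
    by (simp add: infsum_uminus_int theta0_def)
qed

definition theta0_deriv :: "nat \<Rightarrow> complex \<Rightarrow> complex \<Rightarrow> complex" where
  "theta0_deriv k \<tau> z = (\<Sum>\<^sub>\<infinity>n. (2 * of_real pi * \<i> * of_int n) ^ k * theta0_term \<tau> z n)"

lemma theta0_deriv_0: "theta0_deriv 0 = theta0"
  by (simp add: theta0_deriv_def theta0_def fun_eq_iff)

lemma norm_theta0_deriv_term_le: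
  assumes "t \<le> Im \<tau>" "\<bar>Im z\<bar> \<le> \<rho>"
  shows "norm ((2 * of_real pi * \<i> * of_int n) ^ k * theta0_term \<tau> z n)
    \<le> exp (- (pi * t) * (of_int n)\<^sup>2 + 2 * pi * (\<rho> + real k) * \<bar>of_int n\<bar>)"
proof -
  have "norm ((2 * of_real pi * \<i> * of_int n) ^ k) = (2 * pi * \<bar>of_int n\<bar>) ^ k"
    by (simp add: norm_power norm_mult)
  also have "\<dots> \<le> exp (2 * pi * \<bar>of_int n\<bar>) ^ k"
  proof (rule power_mono)
    show "2 * pi * \<bar>of_int n\<bar> \<le> exp (2 * pi * \<bar>of_int n\<bar>)"
      using exp_ge_add_one_self[of "2 * pi * \<bar>of_int n\<bar>"] by linarith
  qed auto
  also have "\<dots> = exp (real k * (2 * pi * \<bar>of_int n\<bar>))"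
    by (simp add: exp_of_nat_mult)
  finally have "norm ((2 * of_real pi * \<i> * of_int n) ^ k * theta0_term \<tau> z n)
    \<le> exp (real k * (2 * pi * \<bar>of_int n\<bar>)) * exp (- (pi * t) * (of_int n)\<^sup>2 + 2 * pi * \<rho> * \<bar>of_int n\<bar>)"
    unfolding norm_mult[of "_ ^ k"] by (intro mult_mono norm_theta0_term_le assms) auto
  also have "\<dots> = exp (- (pi * t) * (of_int n)\<^sup>2 + 2 * pi * (\<rho> + real k) * \<bar>of_int n\<bar>)"
    unfolding exp_add[symmetric] by (intro arg_cong[of _ _ exp]) (simp add: algebra_simps)
  finally show ?thesis .
qed

lemma summable_theta0_deriv:
  assumes "Im \<tau> > 0"
  shows "(\<lambda>n. (2 * of_real pi * \<i> * of_int n) ^ k * theta0_term \<tau> z n) summable_on UNIV"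
  by (rule summable_gauss_comparison[where K = 1 and a = "pi * Im \<tau>" and b = "2 * pi * (\<bar>Im z\<bar> + real k)"])
     (use assms norm_theta0_deriv_term_le[OF order_refl order_refl] in auto)

lemma has_field_derivative_infsum_int:
  fixes f A :: "int \<Rightarrow> complex \<Rightarrow> complex" and M :: "int \<Rightarrow> real"
  assumes "convex S" "open S"
    and D: "\<And>n x. x \<in> S \<Longrightarrow> (f n has_field_derivative A n x) (at x)"
    and A: "\<And>n x. x \<in> S \<Longrightarrow> norm (A n x) \<le> M n"
    and M: "M summable_on UNIV" and f: "\<And>x. x \<in> S \<Longrightarrow> (\<lambda>n. f n x) summable_on UNIV"
    and x: "x \<in> S"
  shows "((\<lambda>x. \<Sum>\<^sub>\<infinity>n. f n x) has_field_derivative (\<Sum>\<^sub>\<infinity>n. A n x)) (at x)"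
proof -
  have "((\<lambda>x. \<Sum>\<^sub>\<infinity>n. f n x) has_derivative (\<lambda>h. (\<Sum>\<^sub>\<infinity>n. A n x) * h + (\<Sum>\<^sub>\<infinity>n::int. 0) * cnj h)) (at x)"
  proof (rule has_derivative_infsum_int[where B = "\<lambda>_ _. 0", OF assms(1,2) _ A _ M f x])
    show "(f n has_derivative (\<lambda>h. A n x * h + 0 * cnj h)) (at x)" if "x \<in> S" for n x
      using D[OF that] by (simp add: has_field_derivative_def)
    show "norm (0::complex) \<le> M n" if "x \<in> S" for n and x :: complex
      using order_trans[OF norm_ge_zero A[OF that, of n]] by simp
  qed auto
  then show ?thesis
    by (simp add: has_field_derivative_def)
qed

lemma DERIV_theta0_deriv:
  assumes "Im \<tau> > 0"
  shows "(theta0_deriv k \<tau> has_field_derivative theta0_deriv (Suc k) \<tau> z) (at z)"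
  unfolding theta0_deriv_def[abs_def]
proof (rule has_field_derivative_infsum_int[of "ball 0 (norm z + 1)"])
  let ?M = "\<lambda>n. exp (- (pi * Im \<tau>) * (of_int n)\<^sup>2 + 2 * pi * ((norm z + 1) + real (Suc k)) * \<bar>real_of_int n\<bar>)"
  show "?M summable_on UNIV"
    using assms by (intro summable_gauss) auto
  fix n and x :: complex assume x: "x \<in> ball 0 (norm z + 1)"
  then have "\<bar>Im x\<bar> \<le> norm z + 1"
    using abs_Im_le_cmod[of x] by auto
  then show "norm ((2 * of_real pi * \<i> * of_int n) ^ Suc k * theta0_term \<tau> x n) \<le> ?M n"
    by (rule norm_theta0_deriv_term_le[OF order_refl])
  show "((\<lambda>x. (2 * of_real pi * \<i> * of_int n) ^ k * theta0_term \<tau> x n)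
      has_field_derivative (2 * of_real pi * \<i> * of_int n) ^ Suc k * theta0_term \<tau> x n) (at x)"
    unfolding theta0_term_def by (auto intro!: derivative_eq_intros)
qed (use summable_theta0_deriv[OF assms] in auto)

lemma DERIV_theta0:
  assumes "Im \<tau> > 0" "(f has_field_derivative f') (at z)"
  shows "((\<lambda>z. theta0 \<tau> (f z)) has_field_derivative theta0_deriv 1 \<tau> (f z) * f') (at z)"
    and "((\<lambda>z. theta0_deriv 1 \<tau> (f z)) has_field_derivative theta0_deriv 2 \<tau> (f z) * f') (at z)"
  using DERIV_chain2[OF DERIV_theta0_deriv[OF assms(1), of 0] assms(2)]
    DERIV_chain2[OF DERIV_theta0_deriv[OF assms(1), of 1] assms(2)]
  by (simp_all add: theta0_deriv_0 numeral_2_eq_2)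

text \<open>The heat equation: the derivative in \<open>\<tau>\<close> is a multiple of the second derivative in \<open>z\<close>.\<close>

lemma DERIV_theta0_tau:
  assumes "Im \<tau> > 0"
  shows "((\<lambda>\<tau>. theta0 \<tau> z) has_field_derivative theta0_deriv 2 \<tau> z / (4 * of_real pi * \<i>)) (at \<tau>)"
proof -
  define t where "t = Im \<tau> / 2"
  have t: "t > 0" using assms by (simp add: t_def)
  let ?S = "{x. t < Im x}"
  let ?A = "\<lambda>n x. (2 * of_real pi * \<i> * of_int n) ^ 2 * theta0_term x z n / (4 * of_real pi * \<i>)"
  let ?M = "\<lambda>n. 1 / (4 * pi) * exp (- (pi * t) * (of_int n)\<^sup>2 + 2 * pi * (\<bar>Im z\<bar> + real 2) * \<bar>real_of_int n\<bar>)"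
  have "((\<lambda>\<tau>. \<Sum>\<^sub>\<infinity>n. theta0_term \<tau> z n) has_field_derivative (\<Sum>\<^sub>\<infinity>n. ?A n \<tau>)) (at \<tau>)"
  proof (rule has_field_derivative_infsum_int[of ?S])
    show "convex ?S" by (rule convex_halfspace_Im_gt)
    show "open ?S" by (rule open_halfspace_Im_gt)
    show "?M summable_on UNIV"
      using t by (intro summable_on_cmult_right summable_gauss) auto
    show "\<tau> \<in> ?S" using assms by (simp add: t_def)
    show "(\<lambda>n. theta0_term x z n) summable_on UNIV" if "x \<in> ?S" for x
      using summable_theta0(1)[of x z] that t by auto
    fix n x assume x: "x \<in> ?S"
    have "norm (?A n x) = 1 / (4 * pi) * norm ((2 * of_real pi * \<i> * of_int n) ^ 2 * theta0_term x z n)"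
      by (simp add: norm_divide norm_mult)
    also have "\<dots> \<le> ?M n"
      using x by (intro mult_left_mono norm_theta0_deriv_term_le[of t]) auto
    finally show "norm (?A n x) \<le> ?M n" .
    have "((\<lambda>x. theta0_term x z n) has_field_derivative 2 * of_real pi * \<i> * ((of_int n)\<^sup>2 / 2) * theta0_term x z n) (at x)"
      unfolding theta0_term_def by (auto intro!: derivative_eq_intros)
    moreover have "2 * of_real pi * \<i> * ((of_int n)\<^sup>2 / 2) * theta0_term x z n = ?A n x"
      by (simp add: field_simps power2_eq_square)
    ultimately show "((\<lambda>x. theta0_term x z n) has_field_derivative ?A n x) (at x)"
      by simp
  qed
  moreover have "(\<Sum>\<^sub>\<infinity>n. ?A n \<tau>) = theta0_deriv 2 \<tau> z / (4 * of_real pi * \<i>)"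
    unfolding theta0_deriv_def divide_inverse infsum_cmult_left' ..
  ultimately show ?thesis
    unfolding theta0_def[abs_def] by simp
qed

lemma half_notin_lat:
  assumes "Im \<tau> > 0"
  shows "- 1 / 2 - \<tau> / 2 \<notin> lat \<tau>"
proof
  assume "- 1 / 2 - \<tau> / 2 \<in> lat \<tau>"
  then obtain p r :: int where "- 1 / 2 - \<tau> / 2 = of_int p * \<tau> + of_int r"
    unfolding lat_def by auto
  then have "Im (- 1 / 2 - \<tau> / 2) = Im (of_int p * \<tau> + of_int r)"
    by (rule arg_cong)
  then have "(2 * of_int p + 1) * Im \<tau> = 0"
    by (simp add: field_simps)
  then have "of_int (2 * p + 1) = (0::real)"
    using assms by simp
  then show False
    by (simp only: of_int_eq_0_iff) presburger
qed

lemma theta0_0_nonzero: "Im \<tau> > 0 \<Longrightarrow> theta0 \<tau> 0 \<noteq> 0"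
  using theta0_nonzero[OF _ half_notin_lat] by fastforce

text \<open>
  An entire function with the same behaviour as \<open>theta0 \<tau>\<close> under translations is a multiple of it,
  provided that it is even: evenness forces a zero at the zeros of \<open>theta0 \<tau>\<close>, which are simple.
\<close>

lemma theta0_unique:
  assumes "Im \<tau> > 0" and G: "G holomorphic_on UNIV"
    and G1: "\<And>z. G (z + 1) = G z" and Gt: "\<And>z. G (z + \<tau>) = e2pi (- \<tau> / 2 - z) * G z"
    and Ge: "\<And>z. G (- z) = G z"
  obtains c where "\<And>z. G z = c * theta0 \<tau> z"
proof -
  define s where "s = 1 / 2 + \<tau> / 2"
  define F where "F z = G (z + s)" for z
  define T where "T z = theta0 \<tau> (z + s)" for z
  have T: "T z \<noteq> 0" if "z \<notin> lat \<tau>" for z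
    using theta0_nonzero[OF assms(1) that] by (simp add: T_def s_def add.assoc)
  have holG: "G field_differentiable (at z)" for z
    using holomorphic_on_imp_differentiable_at[OF G open_UNIV] by simp
  have holF: "F field_differentiable (at z)" for z
    using holG[of "z + s"] unfolding F_def field_differentiable_def by (auto simp: DERIV_shift)
  have holT: "T field_differentiable (at z)" for z
  proof -
    have "(theta0 \<tau>) field_differentiable (at w)" for w
      using DERIV_theta0(1)[OF assms(1) DERIV_ident, of w] unfolding field_differentiable_def by auto
    from this[of "z + s"] show ?thesis
      unfolding T_def field_differentiable_def by (auto simp: DERIV_shift)
  qed
  have half: "e2pi (- (1 / 2)) = - 1"
    by (simp add: e2pi_def exp_minus exp_pi_i' mult.commute)
  \<comment> \<open>The point \<open>s\<close> is congruent to \<open>- s\<close> modulo the lattice, and the factor of the translation is \<open>- 1\<close>.\<close>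
  have "G s = G ((1 / 2 - \<tau> / 2) + \<tau>)"
    by (simp add: s_def field_simps)
  also have "\<dots> = e2pi (- (1 / 2)) * G (1 / 2 - \<tau> / 2)"
    unfolding Gt by (simp add: algebra_simps)
  also have "G (1 / 2 - \<tau> / 2) = G (- s + 1)"
    by (simp add: s_def field_simps)
  also have "\<dots> = G s"
    by (simp only: G1 Ge)
  finally have Gs: "G s = 0"
    by (simp add: half)
  have FT: "F (z + 1) = F z" "F (z + \<tau>) = e2pi (- \<tau> / 2 - (z + s)) * F z"
    "T (z + 1) = T z" "T (z + \<tau>) = e2pi (- \<tau> / 2 - (z + s)) * T z" for z
    using G1[of "z + s"] Gt[of "z + s"] theta0_add_int[of \<tau> "z + s" 1] theta0_add_tau[of \<tau> "z + s"]
    by (simp_all add: F_def T_def add_ac)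
  have FTi: "F (z + of_int p * \<tau> + of_int r) = 0" if "F z = 0" for z p r
  proof -
    have 1: "F (z + of_int p * \<tau>) = 0"
    proof (induction p rule: int_induct[of _ 0])
      case (step1 i)
      then show ?case using FT(2)[of "z + of_int i * \<tau>"] by (simp add: algebra_simps)
    next
      case (step2 i)
      then show ?case using FT(2)[of "z + of_int (i - 1) * \<tau>"] by (simp add: algebra_simps)
    qed (use that in simp)
    show ?thesis
    proof (induction r rule: int_induct[of _ 0])
      case (step1 i)
      then show ?case using FT(1)[of "z + of_int p * \<tau> + of_int i"] by (simp add: add.assoc)
    next
      case (step2 i)
      then show ?case using FT(1)[of "z + of_int p * \<tau> + of_int (i - 1)"] by (simp add: add.assoc)
    qed (use 1 in simp)
  qed
  define D where "D z = F z / T z" for z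
  have lim0: "((\<lambda>z. z * D z) \<longlongrightarrow> 0) (at 0)"
  proof -
    have "((\<lambda>z. F z / (T z / z)) \<longlongrightarrow> F 0 / (2 * of_real pi * \<i> * euler (e2pi \<tau>) 1 ^ 3)) (at 0)"
    proof (intro tendsto_divide)
      show "(F \<longlongrightarrow> F 0) (at 0)"
        using field_differentiable_imp_continuous_at[OF holF] by (simp add: isCont_def)
      show "((\<lambda>z. T z / z) \<longlongrightarrow> 2 * of_real pi * \<i> * euler (e2pi \<tau>) 1 ^ 3) (at 0)"
        using theta0_limit_0[OF assms(1)] by (simp add: T_def s_def add.assoc)
    qed (use euler_1_nonzero[OF assms(1)] in simp)
    then show ?thesis
      using Gs by (simp add: D_def F_def field_simps)
  qed
  have per1: "D (z + 1) = D z" and pert: "D (z + \<tau>) = D z" for z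
    by (simp_all add: D_def FT)
  have Dper: "D (z + of_int p * \<tau> + of_int r) = D z" for z p r
  proof -
    have 1: "D (z + of_int p * \<tau>) = D z"
    proof (induction p rule: int_induct[of _ 0])
      case (step1 i)
      then show ?case using pert[of "z + of_int i * \<tau>"] by (simp add: algebra_simps)
    next
      case (step2 i)
      then show ?case using pert[of "z + of_int (i - 1) * \<tau>"] by (simp add: algebra_simps)
    qed simp
    show ?thesis
    proof (induction r rule: int_induct[of _ 0])
      case (step1 i)
      then show ?case using per1[of "z + of_int p * \<tau> + of_int i"] by (simp add: add.assoc)
    next
      case (step2 i)
      then show ?case using per1[of "z + of_int p * \<tau> + of_int (i - 1)"] by (simp add: add.assoc)
    qed (use 1 in simp)
  qed
  obtain c where c: "\<And>z. z \<notin> lat \<tau> \<Longrightarrow> D z = c"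
  proof (rule lattice_liouville[of \<tau> 0 D 0])
    fix z assume "z \<notin> lat \<tau>"
    then show "D field_differentiable (at z)"
      unfolding D_def using T by (intro field_differentiable_divide holF holT) auto
  next
    fix p assume "p \<in> lat \<tau>"
    then obtain i r :: int where p: "p = of_int i * \<tau> + of_int r"
      unfolding lat_def by auto
    have "filterlim (\<lambda>z. z - p) (at 0) (at p)"
      by (intro filterlim_atI) (auto intro!: tendsto_eq_intros simp: eventually_neq_at_within)
    from filterlim_compose[OF lim0 this]
    have "((\<lambda>z. (z - p) * D (z - p)) \<longlongrightarrow> 0) (at p)" .
    moreover have "D (z - p) = D z" for z
      using Dper[of "z - p" i r] by (simp add: p)
    ultimately show "((\<lambda>z. (z - p) * D z) \<longlongrightarrow> 0) (at p)"
      by simp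
  qed (use assms(1) per1 pert in auto)
  have FcT: "F z = c * T z" for z
  proof -
    have cT: "c * T w = F w" if "w \<notin> lat \<tau>" for w
      using c[OF that] T[OF that] by (simp add: D_def field_simps)
    have ev: "\<forall>\<^sub>F w in at z. c * T w = F w"
      using eventually_notin_lat[OF assms(1), of z] by eventually_elim (rule cT)
    have cTz: "((\<lambda>w. c * T w) \<longlongrightarrow> c * T z) (at z)" and F: "(F \<longlongrightarrow> F z) (at z)"
      using field_differentiable_imp_continuous_at[OF holT] field_differentiable_imp_continuous_at[OF holF]
      by (auto simp: isCont_def intro!: tendsto_intros)
    show ?thesis
      by (rule tendsto_unique[OF trivial_limit_at F Lim_transform_eventually[OF cTz ev]])
  qed
  have "G z = c * theta0 \<tau> z" for z
    using FcT[of "z - s"] by (simp add: F_def T_def)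
  then show thesis by (rule that)
qed

text \<open>
  A square root of \<open>- \<i> * \<tau>\<close> (\<open>theta0_mult_square\<close>). Its modulus enters the inversion of
  \<open>dbar_theta\<close>, while in the denominators it cancels.
\<close>

definition theta0_mult :: "complex \<Rightarrow> complex" where
  "theta0_mult \<tau> = theta0 (- 1 / \<tau>) 0 / theta0 \<tau> 0"

lemma Im_inversion_pos: "Im \<tau> > 0 \<Longrightarrow> Im (- 1 / \<tau>) > 0"
  unfolding Im_inversion by (metis divide_pos_pos norm_eq_zero order_less_irrefl zero_complex.simps(2) zero_less_power zero_less_norm_iff)

text \<open>
  Divided by the exponential factor, the left-hand side is an even function of \<open>z\<close> that behaves
  under translations like \<open>theta0 \<tau>\<close>: the two periods have exchanged their roles.
\<close>

lemma theta0_inversion: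
  assumes "Im \<tau> > 0"
  shows "theta0 (- 1 / \<tau>) (z / \<tau>) = theta0_mult \<tau> * e2pi (z\<^sup>2 / (2 * \<tau>)) * theta0 \<tau> z"
proof -
  have tau: "\<tau> \<noteq> 0" using assms by auto
  have im: "Im (- 1 / \<tau>) > 0" by (rule Im_inversion_pos[OF assms])
  define G where "G z = e2pi (- z\<^sup>2 / (2 * \<tau>)) * theta0 (- 1 / \<tau>) (z / \<tau>)" for z
  obtain c where c: "\<And>z. G z = c * theta0 \<tau> z"
  proof (rule theta0_unique[OF assms, of G])
    have "(theta0 (- 1 / \<tau>)) holomorphic_on UNIV"
      unfolding holomorphic_on_def field_differentiable_def
      using DERIV_theta0(1)[OF im DERIV_ident] by (auto intro: has_field_derivative_at_within)
    then have "(theta0 (- 1 / \<tau>) \<circ> (\<lambda>z. z / \<tau>)) holomorphic_on UNIV"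
      by (intro holomorphic_on_compose_gen[of _ _ _ UNIV]) (auto intro!: holomorphic_intros simp: tau)
    then show "G holomorphic_on UNIV"
      unfolding G_def o_def using tau by (intro holomorphic_intros) auto
    show "G (z + 1) = G z" for z
    proof -
      have "theta0 (- 1 / \<tau>) (z / \<tau>) = theta0 (- 1 / \<tau>) ((z + 1) / \<tau> + (- 1 / \<tau>))"
        by (simp add: add_divide_distrib)
      also have "\<dots> = e2pi (- (- 1 / \<tau>) / 2 - (z + 1) / \<tau>) * theta0 (- 1 / \<tau>) ((z + 1) / \<tau>)"
        by (rule theta0_add_tau)
      finally have "G z = (e2pi (- z\<^sup>2 / (2 * \<tau>)) * e2pi (- (- 1 / \<tau>) / 2 - (z + 1) / \<tau>)) * theta0 (- 1 / \<tau>) ((z + 1) / \<tau>)"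
        by (simp add: G_def)
      also have "e2pi (- z\<^sup>2 / (2 * \<tau>)) * e2pi (- (- 1 / \<tau>) / 2 - (z + 1) / \<tau>) = e2pi (- (z + 1)\<^sup>2 / (2 * \<tau>))"
        unfolding e2pi_add[symmetric] using tau
        by (intro arg_cong[of _ _ e2pi]) (simp add: field_simps power2_eq_square)
      finally show ?thesis by (simp add: G_def)
    qed
    show "G (z + \<tau>) = e2pi (- \<tau> / 2 - z) * G z" for z
    proof -
      have "theta0 (- 1 / \<tau>) ((z + \<tau>) / \<tau>) = theta0 (- 1 / \<tau>) (z / \<tau>)"
        using theta0_add_int[of "- 1 / \<tau>" "z / \<tau>" 1] tau by (simp add: add_divide_distrib)
      moreover have "e2pi (- (z + \<tau>)\<^sup>2 / (2 * \<tau>)) = e2pi (- \<tau> / 2 - z) * e2pi (- z\<^sup>2 / (2 * \<tau>))"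
        unfolding e2pi_add[symmetric] using tau
        by (intro arg_cong[of _ _ e2pi]) (simp add: field_simps power2_eq_square)
      ultimately show ?thesis by (simp add: G_def)
    qed
    show "G (- z) = G z" for z
      using theta0_uminus[of "- 1 / \<tau>" "z / \<tau>"] by (simp add: G_def)
  qed (rule that)
  have "c = theta0_mult \<tau>"
    using c[of 0] theta0_0_nonzero[OF assms] by (simp add: G_def theta0_mult_def field_simps)
  moreover have "theta0 (- 1 / \<tau>) (z / \<tau>) = e2pi (z\<^sup>2 / (2 * \<tau>)) * G z"
    by (simp add: G_def e2pi_minus)
  ultimately show ?thesis
    unfolding c by simp
qed

text \<open>
  The inversion formula is differentiated twice in \<open>z\<close> and once in \<open>\<tau>\<close>; by the heat equation
  \<open>theta0_mult \<tau> ^ 2 / \<tau>\<close> is constant, and its value is found at the fixed point \<open>\<i>\<close>.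
\<close>

lemma theta0_mult_square:
  assumes "Im \<tau> > 0"
  shows "(theta0_mult \<tau>)\<^sup>2 = - \<i> * \<tau>"
proof -
  have D: "(theta0_mult has_field_derivative theta0_mult \<tau> / (2 * \<tau>)) (at \<tau>)" if im0: "Im \<tau> > 0" for \<tau>
  proof -
    have tau: "\<tau> \<noteq> 0" using im0 by auto
    have im: "Im (- 1 / \<tau>) > 0" by (rule Im_inversion_pos[OF im0])
    define c where "c = theta0_mult \<tau>"
    let ?e = "\<lambda>z. e2pi (z\<^sup>2 / (2 * \<tau>))"
    let ?t = "\<lambda>k. theta0_deriv k (- 1 / \<tau>)"
    let ?s = "\<lambda>k. theta0_deriv k \<tau>"
    have dz: "((\<lambda>z. z / \<tau>) has_field_derivative 1 / \<tau>) (at z)" for z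
      using tau by (auto intro!: derivative_eq_intros)
    have de: "(?e has_field_derivative 2 * of_real pi * \<i> * (z / \<tau>) * ?e z) (at z)" for z
      using tau by (auto intro!: derivative_eq_intros)
    have eq1: "?t 1 (z / \<tau>) * (1 / \<tau>) = c * (2 * of_real pi * \<i> * (z / \<tau>) * ?e z * theta0 \<tau> z + ?e z * ?s 1 z)" for z
    proof (rule DERIV_unique)
      show "((\<lambda>z. theta0 (- 1 / \<tau>) (z / \<tau>)) has_field_derivative ?t 1 (z / \<tau>) * (1 / \<tau>)) (at z)"
        by (rule DERIV_theta0(1)[OF im dz])
      have "((\<lambda>z. c * (?e z * theta0 \<tau> z)) has_field_derivative
          c * (2 * of_real pi * \<i> * (z / \<tau>) * ?e z * theta0 \<tau> z + theta0_deriv 1 \<tau> z * 1 * ?e z)) (at z)"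
        by (intro DERIV_cmult DERIV_mult de DERIV_theta0(1)[OF im0 DERIV_ident])
      then show "((\<lambda>z. theta0 (- 1 / \<tau>) (z / \<tau>)) has_field_derivative
          c * (2 * of_real pi * \<i> * (z / \<tau>) * ?e z * theta0 \<tau> z + ?e z * ?s 1 z)) (at z)"
        unfolding theta0_inversion[OF im0] c_def by (simp add: mult_ac)
    qed
    have eq2: "?t 2 0 * (1 / \<tau>) * (1 / \<tau>) = c * (2 * of_real pi * \<i> / \<tau> * theta0 \<tau> 0 + ?s 2 0)"
    proof (rule DERIV_unique)
      have "((\<lambda>z. ?t 1 (z / \<tau>) * (1 / \<tau>)) has_field_derivative ?t 2 (0 / \<tau>) * (1 / \<tau>) * (1 / \<tau>)) (at 0)"
        by (rule DERIV_cmult_right[OF DERIV_theta0(2)[OF im dz]])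
      then show "((\<lambda>z. ?t 1 (z / \<tau>) * (1 / \<tau>)) has_field_derivative ?t 2 0 * (1 / \<tau>) * (1 / \<tau>)) (at 0)"
        by simp
      have "((\<lambda>z. 2 * of_real pi * \<i> * (z / \<tau>)) has_field_derivative 2 * of_real pi * \<i> * (1 / \<tau>)) (at 0)"
        by (rule DERIV_cmult[OF dz])
      then have "((\<lambda>z. c * (2 * of_real pi * \<i> * (z / \<tau>) * ?e z * theta0 \<tau> z + ?e z * ?s 1 z)) has_field_derivative
          c * (((2 * of_real pi * \<i> * (1 / \<tau>)) * ?e 0 + (2 * of_real pi * \<i> * (0 / \<tau>) * ?e 0) * (2 * of_real pi * \<i> * (0 / \<tau>))) * theta0 \<tau> 0
               + (theta0_deriv 1 \<tau> 0 * 1) * (2 * of_real pi * \<i> * (0 / \<tau>) * ?e 0)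
             + ((2 * of_real pi * \<i> * (0 / \<tau>) * ?e 0) * ?s 1 0 + (theta0_deriv 2 \<tau> 0 * 1) * ?e 0))) (at 0)"
        by (intro DERIV_cmult DERIV_add DERIV_mult dz de DERIV_theta0[OF im0 DERIV_ident])
      then show "((\<lambda>z. ?t 1 (z / \<tau>) * (1 / \<tau>)) has_field_derivative
          c * (2 * of_real pi * \<i> / \<tau> * theta0 \<tau> 0 + ?s 2 0)) (at 0)"
        unfolding eq1 by simp
    qed
    have "((\<lambda>\<tau>. - 1 / \<tau>) has_field_derivative 1 / \<tau>\<^sup>2) (at \<tau>)"
      using tau by (auto intro!: derivative_eq_intros simp: power2_eq_square)
    from DERIV_chain2[OF DERIV_theta0_tau[OF im] this]
    have n: "((\<lambda>\<tau>. theta0 (- 1 / \<tau>) 0) has_field_derivative ?t 2 0 / (4 * of_real pi * \<i>) * (1 / \<tau>\<^sup>2)) (at \<tau>)" .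
    define S where "S = theta0 \<tau> 0"
    have S: "S \<noteq> 0"
      using theta0_0_nonzero[OF im0] by (simp add: S_def)
    have cS: "theta0 (- 1 / \<tau>) 0 = c * S"
      using S by (simp add: c_def theta0_mult_def S_def)
    have "(theta0_mult has_field_derivative
       ((?t 2 0 / (4 * of_real pi * \<i>) * (1 / \<tau>\<^sup>2)) * S - theta0 (- 1 / \<tau>) 0 * (?s 2 0 / (4 * of_real pi * \<i>))) / (S * S)) (at \<tau>)"
      unfolding theta0_mult_def[abs_def] S_def
      by (rule DERIV_divide[OF n DERIV_theta0_tau[OF im0]]) (rule theta0_0_nonzero[OF im0])
    moreover have "((?t 2 0 / (4 * of_real pi * \<i>) * (1 / \<tau>\<^sup>2)) * S - theta0 (- 1 / \<tau>) 0 * (?s 2 0 / (4 * of_real pi * \<i>))) / (S * S)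
      = c / (2 * \<tau>)"
    proof -
      have "?t 2 0 / (4 * of_real pi * \<i>) * (1 / \<tau>\<^sup>2) = (?t 2 0 * (1 / \<tau>) * (1 / \<tau>)) / (4 * of_real pi * \<i>)"
        by (simp add: power2_eq_square)
      also have "\<dots> = c * S / (2 * \<tau>) + c * ?s 2 0 / (4 * of_real pi * \<i>)"
        unfolding eq2 S_def[symmetric] using tau by (simp add: field_simps)
      finally have "?t 2 0 / (4 * of_real pi * \<i>) * (1 / \<tau>\<^sup>2) = c * S / (2 * \<tau>) + c * ?s 2 0 / (4 * of_real pi * \<i>)" .
      then have "(?t 2 0 / (4 * of_real pi * \<i>) * (1 / \<tau>\<^sup>2)) * S - theta0 (- 1 / \<tau>) 0 * (?s 2 0 / (4 * of_real pi * \<i>))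
          = c / (2 * \<tau>) * (S * S)"
        unfolding cS by (simp only:) (simp add: algebra_simps)
      then show ?thesis using S by simp
    qed
    ultimately show ?thesis by (simp add: c_def)
  qed
  have "\<exists>k. \<forall>\<tau>\<in>{\<tau>. 0 < Im \<tau>}. (theta0_mult \<tau>)\<^sup>2 / \<tau> = k"
  proof (rule has_field_derivative_zero_constant)
    show "convex {\<tau>. 0 < Im \<tau>}" by (rule convex_halfspace_Im_gt)
    fix \<tau> assume "\<tau> \<in> {\<tau>. 0 < Im \<tau>}"
    then have im0: "Im \<tau> > 0" and tau: "\<tau> \<noteq> 0" by auto
    have "((\<lambda>\<tau>. (theta0_mult \<tau>)\<^sup>2 / \<tau>) has_field_derivative 0) (at \<tau>)"
      by (rule derivative_eq_intros D[OF im0] refl tau)+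
         (use tau in \<open>simp add: field_simps power2_eq_square\<close>)
    then show "((\<lambda>\<tau>. (theta0_mult \<tau>)\<^sup>2 / \<tau>) has_field_derivative 0) (at \<tau> within {\<tau>. 0 < Im \<tau>})"
      by (rule has_field_derivative_at_within)
  qed
  then obtain k where k: "\<And>\<tau>. Im \<tau> > 0 \<Longrightarrow> (theta0_mult \<tau>)\<^sup>2 / \<tau> = k"
    by auto
  have "theta0_mult \<i> = 1"
    using theta0_0_nonzero[of \<i>] by (simp add: theta0_mult_def)
  then have "k = - \<i>"
    using k[of \<i>] by simp
  moreover have "\<tau> \<noteq> 0"
    using assms by auto
  ultimately show ?thesis
    using k[OF assms] by (simp add: divide_eq_eq)
qed

lemma norm_theta0_mult_square: "Im \<tau> > 0 \<Longrightarrow> (norm (theta0_mult \<tau>))\<^sup>2 = norm \<tau>"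
  using arg_cong[OF theta0_mult_square[of \<tau>], of norm] by (simp add: norm_mult norm_power)

lemma theta0_mult_nonzero: "Im \<tau> > 0 \<Longrightarrow> theta0_mult \<tau> \<noteq> 0"
  using theta0_mult_square[of \<tau>] by auto

section \<open>The inversion of the antiholomorphic derivative\<close>

lemma Theta_eq_theta0:
  assumes "N > 0"
  shows "Theta j N \<tau> z = e2pi (of_int j * z / 2 + (of_int j)\<^sup>2 * \<tau> / (4 * of_nat N))
    * theta0 (2 * of_nat N * \<tau>) (of_nat N * z + of_int j * \<tau>)"
  unfolding Theta_eq[OF assms] theta0_def infsum_cmult_right'[symmetric] theta_term_def theta0_term_def e2pi_add[symmetric]
  using assms by (intro infsum_cong arg_cong[of _ _ e2pi]) (simp add: field_simps power2_eq_square)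

text \<open>
  The modulus \<open>2 * N * \<tau>\<close> of \<open>Theta_eq_theta0\<close> is inverted to \<open>\<tau> / (2 * N)\<close>, and the resulting series
  splits into the functions \<open>Theta l N \<tau>\<close> by the residue \<open>l\<close> of its index modulo \<open>2 * N\<close>.
\<close>

lemma Theta_inversion:
  assumes "Im \<tau> > 0" "N > 0"
  shows "Theta j N (- 1 / \<tau>) (z / \<tau>) = theta0_mult (\<tau> / (2 * of_nat N)) * e2pi (of_nat N * z\<^sup>2 / (4 * \<tau>))
    * (\<Sum>l\<in>{0..<2 * int N}. e2pi (- (of_int (l * j) / (2 * of_nat N))) * Theta l N \<tau> z)"
proof -
  have tau: "\<tau> \<noteq> 0" using assms(1) by auto
  define \<sigma> where "\<sigma> = \<tau> / (2 * of_nat N)"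
  have s: "Im \<sigma> > 0"
    using assms Im_divide_of_nat[of \<tau> "2 * N"] by (simp add: \<sigma>_def)
  define y where "y = (of_nat N * z - of_int j) / (2 * of_nat N)"
  have "2 * of_nat N * (- 1 / \<tau>) = - 1 / \<sigma>" "of_nat N * (z / \<tau>) + of_int j * (- 1 / \<tau>) = y / \<sigma>"
    using tau assms(2) by (simp_all add: \<sigma>_def y_def field_simps)
  then have "Theta j N (- 1 / \<tau>) (z / \<tau>)
      = e2pi (of_int j * (z / \<tau>) / 2 + (of_int j)\<^sup>2 * (- 1 / \<tau>) / (4 * of_nat N)) * theta0 (- 1 / \<sigma>) (y / \<sigma>)"
    unfolding Theta_eq_theta0[OF assms(2)] by (simp only:)
  also have "\<dots> = theta0_mult \<sigma> * (e2pi (of_int j * (z / \<tau>) / 2 + (of_int j)\<^sup>2 * (- 1 / \<tau>) / (4 * of_nat N)) * e2pi (y\<^sup>2 / (2 * \<sigma>))) * theta0 \<sigma> y"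
    unfolding theta0_inversion[OF s] by (simp only: mult_ac)
  also have "e2pi (of_int j * (z / \<tau>) / 2 + (of_int j)\<^sup>2 * (- 1 / \<tau>) / (4 * of_nat N)) * e2pi (y\<^sup>2 / (2 * \<sigma>))
      = e2pi (of_nat N * z\<^sup>2 / (4 * \<tau>))"
    unfolding e2pi_add[symmetric] y_def \<sigma>_def using tau assms(2)
    by (intro arg_cong[of _ _ e2pi]) (simp add: field_simps power2_eq_square)
  also have "theta0 \<sigma> y = (\<Sum>l\<in>{0..<2 * int N}. e2pi (- (of_int (l * j) / (2 * of_nat N))) * Theta l N \<tau> z)"
  proof -
    have bij: "bij_betw (\<lambda>l. l mod int (2 * N)) {0..<2 * int N} {0..<int (2 * N)}"
      using bij_betw_residues[of "int (2 * N)" 1 0 0] assms(2) by simp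
    have S: "theta0 \<sigma> y = (\<Sum>l\<in>{0..<2 * int N}. \<Sum>\<^sub>\<infinity>k. theta0_term \<sigma> y (int (2 * N) * k + l))"
      unfolding theta0_def
      by (rule infsum_residues(1)[OF _ _ summable_theta0(1)[OF s] bij]) (use assms(2) in auto)
    have t: "theta0_term \<sigma> y (int (2 * N) * k + l)
        = e2pi (- (of_int (l * j) / (2 * of_nat N))) * theta_term N \<tau> z (2 * int N * k + l)" for k l
      unfolding theta0_term_def theta_term_def e2pi_add[symmetric] y_def \<sigma>_def using assms(2)
      by (intro e2pi_eqI[of _ _ "- (k * j)"]) (simp add: field_simps power2_eq_square)
    show ?thesis
      unfolding S t infsum_cmult_right' Theta_eq[OF assms(2)] ..
  qed
  finally show ?thesis
    unfolding \<sigma>_def .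
qed

lemma dbar_theta_eq_sum:
  assumes "Im \<tau> > 0" "N > 0"
  shows "dbar_theta N \<tau> u v = (\<Sum>j\<in>{0..<2 * int N}. cnj (Theta j N \<tau> (2 * v)) * Theta (- j) N \<tau> u)"
proof -
  obtain K where K: "K > 0" "\<And>j. norm (Theta j N \<tau> u) \<le> K"
    using Theta_bounded[OF assms(2)] by metis
  have s: "(\<lambda>n. cnj (theta_term N \<tau> (2 * v) n) * Theta (- n) N \<tau> u) summable_on UNIV"
  proof (rule summable_gauss_comparison)
    show "pi * Im \<tau> / (2 * real N) > 0" using assms by simp
    fix n
    show "norm (cnj (theta_term N \<tau> (2 * v) n) * Theta (- n) N \<tau> u)
      \<le> K * exp (- (pi * Im \<tau> / (2 * real N)) * (of_int n)\<^sup>2 + pi * \<bar>Im (2 * v)\<bar> * \<bar>of_int n\<bar>)"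
      unfolding norm_mult complex_mod_cnj
      using mult_mono[OF norm_theta_term_le[of N \<tau> "2 * v" n] K(2)[of "- n"]] by (simp add: mult.commute)
  qed
  have bij: "bij_betw (\<lambda>l. l mod int (2 * N)) {0..<2 * int N} {0..<int (2 * N)}"
    using bij_betw_residues[of "int (2 * N)" 1 0 0] assms(2) by simp
  have "dbar_theta N \<tau> u v = (\<Sum>j\<in>{0..<2 * int N}. \<Sum>\<^sub>\<infinity>k. cnj (theta_term N \<tau> (2 * v) (int (2 * N) * k + j)) * Theta (- (int (2 * N) * k + j)) N \<tau> u)"
    unfolding dbar_theta_def
    by (rule infsum_residues(1)[OF _ _ s bij]) (use assms(2) in auto)
  also have "\<dots> = (\<Sum>j\<in>{0..<2 * int N}. cnj (Theta j N \<tau> (2 * v)) * Theta (- j) N \<tau> u)"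
  proof (rule sum.cong[OF refl])
    fix j
    have "Theta (- (int (2 * N) * k + j)) N \<tau> u = Theta (- j) N \<tau> u" for k
      using Theta_shift[OF assms(2), of "- j" "- k" \<tau> u] by (simp add: algebra_simps)
    then show "(\<Sum>\<^sub>\<infinity>k. cnj (theta_term N \<tau> (2 * v) (int (2 * N) * k + j)) * Theta (- (int (2 * N) * k + j)) N \<tau> u)
        = cnj (Theta j N \<tau> (2 * v)) * Theta (- j) N \<tau> u"
      unfolding Theta_eq[OF assms(2), of j] by (simp add: infsum_cmult_left')
  qed
  finally show ?thesis .
qed

lemma sum_roots_of_unity:
  assumes "K > 0"
  shows "(\<Sum>j\<in>{0..<int K}. e2pi (of_int (r * j) / of_nat K)) = (if int K dvd r then of_nat K else 0)"
proof -
  define w where "w = e2pi (of_int r / of_nat K)"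
  have "(\<Sum>j\<in>{0..<int K}. e2pi (of_int (r * j) / of_nat K)) = (\<Sum>j<K. w ^ j)"
    by (rule sum.reindex_bij_witness[of _ int nat]) (auto simp: w_def e2pi_power mult.commute)
  also have "\<dots> = (if int K dvd r then of_nat K else 0)"
  proof (cases "int K dvd r")
    case True
    then obtain l where "r = int K * l" by blast
    then have "w = 1"
      using assms by (simp add: w_def)
    then show ?thesis using True by simp
  next
    case False
    have "w \<noteq> 1"
    proof
      assume "w = 1"
      then obtain l :: int where "of_int r / of_nat K = (of_int l :: complex)"
        unfolding w_def e2pi_eq_1_iff by (elim Ints_cases)
      then have "complex_of_int r = of_int (int K * l)"
        using assms by (simp add: field_simps)
      then have "r = int K * l"
        by (simp only: of_int_eq_iff)
      then show False using False by simp
    qed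
    moreover have "w ^ K = 1"
      using assms by (simp add: w_def e2pi_power)
    ultimately show ?thesis
      using False geometric_sum[of w K] by simp
  qed
  finally show ?thesis .
qed

text \<open>The matrix of \<open>Theta_inversion\<close> is unitary up to a factor, so that the pairing of the two theta vectors is preserved.\<close>

lemma dbar_theta_inversion:
  assumes "Im \<tau> > 0" "N > 0"
  shows "dbar_theta N (- 1 / \<tau>) (u / \<tau>) (v / \<tau>)
      = of_real (norm \<tau>) * e2pi (of_nat N * u\<^sup>2 / (4 * \<tau>)) * cnj (e2pi (of_nat N * v\<^sup>2 / \<tau>)) * dbar_theta N \<tau> u v"
proof -
  have im: "Im (- 1 / \<tau>) > 0" by (rule Im_inversion_pos[OF assms(1)])
  let ?I = "{0..<2 * int N}"
  define c where "c = theta0_mult (\<tau> / (2 * of_nat N))"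
  define U where "U = e2pi (of_nat N * u\<^sup>2 / (4 * \<tau>))"
  define V where "V = e2pi (of_nat N * v\<^sup>2 / \<tau>)"
  let ?e = "\<lambda>r. e2pi (of_int r / (2 * of_nat N))"
  let ?a = "\<lambda>l. cnj (Theta l N \<tau> (2 * v))" and ?b = "\<lambda>l. Theta l N \<tau> u"
  have e_add: "?e r * ?e s = ?e (r + s)" for r s
    by (simp add: e2pi_add[symmetric] add_divide_distrib)
  have e_cnj: "cnj (e2pi (- (of_int r / (2 * of_nat N)))) = ?e r" for r
    by (simp add: e2pi_def exp_cnj)
  have cc: "of_nat (2 * N) * (cnj c * c) = complex_of_real (norm \<tau>)"
  proof -
    have "Im (\<tau> / (2 * of_nat N)) > 0"
      using assms Im_divide_of_nat[of \<tau> "2 * N"] by simp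
    from norm_theta0_mult_square[OF this] have "(norm c)\<^sup>2 = norm \<tau> / (2 * real N)"
      by (simp add: c_def norm_divide norm_mult)
    then have "real (2 * N) * (norm c)\<^sup>2 = norm \<tau>"
      using assms(2) by simp
    then have "of_nat (2 * N) * complex_of_real ((norm c)\<^sup>2) = complex_of_real (norm \<tau>)"
      by (metis of_real_mult of_real_of_nat_eq)
    then show ?thesis
      by (simp only: complex_norm_square mult.commute)
  qed
  have 1: "cnj (Theta j N (- 1 / \<tau>) (2 * (v / \<tau>))) = cnj c * cnj V * (\<Sum>l\<in>?I. ?e (l * j) * ?a l)" for j
  proof -
    have "Theta j N (- 1 / \<tau>) (2 * (v / \<tau>)) = Theta j N (- 1 / \<tau>) ((2 * v) / \<tau>)"
      by simp
    also have "\<dots> = c * e2pi (of_nat N * (2 * v)\<^sup>2 / (4 * \<tau>)) * (\<Sum>l\<in>?I. e2pi (- (of_int (l * j) / (2 * of_nat N))) * Theta l N \<tau> (2 * v))"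
      unfolding c_def by (rule Theta_inversion[OF assms])
    also have "of_nat N * (2 * v)\<^sup>2 / (4 * \<tau>) = of_nat N * v\<^sup>2 / \<tau>"
      by (simp add: power2_eq_square)
    finally show ?thesis
      by (simp only: complex_cnj_mult cnj_sum e_cnj V_def)
  qed
  have 2: "Theta (- j) N (- 1 / \<tau>) (u / \<tau>) = c * U * (\<Sum>m\<in>?I. ?e (m * j) * ?b m)" for j
    unfolding Theta_inversion[OF assms] c_def U_def by simp
  have orth: "(\<Sum>j\<in>?I. ?e ((l + m) * j)) = (if 2 * int N dvd l + m then of_nat (2 * N) else 0)" for l m
    using sum_roots_of_unity[of "2 * N" "l + m"] assms(2) by simp
  have inner: "(\<Sum>m\<in>?I. (if 2 * int N dvd l + m then of_nat (2 * N) else 0) * ?b m) = of_nat (2 * N) * ?b (- l)" for l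
  proof -
    have "(\<Sum>m\<in>?I. (if 2 * int N dvd l + m then of_nat (2 * N) else 0) * ?b m)
        = (\<Sum>m\<in>?I. if m = (- l) mod (2 * int N) then of_nat (2 * N) * ?b m else 0)"
    proof (rule sum.cong[OF refl])
      fix m assume m: "m \<in> ?I"
      have "2 * int N dvd l + m \<longleftrightarrow> m mod (2 * int N) = (- l) mod (2 * int N)"
        by (simp add: mod_eq_dvd_iff add.commute)
      then have "2 * int N dvd l + m \<longleftrightarrow> m = (- l) mod (2 * int N)"
        using m by simp
      then show "(if 2 * int N dvd l + m then of_nat (2 * N) else 0) * ?b m = (if m = (- l) mod (2 * int N) then of_nat (2 * N) * ?b m else 0)"
        by simp
    qed
    also have "\<dots> = of_nat (2 * N) * ?b ((- l) mod (2 * int N))"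
      using assms(2) by (simp add: sum.delta)
    finally show ?thesis
      by (simp only: Theta_mod[OF assms(2)])
  qed
  have "dbar_theta N (- 1 / \<tau>) (u / \<tau>) (v / \<tau>)
      = (\<Sum>j\<in>?I. (cnj c * cnj V * (\<Sum>l\<in>?I. ?e (l * j) * ?a l)) * (c * U * (\<Sum>m\<in>?I. ?e (m * j) * ?b m)))"
    unfolding dbar_theta_eq_sum[OF im assms(2)] 1 2 ..
  also have "\<dots> = (cnj c * c) * U * cnj V * (\<Sum>j\<in>?I. (\<Sum>l\<in>?I. ?e (l * j) * ?a l) * (\<Sum>m\<in>?I. ?e (m * j) * ?b m))"
    unfolding sum_distrib_left[of "(cnj c * c) * U * cnj V"] by (intro sum.cong refl) (simp only: mult_ac)
  also have "(\<Sum>j\<in>?I. (\<Sum>l\<in>?I. ?e (l * j) * ?a l) * (\<Sum>m\<in>?I. ?e (m * j) * ?b m))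
      = (\<Sum>j\<in>?I. \<Sum>l\<in>?I. \<Sum>m\<in>?I. ?e ((l + m) * j) * (?a l * ?b m))"
  proof (intro sum.cong refl)
    fix j
    have "(?e (l * j) * ?a l) * (?e (m * j) * ?b m) = ?e ((l + m) * j) * (?a l * ?b m)" for l m
      unfolding distrib_right e_add[symmetric] by (simp only: mult_ac)
    then show "(\<Sum>l\<in>?I. ?e (l * j) * ?a l) * (\<Sum>m\<in>?I. ?e (m * j) * ?b m) = (\<Sum>l\<in>?I. \<Sum>m\<in>?I. ?e ((l + m) * j) * (?a l * ?b m))"
      unfolding sum_product by (simp only:)
  qed
  also have "\<dots> = (\<Sum>l\<in>?I. \<Sum>m\<in>?I. \<Sum>j\<in>?I. ?e ((l + m) * j) * (?a l * ?b m))"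
    by (rule trans[OF sum.swap]) (rule sum.cong[OF refl], rule sum.swap)
  also have "\<dots> = (\<Sum>l\<in>?I. \<Sum>m\<in>?I. ?a l * ((if 2 * int N dvd l + m then of_nat (2 * N) else 0) * ?b m))"
    unfolding sum_distrib_right[symmetric] orth by (simp only: mult_ac)
  also have "\<dots> = of_nat (2 * N) * dbar_theta N \<tau> u v"
    unfolding sum_distrib_left[symmetric] inner dbar_theta_eq_sum[OF assms]
    unfolding sum_distrib_left by (simp only: mult_ac)
  finally have "dbar_theta N (- 1 / \<tau>) (u / \<tau>) (v / \<tau>) = (of_nat (2 * N) * (cnj c * c)) * U * cnj V * dbar_theta N \<tau> u v"
    by (simp only: mult_ac)
  then show ?thesis
    unfolding cc U_def V_def .
qed

section \<open>The denominators\<close>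

lemma jacobi_theta_eq_theta0:
  "jacobi_theta a b \<tau> z = e2pi (\<tau> * (of_real a)\<^sup>2 / 8 + of_real a * (z + of_real b / 2) / 2)
    * theta0 \<tau> (z + of_real b / 2 + of_real a * \<tau> / 2)"
  unfolding jacobi_theta_def theta0_def infsum_cmult_right'[symmetric] theta0_term_def e2pi_add[symmetric]
  unfolding e2pi_def by (intro infsum_cong arg_cong[of _ _ exp]) (simp add: field_simps power2_eq_square)

lemma jacobi_theta_inversion:
  fixes a b :: int
  assumes "Im \<tau> > 0"
  shows "jacobi_theta (of_int a) (of_int b) (- 1 / \<tau>) (z / \<tau>)
    = theta0_mult \<tau> * e2pi (z\<^sup>2 / (2 * \<tau>)) * e2pi (- (of_int (a * b) / 4)) * jacobi_theta (of_int b) (of_int a) \<tau> z"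
proof -
  have tau: "\<tau> \<noteq> 0" using assms by auto
  define y where "y = z + of_int b * \<tau> / 2 - of_int a / 2"
  have y: "z / \<tau> + of_real (of_int b) / 2 + of_real (of_int a) * (- 1 / \<tau>) / 2 = y / \<tau>"
    using tau by (simp add: y_def field_simps)
  have "theta0 \<tau> y = theta0 \<tau> (y + of_int a)"
    by (rule theta0_add_int[symmetric])
  also have "y + of_int a = z + of_real (of_int a) / 2 + of_real (of_int b) * \<tau> / 2"
    by (simp add: y_def field_simps)
  finally have ty: "theta0 \<tau> y = theta0 \<tau> (z + of_real (of_int a) / 2 + of_real (of_int b) * \<tau> / 2)" .
  have e: "e2pi (- 1 / \<tau> * (of_real (of_int a))\<^sup>2 / 8 + of_real (of_int a) * (z / \<tau> + of_real (of_int b) / 2) / 2) * e2pi (y\<^sup>2 / (2 * \<tau>))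
      = e2pi (z\<^sup>2 / (2 * \<tau>)) * e2pi (- (of_int (a * b) / 4)) * e2pi (\<tau> * (of_real (of_int b))\<^sup>2 / 8 + of_real (of_int b) * (z + of_real (of_int a) / 2) / 2)"
    unfolding e2pi_add[symmetric] y_def using tau
    by (intro arg_cong[of _ _ e2pi]) (simp add: field_simps power2_eq_square)
  show ?thesis
    unfolding jacobi_theta_eq_theta0 y theta0_inversion[OF assms] ty[symmetric]
    using arg_cong[OF e, of "\<lambda>x. theta0_mult \<tau> * x * theta0 \<tau> y"] by (simp only: mult_ac)
qed

text \<open>
  For integral \<open>n\<close> the exponent changes by \<open>n\<^sup>2 / 2\<close>, which is congruent to \<open>n / 2\<close> modulo 1 and amounts to
  a shift of the argument by \<open>1 / 2\<close>. For characteristic 1 it adds up with the change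
  of \<open>\<tau> / 2\<close> to the period 1.
\<close>

lemma jacobi_theta_add_1:
  "jacobi_theta 1 b (\<tau> + 1) z = e2pi (1 / 8) * jacobi_theta 1 b \<tau> z"
  "jacobi_theta 0 b (\<tau> + 1) z = theta0 \<tau> (z + of_real b / 2 + 1 / 2)"
proof -
  have even: "\<exists>k. n * n + n = 2 * k" for n :: int
    by (metis evenE even_mult_iff even_plus_one_iff distrib_left mult.right_neutral)
  have t: "theta0 (\<tau> + 1) w = theta0 \<tau> (w + 1 / 2)" for w
    unfolding theta0_def theta0_term_def
  proof (rule infsum_cong)
    fix n :: int
    obtain k where k: "n * n + n = 2 * k" using even by blast
    then have "complex_of_int (n * n + n) = of_int (2 * k)"
      by (rule arg_cong)
    then have "(of_int n)\<^sup>2 + of_int n = 2 * (of_int k :: complex)"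
      by (simp add: power2_eq_square)
    then have h: "(of_int n)\<^sup>2 = 2 * of_int k - (of_int n :: complex)"
      by (simp add: eq_diff_eq)
    have "(of_int n)\<^sup>2 * (\<tau> + 1) / 2 + of_int n * w = (of_int n)\<^sup>2 * \<tau> / 2 + (of_int n)\<^sup>2 / 2 + of_int n * w"
      by (simp add: field_simps)
    also have "(of_int n)\<^sup>2 / 2 = of_int k - of_int n / (2 :: complex)"
      unfolding h by (simp add: field_simps)
    also have "(of_int n)\<^sup>2 * \<tau> / 2 + (of_int k - of_int n / 2) + of_int n * w
        = (of_int n)\<^sup>2 * \<tau> / 2 + of_int n * (w + 1 / 2) + of_int (k - n)"
      by (simp add: algebra_simps)
    finally show "e2pi ((of_int n)\<^sup>2 * (\<tau> + 1) / 2 + of_int n * w) = e2pi ((of_int n)\<^sup>2 * \<tau> / 2 + of_int n * (w + 1 / 2))"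
      by (rule e2pi_eqI)
  qed
  show "jacobi_theta 0 b (\<tau> + 1) z = theta0 \<tau> (z + of_real b / 2 + 1 / 2)"
    by (simp add: jacobi_theta_eq_theta0 t)
  have "theta0 (\<tau> + 1) (z + of_real b / 2 + (\<tau> + 1) / 2) = theta0 \<tau> (z + of_real b / 2 + \<tau> / 2)"
  proof -
    have "z + of_real b / 2 + (\<tau> + 1) / 2 + 1 / 2 = z + of_real b / 2 + \<tau> / 2 + of_int 1"
      by (simp add: field_simps)
    then show ?thesis
      unfolding t by (simp only: theta0_add_int)
  qed
  moreover have "e2pi ((\<tau> + 1) / 8 + (z + of_real b / 2) / 2) = e2pi (1 / 8) * e2pi (\<tau> / 8 + (z + of_real b / 2) / 2)"
    unfolding e2pi_add[symmetric] by (rule arg_cong[of _ _ e2pi]) (simp add: field_simps)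
  ultimately show "jacobi_theta 1 b (\<tau> + 1) z = e2pi (1 / 8) * jacobi_theta 1 b \<tau> z"
    by (simp add: jacobi_theta_eq_theta0)
qed

lemma dedekind_eta_eq: "dedekind_eta \<tau> = e2pi (\<tau> / 24) * euler (e2pi \<tau>) 1"
  unfolding dedekind_eta_def euler_def qpow_def e2pi_power by (simp add: mult.commute)

lemma dedekind_eta_cube: "dedekind_eta \<tau> ^ 3 = e2pi (\<tau> / 8) * euler (e2pi \<tau>) 1 ^ 3"
  by (simp add: dedekind_eta_eq power_mult_distrib e2pi_power)

lemma dedekind_eta_cube_add_1: "dedekind_eta (\<tau> + 1) ^ 3 = e2pi (1 / 8) * dedekind_eta \<tau> ^ 3"
proof -
  have "e2pi (\<tau> + 1) = e2pi \<tau>" by (rule e2pi_eqI[of _ _ 1]) simp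
  then show ?thesis
    by (simp add: dedekind_eta_cube add_divide_distrib e2pi_add)
qed

lemma e2pi_quarter: "e2pi (1 / 4) = \<i>"
  unfolding e2pi_def by (simp add: exp_eq_polar cis_conv_exp[symmetric] mult.commute)

text \<open>Jacobi's formula for the derivative of the odd theta function, read off the triple product.\<close>

lemma jacobi_theta_limit_0:
  assumes "Im \<tau> > 0"
  shows "((\<lambda>z. jacobi_theta 1 1 \<tau> z / z) \<longlongrightarrow> - 2 * of_real pi * dedekind_eta \<tau> ^ 3) (at 0)"
proof -
  have L: "((\<lambda>z. e2pi (\<tau> / 8 + (z + 1 / 2) / 2) * (theta0 \<tau> (z + 1 / 2 + \<tau> / 2) / z))
      \<longlongrightarrow> e2pi (\<tau> / 8 + (0 + 1 / 2) / 2) * (2 * of_real pi * \<i> * euler (e2pi \<tau>) 1 ^ 3)) (at 0)"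
  proof (intro tendsto_mult theta0_limit_0 assms)
    show "((\<lambda>z. e2pi (\<tau> / 8 + (z + 1 / 2) / 2)) \<longlongrightarrow> e2pi (\<tau> / 8 + (0 + 1 / 2) / 2)) (at 0)"
      unfolding e2pi_def by (intro tendsto_intros) auto
  qed
  have v: "e2pi (\<tau> / 8 + (0 + 1 / 2) / 2) * (2 * of_real pi * \<i> * euler (e2pi \<tau>) 1 ^ 3) = - 2 * of_real pi * dedekind_eta \<tau> ^ 3"
  proof -
    have "e2pi (\<tau> / 8 + (0 + 1 / 2) / 2) = e2pi (\<tau> / 8) * \<i>"
      unfolding e2pi_quarter[symmetric] e2pi_add[symmetric] by simp
    then show ?thesis
      by (simp add: dedekind_eta_cube)
  qed
  have f: "e2pi (\<tau> / 8 + (z + 1 / 2) / 2) * (theta0 \<tau> (z + 1 / 2 + \<tau> / 2) / z) = jacobi_theta 1 1 \<tau> z / z" for z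
    by (simp add: jacobi_theta_eq_theta0)
  show ?thesis
    using L unfolding v f .
qed

text \<open>
  The inversion of the odd theta function, divided by \<open>z\<close>, in the limit \<open>z \<rightarrow> 0\<close>.
\<close>

lemma dedekind_eta_cube_inversion:
  assumes "Im \<tau> > 0"
  shows "dedekind_eta (- 1 / \<tau>) ^ 3 = - \<i> * \<tau> * theta0_mult \<tau> * dedekind_eta \<tau> ^ 3"
proof -
  have tau: "\<tau> \<noteq> 0" using assms by auto
  have im: "Im (- 1 / \<tau>) > 0" by (rule Im_inversion_pos[OF assms])
  have f: "filterlim (\<lambda>z. z / \<tau>) (at 0) (at 0)"
    using tau by (intro filterlim_atI) (auto intro!: tendsto_eq_intros simp: eventually_at_filter)
  have 1: "((\<lambda>z. jacobi_theta 1 1 (- 1 / \<tau>) (z / \<tau>) / (z / \<tau>)) \<longlongrightarrow> - 2 * of_real pi * dedekind_eta (- 1 / \<tau>) ^ 3) (at 0)"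
    by (rule filterlim_compose[OF jacobi_theta_limit_0[OF im] f])
  have m: "e2pi (- (1 / 4)) = - \<i>"
    by (simp add: e2pi_minus e2pi_quarter)
  have L: "((\<lambda>z. theta0_mult \<tau> * e2pi (z\<^sup>2 / (2 * \<tau>)) * (- \<i>) * \<tau> * (jacobi_theta 1 1 \<tau> z / z))
      \<longlongrightarrow> theta0_mult \<tau> * e2pi (0\<^sup>2 / (2 * \<tau>)) * (- \<i>) * \<tau> * (- 2 * of_real pi * dedekind_eta \<tau> ^ 3)) (at 0)"
  proof (intro tendsto_mult jacobi_theta_limit_0 assms tendsto_const)
    show "((\<lambda>z. e2pi (z\<^sup>2 / (2 * \<tau>))) \<longlongrightarrow> e2pi (0\<^sup>2 / (2 * \<tau>))) (at 0)"
      unfolding e2pi_def using tau by (intro tendsto_intros) auto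
  qed
  have f: "theta0_mult \<tau> * e2pi (z\<^sup>2 / (2 * \<tau>)) * (- \<i>) * \<tau> * (jacobi_theta 1 1 \<tau> z / z)
      = jacobi_theta 1 1 (- 1 / \<tau>) (z / \<tau>) / (z / \<tau>)" for z
    using jacobi_theta_inversion[OF assms, of 1 1 z] by (simp add: m)
  have 2: "((\<lambda>z. jacobi_theta 1 1 (- 1 / \<tau>) (z / \<tau>) / (z / \<tau>))
      \<longlongrightarrow> theta0_mult \<tau> * e2pi (0\<^sup>2 / (2 * \<tau>)) * (- \<i>) * \<tau> * (- 2 * of_real pi * dedekind_eta \<tau> ^ 3)) (at 0)"
    using L unfolding f .
  have "- 2 * of_real pi * dedekind_eta (- 1 / \<tau>) ^ 3
      = theta0_mult \<tau> * e2pi (0\<^sup>2 / (2 * \<tau>)) * (- \<i>) * \<tau> * (- 2 * of_real pi * dedekind_eta \<tau> ^ 3)"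
    by (rule tendsto_unique[OF trivial_limit_at 1 2])
  also have "\<dots> = (- 2 * of_real pi) * (- \<i> * \<tau> * theta0_mult \<tau> * dedekind_eta \<tau> ^ 3)"
  proof -
    have "e2pi (0\<^sup>2 / (2 * \<tau>)) = 1" by simp
    then show ?thesis
      by (simp only: mult_1_right) (simp only: mult_ac)
  qed
  finally have e: "(- 2 * of_real pi) * dedekind_eta (- 1 / \<tau>) ^ 3
      = (- 2 * of_real pi) * (- \<i> * \<tau> * theta0_mult \<tau> * dedekind_eta \<tau> ^ 3)" .
  have "- 2 * complex_of_real pi \<noteq> 0" by simp
  from e show ?thesis
    unfolding mult_left_cancel[OF \<open>- 2 * complex_of_real pi \<noteq> 0\<close>] .
qed

text \<open>
  The factor \<open>theta0_mult \<tau>\<close> of the theta function cancels the one of the cube of the eta function.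
\<close>

lemma N2_denom_inversion:
  fixes p p' :: int
  assumes "Im \<tau> > 0" and p: "1 - 2 * \<epsilon> = of_int p" "1 - 2 * \<epsilon>' = of_int p'"
  shows "N2_denom \<epsilon> \<epsilon>' (- 1 / \<tau>) (z / \<tau>)
    = - \<i> * \<tau> * e2pi (- (z\<^sup>2 / (2 * \<tau>))) * e2pi (of_int (p * p') / 4) * N2_denom \<epsilon>' \<epsilon> \<tau> z"
proof -
  have c: "theta0_mult \<tau> \<noteq> 0" by (rule theta0_mult_nonzero[OF assms(1)])
  have 1: "e2pi (- (of_int (p' * p) / 4)) = inverse (e2pi (of_int (p * p') / 4))"
    by (simp add: e2pi_minus mult.commute)
  have aux: "P * (x * theta0_mult \<tau> * E) / (theta0_mult \<tau> * A * inverse B * J) = x * inverse A * B * (P * E / J)"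
    if "A \<noteq> 0" "B \<noteq> 0" for P x E A B J :: complex
    using c that by (cases "J = 0") (simp_all add: field_simps)
  have 2: "(1 - 2 * \<epsilon>') * (1 - 2 * \<epsilon>) = (1 - 2 * \<epsilon>) * (1 - 2 * \<epsilon>')"
    by (rule mult.commute)
  show ?thesis
    unfolding N2_denom_def 2 unfolding p jacobi_theta_inversion[OF assms(1)] dedekind_eta_cube_inversion[OF assms(1)] 1 e2pi_minus[of "z\<^sup>2 / (2 * \<tau>)"]
    by (rule aux) simp_all
qed

lemma N2_denom_add_1:
  assumes "\<epsilon> \<in> {0, 1 / 2}" "\<epsilon>' \<in> {0, 1 / 2}"
  shows "N2_denom \<epsilon> \<epsilon>' (\<tau> + 1) z = e2pi (of_real \<epsilon>' / 4) * N2_denom \<bar>\<epsilon> - \<epsilon>'\<bar> \<epsilon>' \<tau> z"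
proof (cases "\<epsilon>' = 0")
  case True
  have "\<bar>\<epsilon> - \<epsilon>'\<bar> = \<epsilon>" using assms True by auto
  then show ?thesis
    unfolding N2_denom_def True using jacobi_theta_add_1(1)[of "1 - 2 * \<epsilon>" \<tau> z]
    by (simp add: dedekind_eta_cube_add_1)
next
  case False
  then have e': "\<epsilon>' = 1 / 2" using assms by auto
  have "jacobi_theta 0 (1 - 2 * \<epsilon>) (\<tau> + 1) z = jacobi_theta 0 (1 - 2 * \<bar>\<epsilon> - 1 / 2\<bar>) \<tau> z"
  proof (cases "\<epsilon> = 0")
    case True
    then show ?thesis
      using theta0_add_int[of \<tau> z 1] unfolding jacobi_theta_add_1(2) by (simp add: jacobi_theta_eq_theta0 add.commute)
  next
    case False
    then have e: "\<epsilon> = 1 / 2" using assms by auto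
    show ?thesis
      unfolding e jacobi_theta_add_1(2) by (simp add: jacobi_theta_eq_theta0)
  qed
  then show ?thesis
    unfolding N2_denom_def e' by (simp add: dedekind_eta_cube_add_1)
qed

section \<open>Modular transformations of the characters\<close>

lemma capp_add_1:
  assumes "N > 0"
  shows "capp N s (\<tau> + of_int p) z1 z2 = capp N s \<tau> z1 z2"
proof -
  have "appell_term N s (\<tau> + of_int p) u z j = appell_term N s \<tau> u z j" for u z j
    unfolding appell_term_def
  proof (intro arg_cong2[of _ _ _ _ "(/)"] arg_cong2[of _ _ _ _ "(-)"] refl)
    show "e2pi (of_nat N * (of_int j * u + (of_int j)\<^sup>2 * (\<tau> + of_int p)) - of_int s * (z + of_int j * (\<tau> + of_int p)))
      = e2pi (of_nat N * (of_int j * u + (of_int j)\<^sup>2 * \<tau>) - of_int s * (z + of_int j * \<tau>))"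
      by (rule e2pi_eqI[of _ _ "int N * j\<^sup>2 * p - s * j * p"]) (simp add: algebra_simps)
    show "e2pi (z + of_int j * (\<tau> + of_int p)) = e2pi (z + of_int j * \<tau>)"
      by (rule e2pi_eqI[of _ _ "j * p"]) (simp add: algebra_simps)
  qed
  then have 1: "appell N s (\<tau> + of_int p) u z = appell N s \<tau> u z" for u z
    unfolding appell_def by (intro infsum_cong)
  have "corr_term N s (\<tau> + of_int p) v n * Theta (- n) N (\<tau> + of_int p) u = corr_term N s \<tau> v n * Theta (- n) N \<tau> u" for u v n
  proof -
    let ?d = "e2pi ((of_int n)\<^sup>2 / (4 * of_nat N) * of_int p)"
    have "theta_term N (\<tau> + of_int p) u (2 * int N * i + - n) = ?d * theta_term N \<tau> u (2 * int N * i + - n)" for i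
      unfolding theta_term_def e2pi_add[symmetric] using assms
      by (intro e2pi_eqI[of _ _ "(int N * i\<^sup>2 - i * n) * p"]) (simp add: field_simps power2_eq_square)
    then have t: "Theta (- n) N (\<tau> + of_int p) u = ?d * Theta (- n) N \<tau> u"
      unfolding Theta_eq[OF assms] infsum_cmult_right'[symmetric] by simp
    have "corr_exp N (\<tau> + of_int p) v n * ?d = corr_exp N \<tau> v n"
      unfolding corr_exp_def e2pi_add[symmetric] by (rule arg_cong[of _ _ e2pi]) (simp add: distrib_left)
    moreover have "corr_arg N (\<tau> + of_int p) v n = corr_arg N \<tau> v n"
      by (simp add: corr_arg_def)
    ultimately show ?thesis
      unfolding corr_term_def t by (simp add: mult_ac)
  qed
  then have 2: "corr N s (\<tau> + of_int p) u v = corr N s \<tau> u v" for u v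
    unfolding corr_def by simp
  show ?thesis
    unfolding capp_def 1 2 ..
qed

text \<open>One half of \<open>Psi_mod M m s \<epsilon> a b \<tau> (- z) z 0\<close>; the other half is its value at \<open>(- b, - a)\<close>.\<close>

definition psi_half :: "nat \<Rightarrow> nat \<Rightarrow> complex \<Rightarrow> complex \<Rightarrow> complex \<Rightarrow> complex \<Rightarrow> complex \<Rightarrow> complex" where
  "psi_half N M e a b \<tau> z =
     e2pi (of_nat N / of_nat M * (a * b * \<tau> + (a - b) * z))
     * capp N 0 (of_nat M * \<tau>) (- z + a * \<tau> + e) (z + b * \<tau> + e)"

lemma psi_half_add_int:
  assumes "N > 0" "e' = e + of_int r"
  shows "psi_half N M e' a b \<tau> z = psi_half N M e a b \<tau> z"
  using capp_add_int[OF assms(1), of 0 "of_nat M * \<tau>" "- z + a * \<tau> + e" r "z + b * \<tau> + e" r]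
  by (simp add: psi_half_def assms(2) add.assoc)

lemma Psi_mod_eq_psi_half:
  assumes "Im \<tau> > 0" "M > 0" "2 * e = of_int r" and e: "e = of_real \<epsilon>"
    and z: "- z + of_real a * \<tau> + e \<notin> lat (of_nat M * \<tau>)" "- z - of_real b * \<tau> - e \<notin> lat (of_nat M * \<tau>)"
  shows "Psi_mod M m s \<epsilon> a b \<tau> (- z) z 0
    = psi_half (m + 1) M e (of_real a) (of_real b) \<tau> z - psi_half (m + 1) M e (- of_real b) (- of_real a) \<tau> z"
proof -
  have im: "Im (of_nat M * \<tau>) > 0" using assms by simp
  have N: "m + 1 > 0" by simp
  have q: "qpow \<tau> (real (m + 1) * a * b / real M) * e2pi (of_nat (m + 1) / of_nat M * (of_real b * - z + of_real a * z))
      = e2pi (of_nat (m + 1) / of_nat M * (of_real a * of_real b * \<tau> + (of_real a - of_real b) * z))"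
    unfolding qpow_def e2pi_add[symmetric] using assms(2)
    by (intro arg_cong[of _ _ e2pi]) (simp add: field_simps)
  define E where "E = e2pi (of_nat (m + 1) / of_nat M * (of_real a * of_real b * \<tau> + (of_real a - of_real b) * z))"
  define Z1 Z2 where "Z1 = - z + of_real a * \<tau> + e" and "Z2 = z + of_real b * \<tau> + e"
  have Z: "Z1 \<notin> lat (of_nat M * \<tau>)" "- Z2 \<notin> lat (of_nat M * \<tau>)"
    using z by (simp_all add: Z1_def Z2_def)
  have "psi_half (m + 1) M e (- of_real b) (- of_real a) \<tau> z = psi_half (m + 1) M (- e) (- of_real b) (- of_real a) \<tau> z"
    by (rule psi_half_add_int[of _ _ _ r]) (simp_all add: assms(3)[symmetric])
  also have "\<dots> = E * capp (m + 1) 0 (of_nat M * \<tau>) (- Z2) (- Z1)"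
    by (simp add: psi_half_def E_def Z1_def Z2_def mult.commute)
  finally have 2: "psi_half (m + 1) M e (- of_real b) (- of_real a) \<tau> z = E * capp (m + 1) 0 (of_nat M * \<tau>) (- Z2) (- Z1)" .
  have 1: "psi_half (m + 1) M e (of_real a) (of_real b) \<tau> z = E * capp (m + 1) 0 (of_nat M * \<tau>) Z1 Z2"
    by (simp only: psi_half_def E_def Z1_def Z2_def)
  have "Psi_mod M m s \<epsilon> a b \<tau> (- z) z 0
      = E * (capp (m + 1) (int s) (of_nat M * \<tau>) Z1 Z2 - capp (m + 1) (int s) (of_nat M * \<tau>) (- Z2) (- Z1))"
    unfolding Psi_mod_def q Phi_mod_eq_capp[OF im] e[symmetric] E_def[symmetric] Z1_def[symmetric] Z2_def[symmetric] by simp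
  then show ?thesis
    unfolding 1 2 capp_indep[OF im N Z(1), of "int s"] capp_indep[OF im N Z(2), of "int s"] right_diff_distrib .
qed

text \<open>
  By \<open>capp_add_tau\<close> at \<open>M * \<tau>\<close>; the factor is a sign for half-integral \<open>e\<close>.
\<close>

lemma psi_half_mod:
  assumes "Im \<tau> > 0" "N > 0" "M > 0" and z: "- z + a * \<tau> + e \<notin> lat (of_nat M * \<tau>)"
  shows "psi_half N M e (a + of_nat M * of_int k) (b + of_nat M * of_int l) \<tau> z
    = e2pi (- (of_nat N * of_int (k + l) * e)) * psi_half N M e a b \<tau> z"
proof -
  have im: "Im (of_nat M * \<tau>) > 0" using assms by simp
  have x: "- z + (a + of_nat M * of_int k) * \<tau> + e = - z + a * \<tau> + e + of_int k * (of_nat M * \<tau>)"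
    "z + (b + of_nat M * of_int l) * \<tau> + e = z + b * \<tau> + e + of_int l * (of_nat M * \<tau>)"
    by (simp_all add: algebra_simps)
  have "e2pi (of_nat N / of_nat M * ((a + of_nat M * of_int k) * (b + of_nat M * of_int l) * \<tau>
        + ((a + of_nat M * of_int k) - (b + of_nat M * of_int l)) * z))
      * e2pi (- of_nat N * (of_int (k * l) * (of_nat M * \<tau>) + of_int l * (- z + a * \<tau> + e) + of_int k * (z + b * \<tau> + e)))
      = e2pi (- (of_nat N * of_int (k + l) * e)) * e2pi (of_nat N / of_nat M * (a * b * \<tau> + (a - b) * z))"
    unfolding e2pi_add[symmetric] using assms(3) by (intro arg_cong[of _ _ e2pi]) (simp add: field_simps)
  from arg_cong[OF this, of "\<lambda>x. x * capp N 0 (of_nat M * \<tau>) (- z + a * \<tau> + e) (z + b * \<tau> + e)"]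
  show ?thesis
    unfolding psi_half_def x capp_add_tau[OF im assms(2)] capp_indep[OF im assms(2) z, of "0 + int N * (k - l)"]
    by (simp only: mult.assoc)
qed

text \<open>
  The inversion at \<open>\<tau> / M\<close>, followed by the splitting at level \<open>M\<close>. The inversion exchanges the
  characteristics: the shift by \<open>e\<close> becomes one by \<open>e * \<tau>\<close>, and the indices \<open>j\<close>, \<open>k\<close>, being congruent
  to \<open>- e'\<close> modulo 1, leave the shift by \<open>e'\<close>.
\<close>

lemma psi_half_inversion:
  assumes "Im \<tau> > 0" "N > 0" "M > 0" "coprime N M"
    and j: "j = - e' - of_int r" and k: "k = - e' - of_int r'"
    and z: "- z - j + e * \<tau> \<notin> lat \<tau>"
  shows "psi_half N M e j k (- 1 / \<tau>) (z / \<tau>) = \<tau> / of_nat M * e2pi (- (of_nat N * z\<^sup>2 / (of_nat M * \<tau>)))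
    * (\<Sum>a\<in>{0..<int M}. \<Sum>b\<in>{0..<int M}.
        e2pi (- (of_nat N / of_nat M * ((of_int b + e) * j + (of_int a + e) * k))) * psi_half N M e' (of_int a + e) (of_int b + e) \<tau> z)"
proof -
  have tau: "\<tau> \<noteq> 0" using assms(1) by auto
  define \<sigma> where "\<sigma> = \<tau> / of_nat M"
  have s: "Im \<sigma> > 0"
    using assms by (simp add: \<sigma>_def Im_divide_of_nat)
  define y1 y2 where "y1 = - z - j + e * \<tau>" and "y2 = z - k + e * \<tau>"
  have y1: "y1 / of_nat M \<notin> lat \<sigma>"
  proof
    assume "y1 / of_nat M \<in> lat \<sigma>"
    then obtain p r :: int where "y1 / of_nat M = of_int p * \<sigma> + of_int r"
      unfolding lat_def by auto
    then have "y1 = of_int p * \<tau> + of_int (int M * r)"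
      using assms(3) by (simp add: \<sigma>_def field_simps)
    then have "y1 \<in> lat \<tau>" unfolding lat_def by blast
    then show False using z by (simp add: y1_def)
  qed
  have args: "of_nat M * (- 1 / \<tau>) = - 1 / \<sigma>" "- (z / \<tau>) + j * (- 1 / \<tau>) + e = (y1 / of_nat M) / \<sigma>"
    "z / \<tau> + k * (- 1 / \<tau>) + e = (y2 / of_nat M) / \<sigma>"
    using tau assms(3) by (simp_all add: \<sigma>_def y1_def y2_def field_simps)
  let ?E = "e2pi (of_nat N / of_nat M * (j * k * (- 1 / \<tau>) + (j - k) * (z / \<tau>)))"
  let ?E' = "e2pi (of_nat N * (y1 / of_nat M * (y2 / of_nat M)) / \<sigma>)"
  let ?Z = "e2pi (- (of_nat N * z\<^sup>2 / (of_nat M * \<tau>)))"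
  have "psi_half N M e j k (- 1 / \<tau>) (z / \<tau>) = ?E * capp N 0 (- 1 / \<sigma>) ((y1 / of_nat M) / \<sigma>) ((y2 / of_nat M) / \<sigma>)"
    unfolding psi_half_def args ..
  also have "\<dots> = \<sigma> * (?E * ?E') * capp N 0 \<sigma> (y1 / of_nat M) (y2 / of_nat M)"
    unfolding capp_inversion[OF s assms(2) dbar_theta_inversion[OF s assms(2)] y1] by (simp only: mult_ac)
  also have "\<dots> = \<sigma> * (\<Sum>a\<in>{0..<int M}. \<Sum>b\<in>{0..<int M}. ?E * ?E' * level_term N M \<tau> y1 y2 a b)"
  proof -
    have "capp N 0 \<sigma> (y1 / of_nat M) (y2 / of_nat M) = (\<Sum>a\<in>{0..<int M}. \<Sum>b\<in>{0..<int M}. level_term N M \<tau> y1 y2 a b)"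
      unfolding \<sigma>_def by (rule capp_level[OF assms(1-4)]) (use z in \<open>simp add: y1_def\<close>)
    then show ?thesis
      by (simp only: sum_distrib_left mult.assoc)
  qed
  also have "\<dots> = \<sigma> * (\<Sum>a\<in>{0..<int M}. \<Sum>b\<in>{0..<int M}. ?Z * (e2pi (- (of_nat N / of_nat M * ((of_int b + e) * j + (of_int a + e) * k)))
      * psi_half N M e' (of_int a + e) (of_int b + e) \<tau> z))"
  proof -
    have "?E * ?E' * level_term N M \<tau> y1 y2 a b = ?Z * (e2pi (- (of_nat N / of_nat M * ((of_int b + e) * j + (of_int a + e) * k)))
      * psi_half N M e' (of_int a + e) (of_int b + e) \<tau> z)" for a b
    proof -
      have c: "y1 + of_int a * \<tau> = - z + (of_int a + e) * \<tau> + e' + of_int r"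
        "y2 + of_int b * \<tau> = z + (of_int b + e) * \<tau> + e' + of_int r'"
        unfolding j k y1_def y2_def by (simp_all add: algebra_simps)
      have "?E * ?E' * e2pi (of_nat N / of_nat M * (of_int (a * b) * \<tau> + of_int b * y1 + of_int a * y2))
        = ?Z * e2pi (- (of_nat N / of_nat M * ((of_int b + e) * j + (of_int a + e) * k)))
          * e2pi (of_nat N / of_nat M * ((of_int a + e) * (of_int b + e) * \<tau> + ((of_int a + e) - (of_int b + e)) * z))"
        unfolding e2pi_add[symmetric] y1_def y2_def \<sigma>_def using tau assms(3)
        by (intro arg_cong[of _ _ e2pi]) (simp add: field_simps power2_eq_square)
      from arg_cong[OF this, of "\<lambda>x. x * capp N 0 (of_nat M * \<tau>) (- z + (of_int a + e) * \<tau> + e') (z + (of_int b + e) * \<tau> + e')"]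
      show ?thesis
        unfolding level_term_def psi_half_def c capp_add_int[OF assms(2)] by (simp only: mult.assoc)
    qed
    then show ?thesis by (simp only:)
  qed
  finally show ?thesis
    unfolding \<sigma>_def by (simp only: sum_distrib_left mult.assoc)
qed

subsection \<open>The index set\<close>

text \<open>
  The pairs \<open>(a + \<epsilon>, b + \<epsilon>)\<close> modulo \<open>M\<close> with \<open>a + b + 2 * \<epsilon>\<close> not divisible by \<open>M\<close> form orbits of
  length two under \<open>(x, y) \<mapsto> (- y, - x)\<close>, and \<open>Omega M \<epsilon>\<close> represents each orbit once.
\<close>

lemma sum_box_eq_sum_Omega:
  fixes g :: "int \<Rightarrow> int \<Rightarrow> complex"
  assumes "M > 0" and e: "\<epsilon> \<in> {0, 1 / 2}" "of_int r = 2 * \<epsilon>"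
    and per: "\<And>a b k l. g (a + int M * k) (b + int M * l) = g a b"
    and 0: "\<And>a b. int M dvd a + b + r \<Longrightarrow> g a b = 0"
    and f: "\<And>a b. f (of_int a + \<epsilon>, of_int b + \<epsilon>) = g a b + g (- b - r) (- a - r)"
  shows "(\<Sum>a\<in>{0..<int M}. \<Sum>b\<in>{0..<int M}. g a b) = (\<Sum>ab\<in>Omega M \<epsilon>. f ab)"
proof -
  have r: "r = 0 \<and> \<epsilon> = 0 \<or> r = 1 \<and> \<epsilon> = 1 / 2"
    using e by auto
  \<comment> \<open>The set \<open>P\<close> corresponds to \<open>Omega M \<epsilon>\<close>. The involution maps it to the set \<open>Q\<close> of the remaining
    pairs outside \<open>Z\<close>, after a reduction modulo \<open>M\<close> for which the coordinate 0 needs a case of its own.\<close>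
  define P where "P = {(a, b). 0 \<le> a \<and> 0 \<le> b \<and> a + b + r < int M \<and> 0 < a + r}"
  define B where "B = {0..<int M} \<times> {0..<int M}"
  define Z where "Z = {(a, b). (a, b) \<in> B \<and> int M dvd a + b + r}"
  define Q where "Q = B - Z - P"
  have fin: "finite B" by (simp add: B_def)
  have PB: "P \<subseteq> B" using r by (auto simp: P_def B_def)
  have PZ: "P \<inter> Z = {}"
  proof -
    have False if "(a, b) \<in> P" "(a, b) \<in> Z" for a b
    proof -
      have "0 < a + b + r" "a + b + r < int M" "int M dvd a + b + r"
        using that r by (auto simp: P_def Z_def)
      then show False using zdvd_imp_le by fastforce
    qed
    then show ?thesis by auto
  qed
  have ndvd: "a + b + r \<noteq> int M" "a + b + r \<noteq> 0" if "(a, b) \<in> B - Z" for a b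
    using that by (auto simp: Z_def)
  let ?\<phi> = "\<lambda>(a, b). (if r = 0 \<and> b = 0 then 0 else int M - b - r, int M - a - r)"
  let ?\<psi> = "\<lambda>(a, b). (int M - b - r, if r = 0 \<and> a = 0 then 0 else int M - a - r)"
  have QP: "(\<Sum>(a, b)\<in>Q. g a b) = (\<Sum>(a, b)\<in>P. g (- b - r) (- a - r))"
  proof (rule sum.reindex_bij_witness[of _ ?\<phi> ?\<psi>])
    fix x assume x: "x \<in> Q"
    obtain a b where ab: "x = (a, b)" by fastforce
    have B: "0 \<le> a" "a < int M" "0 \<le> b" "b < int M" and nP: "\<not> (a + b + r < int M \<and> 0 < a + r)"
      and n: "a + b + r \<noteq> int M" "a + b + r \<noteq> 0"
      using x ndvd[of a b] unfolding ab by (auto simp: Q_def B_def P_def)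
    show "?\<phi> (?\<psi> x) = x" using B n r by (auto simp: ab)
    show "?\<psi> x \<in> P" using B n nP r by (auto simp: ab P_def)
    show "(case ?\<psi> x of (a, b) \<Rightarrow> g (- b - r) (- a - r)) = (case x of (a, b) \<Rightarrow> g a b)"
    proof (cases "r = 0 \<and> a = 0")
      case True
      then show ?thesis using per[of 0 0 b "- 1"] by (simp add: ab)
    next
      case False
      then show ?thesis using per[of a "- 1" b "- 1"] by (auto simp: ab)
    qed
  next
    fix x assume x: "x \<in> P"
    obtain a b where ab: "x = (a, b)" by fastforce
    have B: "0 \<le> a" "0 \<le> b" "a + b + r < int M" "0 < a + r"
      using x unfolding ab by (auto simp: P_def)
    show "?\<psi> (?\<phi> x) = x" using B r by (auto simp: ab)
    have "?\<phi> x \<in> B" using B r by (auto simp: ab B_def)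
    moreover have "?\<phi> x \<notin> P" using B r by (auto simp: ab P_def)
    moreover have "?\<phi> x \<notin> Z"
    proof
      define y where "y = (if r = 0 \<and> b = 0 then 0 else int M - b - r) + (int M - a - r) + r"
      assume "?\<phi> x \<in> Z"
      then have y: "int M dvd y"
        by (simp add: ab Z_def y_def)
      have "y = int M - (a + b + r) \<or> y = 2 * int M - (a + b + r)"
        using r unfolding y_def by auto
      then have "a + b + r = int M - y \<or> a + b + r = 2 * int M - y"
        by linarith
      then have "int M dvd a + b + r"
        using y by (elim disjE) simp_all
      then show False using B zdvd_imp_le[of "int M" "a + b + r"] r by auto
    qed
    ultimately show "?\<phi> x \<in> Q" by (simp add: Q_def)
  qed
  have "(\<Sum>a\<in>{0..<int M}. \<Sum>b\<in>{0..<int M}. g a b) = (\<Sum>(a, b)\<in>B. g a b)"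
    unfolding B_def by (rule sum.cartesian_product)
  also have "\<dots> = (\<Sum>(a, b)\<in>B - Z. g a b)"
    by (rule sum.mono_neutral_right[OF fin]) (auto simp: Z_def intro: 0)
  also have "\<dots> = (\<Sum>(a, b)\<in>P. g a b) + (\<Sum>(a, b)\<in>Q. g a b)"
    unfolding Q_def using PB PZ fin by (subst sum.subset_diff[of P "B - Z"]) (auto simp: add.commute)
  also have "\<dots> = (\<Sum>(a, b)\<in>P. f (of_int a + \<epsilon>, of_int b + \<epsilon>))"
    unfolding QP f by (simp add: sum.distrib case_prod_unfold)
  also have "\<dots> = (\<Sum>ab\<in>Omega M \<epsilon>. f ab)"
  proof -
    have "bij_betw (\<lambda>(a, b). (of_int a + \<epsilon>, of_int b + \<epsilon>)) P (Omega M \<epsilon>)"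
    proof (rule bij_betwI')
      fix x y :: "int \<times> int"
      show "((case x of (a, b) \<Rightarrow> (of_int a + \<epsilon>, of_int b + \<epsilon>)) = (case y of (a, b) \<Rightarrow> (of_int a + \<epsilon>, of_int b + \<epsilon>))) = (x = y)"
        by (auto simp: case_prod_unfold prod_eq_iff)
    next
      fix x assume "x \<in> P"
      then obtain a b where ab: "x = (a, b)" "0 \<le> a" "0 \<le> b" "a + b + r < int M" "0 < a + r"
        by (auto simp: P_def)
      have "of_int a + \<epsilon> = \<epsilon> + real (nat a)" "of_int b + \<epsilon> = \<epsilon> + real (nat b)"
        using ab by simp_all
      moreover have "of_int a + \<epsilon> + (of_int b + \<epsilon>) \<le> real M - 1"
      proof -
        have "of_int (a + b + r) \<le> (of_int (int M - 1) :: real)"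
          using ab by (subst of_int_le_iff) simp
        then show ?thesis using e(2) by simp
      qed
      moreover have "of_int a + \<epsilon> > 0"
        using ab r by auto
      ultimately show "(case x of (a, b) \<Rightarrow> (of_int a + \<epsilon>, of_int b + \<epsilon>)) \<in> Omega M \<epsilon>"
        unfolding ab(1) Omega_def mem_Collect_eq prod.case
        by (intro conjI exI[of _ "nat a"] exI[of _ "nat b"])
    next
      fix y assume "y \<in> Omega M \<epsilon>"
      then obtain p q :: nat where y: "y = (\<epsilon> + real p, \<epsilon> + real q)" "\<epsilon> + real p + (\<epsilon> + real q) \<le> real M - 1" "\<epsilon> + real p > 0"
        unfolding Omega_def by auto
      have "real_of_int (int p + int q + r) \<le> of_int (int M - 1)"
        using y(2) e(2) by simp
      then have "int p + int q + r < int M"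
        by (simp only: of_int_le_iff)
      moreover have "0 < int p + r"
        using y(3) r by auto
      ultimately have "(int p, int q) \<in> P"
        by (simp add: P_def)
      then show "\<exists>x\<in>P. y = (case x of (a, b) \<Rightarrow> (of_int a + \<epsilon>, of_int b + \<epsilon>))"
        by (intro bexI[of _ "(int p, int q)"]) (simp_all add: y(1) add.commute)
    qed
    then show ?thesis
      by (subst sum.reindex_bij_betw[symmetric]) (auto simp: case_prod_unfold)
  qed
  finally show ?thesis .
qed

subsection \<open>Assembling the formulas\<close>

lemma notin_lat_if_notin_N2_poles:
  assumes "z \<notin> N2_poles \<epsilon>' \<epsilon> \<tau>" "A = of_real \<epsilon> + of_int a" "B = of_real \<epsilon>' + of_int b"
  shows "- z + A * \<tau> + B \<notin> lat \<tau>"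
proof
  assume "- z + A * \<tau> + B \<in> lat \<tau>"
  then obtain p r :: int where "- z + A * \<tau> + B = of_int p * \<tau> + of_int r"
    unfolding lat_def by auto
  then have "z = A * \<tau> + B - of_int p * \<tau> - of_int r"
    by (simp add: algebra_simps)
  also have "\<dots> = (of_real \<epsilon> + of_int (a - p)) * \<tau> + of_real \<epsilon>' + of_int (b - r)"
    unfolding assms(2,3) by (simp add: algebra_simps)
  finally show False
    using assms(1) unfolding N2_poles_def by blast
qed

lemma Psi_mod_add_1:
  assumes "Im \<tau> > 0" "M > 0" and \<epsilon>: "\<epsilon> \<in> {0, 1 / 2}" "\<epsilon>' \<in> {0, 1 / 2}"
    and j: "j = \<epsilon>' + real nj" and k: "k = \<epsilon>' + real nk"
  shows "Psi_mod M m s \<epsilon> j k (\<tau> + 1) (- z) z 0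
    = e2pi (of_nat (m + 1) / of_nat M * of_real (j * k)) * Psi_mod M m s \<bar>\<epsilon> - \<epsilon>'\<bar> j k \<tau> (- z) z 0"
proof -
  have im: "Im (of_nat M * \<tau>) > 0" "Im (of_nat M * (\<tau> + 1)) > 0"
    using assms(1,2) by simp_all
  obtain i :: int where "\<epsilon>' + \<epsilon> - \<bar>\<epsilon> - \<epsilon>'\<bar> = of_int i"
  proof (cases "\<epsilon> = 0 \<or> \<epsilon>' = 0")
    case True
    then have "\<epsilon>' + \<epsilon> - \<bar>\<epsilon> - \<epsilon>'\<bar> = of_int 0" using \<epsilon> by auto
    then show ?thesis by (rule that)
  next
    case False
    then have "\<epsilon>' + \<epsilon> - \<bar>\<epsilon> - \<epsilon>'\<bar> = of_int 1" using \<epsilon> by auto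
    then show ?thesis by (rule that)
  qed
  then have "j + \<epsilon> = \<bar>\<epsilon> - \<epsilon>'\<bar> + of_int (i + int nj)" "k + \<epsilon> = \<bar>\<epsilon> - \<epsilon>'\<bar> + of_int (i + int nk)"
    unfolding j k by simp_all
  then have "complex_of_real (j + \<epsilon>) = of_real (\<bar>\<epsilon> - \<epsilon>'\<bar> + of_int (i + int nj))"
    "complex_of_real (k + \<epsilon>) = of_real (\<bar>\<epsilon> - \<epsilon>'\<bar> + of_int (i + int nk))"
    by (simp_all only:)
  then have jk: "complex_of_real j + of_real \<epsilon> = of_real \<bar>\<epsilon> - \<epsilon>'\<bar> + of_int (i + int nj)"
    "complex_of_real k + of_real \<epsilon> = of_real \<bar>\<epsilon> - \<epsilon>'\<bar> + of_int (i + int nk)"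
    by simp_all
  define Z1 Z2 where "Z1 = - z + of_real j * \<tau> + of_real \<bar>\<epsilon> - \<epsilon>'\<bar>" and "Z2 = z + of_real k * \<tau> + of_real \<bar>\<epsilon> - \<epsilon>'\<bar>"
  have "- z + of_real j * (\<tau> + 1) + of_real \<epsilon> = - z + of_real j * \<tau> + (of_real j + of_real \<epsilon>)"
    "z + of_real k * (\<tau> + 1) + of_real \<epsilon> = z + of_real k * \<tau> + (of_real k + of_real \<epsilon>)"
    by (simp_all add: algebra_simps)
  then have Z: "- z + of_real j * (\<tau> + 1) + of_real \<epsilon> = Z1 + of_int (i + int nj)"
    "z + of_real k * (\<tau> + 1) + of_real \<epsilon> = Z2 + of_int (i + int nk)"
    unfolding jk by (simp_all add: Z1_def Z2_def)
  have M: "of_nat M * (\<tau> + 1) = of_nat M * \<tau> + of_int (int M)"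
    by (simp add: algebra_simps)
  have neg: "- (Z2 + of_int (i + int nk)) = - Z2 + of_int (- (i + int nk))" "- (Z1 + of_int (i + int nj)) = - Z1 + of_int (- (i + int nj))"
    by simp_all
  have q: "qpow (\<tau> + 1) (real (m + 1) * j * k / real M)
      = e2pi (of_nat (m + 1) / of_nat M * of_real (j * k)) * qpow \<tau> (real (m + 1) * j * k / real M)"
    unfolding qpow_def e2pi_add[symmetric] using assms(2)
    by (intro arg_cong[of _ _ e2pi]) (simp add: field_simps)
  have P: "Phi_mod m s (of_nat M * (\<tau> + 1)) (Z1 + of_int (i + int nj)) (Z2 + of_int (i + int nk)) (0 / of_nat M)
      = Phi_mod m s (of_nat M * \<tau>) Z1 Z2 (0 / of_nat M)"
    unfolding Phi_mod_eq_capp[OF im(1)] Phi_mod_eq_capp[OF im(2)] neg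
    unfolding M by (simp only: capp_add_1 capp_add_int zero_less_Suc Suc_eq_plus1[symmetric])
  show ?thesis
    unfolding Psi_mod_def Z P q Z1_def[symmetric] Z2_def[symmetric] by (simp only: mult.assoc)
qed

text \<open>
  The phases \<open>(j - k) * (a - b) \<mp> (j + k) * (a + b)\<close> of the two exponentials of the sine are
  \<open>- 2 * (b * j + a * k)\<close> and \<open>2 * (b * k + a * j)\<close>.
\<close>

lemma S_matrix_eq:
  assumes \<epsilon>: "\<epsilon> \<in> {0, 1 / 2}" "\<epsilon>' \<in> {0, 1 / 2}" and p: "1 - 2 * \<epsilon> = of_int p" "1 - 2 * \<epsilon>' = of_int p'"
    and "M > 0"
  shows "S_matrix M m \<epsilon> \<epsilon>' (j, k) (a, b) = e2pi (- (of_int (p * p') / 4)) * (\<i> / of_nat M)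
    * (e2pi (- (of_nat (m + 1) / of_nat M * (of_real b * of_real j + of_real a * of_real k)))
       - e2pi (of_nat (m + 1) / of_nat M * (of_real b * of_real k + of_real a * of_real j)))"
proof -
  have alg: "2 / of_nat M * A * ((P - Q) / (2 * \<i>)) = \<i> / of_nat M * (A * Q - A * P)" for A P Q :: complex
    using assms(5) by (simp add: field_simps)
  have 1: "(- \<i>) powr of_real ((1 - 2 * \<epsilon>) * (1 - 2 * \<epsilon>')) = e2pi (- (of_int (p * p') / 4))"
  proof (cases "\<epsilon> = 0 \<and> \<epsilon>' = 0")
    case True
    then have "of_int p = (1::real)" "of_int p' = (1::real)" using p by auto
    then have "p = 1" "p' = 1" by auto
    moreover have "(- \<i>) powr (1::complex) = - \<i>"
      by (subst powr_def, subst if_not_P, simp, subst mult_1_left, rule exp_Ln, simp)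
    ultimately show ?thesis
      using True by (simp add: e2pi_minus e2pi_quarter)
  next
    case False
    then have "of_int p = (0::real) \<or> of_int p' = (0::real)" using p \<epsilon> by auto
    then have pp: "p * p' = 0" by auto
    have ee: "(1 - 2 * \<epsilon>) * (1 - 2 * \<epsilon>') = 0" using False \<epsilon> by auto
    show ?thesis unfolding pp ee by simp
  qed
  define \<theta> where "\<theta> = real (m + 1) / real M * (j + k) * (a + b) * pi"
  have sin: "complex_of_real (sin \<theta>) = (exp (\<i> * of_real \<theta>) - exp (- (\<i> * of_real \<theta>))) / (2 * \<i>)"
    unfolding sin_of_real[symmetric] sin_exp_eq ..
  have "2 / of_nat M * exp (of_real pi * \<i> * of_nat (m + 1) / of_nat M * of_real ((j - k) * (a - b))) * complex_of_real (sin \<theta>)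
    = \<i> / of_nat M * (exp (of_real pi * \<i> * of_nat (m + 1) / of_nat M * of_real ((j - k) * (a - b))) * exp (- (\<i> * of_real \<theta>))
        - exp (of_real pi * \<i> * of_nat (m + 1) / of_nat M * of_real ((j - k) * (a - b))) * exp (\<i> * of_real \<theta>))"
    unfolding sin by (rule alg)
  also have "exp (of_real pi * \<i> * of_nat (m + 1) / of_nat M * of_real ((j - k) * (a - b))) * exp (- (\<i> * of_real \<theta>))
      = e2pi (- (of_nat (m + 1) / of_nat M * (of_real b * of_real j + of_real a * of_real k)))"
    unfolding exp_add[symmetric] e2pi_def \<theta>_def using assms(5) by (intro arg_cong[of _ _ exp]) (simp add: field_simps)
  also have "exp (of_real pi * \<i> * of_nat (m + 1) / of_nat M * of_real ((j - k) * (a - b))) * exp (\<i> * of_real \<theta>)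
      = e2pi (of_nat (m + 1) / of_nat M * (of_real b * of_real k + of_real a * of_real j))"
    unfolding exp_add[symmetric] e2pi_def \<theta>_def using assms(5) by (intro arg_cong[of _ _ exp]) (simp add: field_simps)
  finally show ?thesis
    unfolding S_matrix_def prod.case 1 \<theta>_def by (simp only: mult.assoc)
qed

text \<open>
  Both halves of \<open>Psi_mod\<close> are inverted by \<open>psi_half_inversion\<close>, and the phases combine to a function
  \<open>X\<close> that is antisymmetric under \<open>(A, B) \<mapsto> (- B, - A)\<close>. It vanishes when \<open>A + B\<close> is divisible by \<open>M\<close>, and
  its quasi-period signs cancel those of \<open>psi_half_mod\<close>, so that \<open>sum_box_eq_sum_Omega\<close> applies.
\<close>

lemma Psi_mod_inversion:
  assumes "Im \<tau> > 0" "M > 0" "coprime (m + 1) M"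
    and \<epsilon>: "\<epsilon> \<in> {0, 1 / 2}" "\<epsilon>' \<in> {0, 1 / 2}"
    and j: "j = \<epsilon>' + real nj" and k: "k = \<epsilon>' + real nk"
    and z: "z \<notin> N2_poles \<epsilon>' \<epsilon> \<tau>"
  shows "Psi_mod M m s \<epsilon> j k (- 1 / \<tau>) (- (z / \<tau>)) (z / \<tau>) 0
    = \<tau> / of_nat M * e2pi (- (of_nat (m + 1) * z\<^sup>2 / (of_nat M * \<tau>)))
      * (\<Sum>(a, b)\<in>Omega M \<epsilon>.
          (e2pi (- (of_nat (m + 1) / of_nat M * (of_real b * of_real j + of_real a * of_real k)))
           - e2pi (of_nat (m + 1) / of_nat M * (of_real b * of_real k + of_real a * of_real j)))
          * Psi_mod M m s \<epsilon>' a b \<tau> (- z) z 0)"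
proof -
  define N where "N = m + 1"
  have N: "N > 0" "coprime N M" using assms(3) by (simp_all add: N_def)
  have tau: "\<tau> \<noteq> 0" using assms(1) by auto
  have im: "Im (- 1 / \<tau>) > 0" by (rule Im_inversion_pos[OF assms(1)])
  obtain r :: int where r: "of_int r = 2 * \<epsilon>"
    using \<epsilon>(1) by (metis insert_iff mult_zero_right nonzero_mult_div_cancel_left of_int_0 of_int_1 singletonD times_divide_eq_right zero_neq_numeral mult.right_neutral)
  obtain r' :: int where r': "of_int r' = 2 * \<epsilon>'"
    using \<epsilon>(2) by (metis insert_iff mult_zero_right nonzero_mult_div_cancel_left of_int_0 of_int_1 singletonD times_divide_eq_right zero_neq_numeral mult.right_neutral)
  define e e' J K :: complex where "e = of_real \<epsilon>" and "e' = of_real \<epsilon>'" and "J = of_real j" and "K = of_real k"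
  have re: "of_int r = 2 * e" "of_int r' = 2 * e'"
  proof -
    have "complex_of_real (of_int r) = of_real (2 * \<epsilon>)" "complex_of_real (of_int r') = of_real (2 * \<epsilon>')"
      by (simp_all only: r r')
    then show "of_int r = 2 * e" "of_int r' = 2 * e'" by (simp_all add: e_def e'_def)
  qed
  have J: "J = e' + of_int (int nj)" and K: "K = e' + of_int (int nk)"
    by (simp_all add: J_def K_def e'_def j k)
  have nlat: "- z + A * \<tau> + B \<notin> lat \<tau>" if "A = e + of_int a" "B = e' + of_int b" for A B a b
    using notin_lat_if_notin_N2_poles[OF z] that by (simp add: e_def e'_def)
  define X where "X A B = e2pi (- (of_nat N / of_nat M * (B * J + A * K))) - e2pi (of_nat N / of_nat M * (B * K + A * J))" for A B
  define Q where "Q A B = psi_half N M e' A B \<tau> z" for A B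
  define g where "g a b = X (of_int a + e) (of_int b + e) * Q (of_int a + e) (of_int b + e)" for a b :: int
  define f where "f = (\<lambda>(a, b). X (of_real a) (of_real b) * Psi_mod M m s \<epsilon>' a b \<tau> (- z) z 0)"
  let ?F = "\<tau> / of_nat M * e2pi (- (of_nat N * z\<^sup>2 / (of_nat M * \<tau>)))"
  have "Psi_mod M m s \<epsilon> j k (- 1 / \<tau>) (- (z / \<tau>)) (z / \<tau>) 0
      = psi_half N M e J K (- 1 / \<tau>) (z / \<tau>) - psi_half N M e (- K) (- J) (- 1 / \<tau>) (z / \<tau>)"
    unfolding N_def J_def K_def
  proof (rule Psi_mod_eq_psi_half[OF im assms(2)])
    show "2 * e = of_int r" by (simp add: re)
    show "e = of_real \<epsilon>" by (simp add: e_def)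
    have "- z + e * \<tau> + - J \<notin> lat \<tau>"
      by (rule nlat[of _ 0 _ "- r' - int nj"]) (simp_all add: J re)
    then have "(- z + e * \<tau> + - J) / \<tau> \<notin> lat (of_nat M * (- 1 / \<tau>))"
      using lat_mult_subset lat_inversion_iff[OF tau] by blast
    moreover have "(- z + e * \<tau> + - J) / \<tau> = - (z / \<tau>) + complex_of_real j * (- 1 / \<tau>) + e"
      using tau by (simp add: J_def field_simps)
    ultimately show "- (z / \<tau>) + complex_of_real j * (- 1 / \<tau>) + e \<notin> lat (of_nat M * (- 1 / \<tau>))"
      by (simp only:) simp
    have "- z + (- e) * \<tau> + K \<notin> lat \<tau>"
      by (rule nlat[of _ "- r" _ "int nk"]) (simp_all add: K re)
    then have "(- z + (- e) * \<tau> + K) / \<tau> \<notin> lat (of_nat M * (- 1 / \<tau>))"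
      using lat_mult_subset lat_inversion_iff[OF tau] by blast
    moreover have "(- z + (- e) * \<tau> + K) / \<tau> = - (z / \<tau>) - complex_of_real k * (- 1 / \<tau>) - e"
      using tau by (simp add: K_def field_simps)
    ultimately show "- (z / \<tau>) - complex_of_real k * (- 1 / \<tau>) - e \<notin> lat (of_nat M * (- 1 / \<tau>))"
      by (simp only:) simp
  qed
  also have "psi_half N M e J K (- 1 / \<tau>) (z / \<tau>) = ?F * (\<Sum>a\<in>{0..<int M}. \<Sum>b\<in>{0..<int M}.
      e2pi (- (of_nat N / of_nat M * ((of_int b + e) * J + (of_int a + e) * K))) * Q (of_int a + e) (of_int b + e))"
    unfolding Q_def
  proof (rule psi_half_inversion[OF assms(1) N(1) assms(2) N(2), where r = "- r' - int nj" and r' = "- r' - int nk"])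
    have "- z + e * \<tau> + - J \<notin> lat \<tau>"
      by (rule nlat[of _ 0 _ "- r' - int nj"]) (simp_all add: J re)
    then show "- z - J + e * \<tau> \<notin> lat \<tau>" by (simp add: algebra_simps)
  qed (simp_all add: J K re)
  also have "psi_half N M e (- K) (- J) (- 1 / \<tau>) (z / \<tau>) = ?F * (\<Sum>a\<in>{0..<int M}. \<Sum>b\<in>{0..<int M}.
      e2pi (- (of_nat N / of_nat M * ((of_int b + e) * (- K) + (of_int a + e) * (- J)))) * Q (of_int a + e) (of_int b + e))"
    unfolding Q_def
  proof (rule psi_half_inversion[OF assms(1) N(1) assms(2) N(2), where r = "int nk" and r' = "int nj"])
    have "- z + e * \<tau> + K \<notin> lat \<tau>"
      by (rule nlat[of _ 0 _ "int nk"]) (simp_all add: K)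
    then show "- z - (- K) + e * \<tau> \<notin> lat \<tau>" by (simp add: algebra_simps)
  qed (simp_all add: J K)
  also have "?F * (\<Sum>a\<in>{0..<int M}. \<Sum>b\<in>{0..<int M}.
      e2pi (- (of_nat N / of_nat M * ((of_int b + e) * J + (of_int a + e) * K))) * Q (of_int a + e) (of_int b + e))
    - ?F * (\<Sum>a\<in>{0..<int M}. \<Sum>b\<in>{0..<int M}.
      e2pi (- (of_nat N / of_nat M * ((of_int b + e) * (- K) + (of_int a + e) * (- J)))) * Q (of_int a + e) (of_int b + e))
    = ?F * (\<Sum>a\<in>{0..<int M}. \<Sum>b\<in>{0..<int M}. g a b)"
  proof -
    have "- (of_nat N / of_nat M * (B * (- K) + A * (- J))) = of_nat N / of_nat M * (B * K + A * J)" for A B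
      by (simp add: algebra_simps)
    then show ?thesis
      by (simp only: g_def X_def left_diff_distrib sum_subtractf right_diff_distrib)
  qed
  also have "(\<Sum>a\<in>{0..<int M}. \<Sum>b\<in>{0..<int M}. g a b) = (\<Sum>ab\<in>Omega M \<epsilon>. f ab)"
  proof (rule sum_box_eq_sum_Omega[OF assms(2) \<epsilon>(1) r])
    fix a b u v :: int
    have zl: "- z + (of_int a + e) * \<tau> + e' \<notin> lat (of_nat M * \<tau>)"
      using nlat[of "of_int a + e" a e' 0] lat_mult_subset by (auto simp: add.commute)
    have sh: "of_int (a + int M * u) + e = of_int a + e + of_nat M * of_int u"
      "of_int (b + int M * v) + e = of_int b + e + of_nat M * of_int v"
      by simp_all
    have 1: "e2pi (- (of_nat N / of_nat M * ((of_int b + e + of_nat M * of_int v) * J + (of_int a + e + of_nat M * of_int u) * K)))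
        * e2pi (- (of_nat N * of_int (u + v) * e')) = e2pi (- (of_nat N / of_nat M * ((of_int b + e) * J + (of_int a + e) * K)))"
      unfolding e2pi_add[symmetric]
    proof (rule e2pi_eqI)
      have "of_nat N / of_nat M * ((of_int b + e + of_nat M * of_int v) * J + (of_int a + e + of_nat M * of_int u) * K)
          = of_nat N / of_nat M * ((of_int b + e) * J + (of_int a + e) * K) + of_nat N * (of_int v * J + of_int u * K)"
        using assms(2) by (simp add: field_simps)
      then show "- (of_nat N / of_nat M * ((of_int b + e + of_nat M * of_int v) * J + (of_int a + e + of_nat M * of_int u) * K))
            + - (of_nat N * of_int (u + v) * e')
          = - (of_nat N / of_nat M * ((of_int b + e) * J + (of_int a + e) * K))
            + of_int (- int N * (v * (r' + int nj) + u * (r' + int nk)))"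
        by (simp only:) (simp add: J K re algebra_simps)
    qed
    have 2: "e2pi (of_nat N / of_nat M * ((of_int b + e + of_nat M * of_int v) * K + (of_int a + e + of_nat M * of_int u) * J))
        * e2pi (- (of_nat N * of_int (u + v) * e')) = e2pi (of_nat N / of_nat M * ((of_int b + e) * K + (of_int a + e) * J))"
      unfolding e2pi_add[symmetric]
    proof (rule e2pi_eqI)
      have "of_nat N / of_nat M * ((of_int b + e + of_nat M * of_int v) * K + (of_int a + e + of_nat M * of_int u) * J)
          = of_nat N / of_nat M * ((of_int b + e) * K + (of_int a + e) * J) + of_nat N * (of_int v * K + of_int u * J)"
        using assms(2) by (simp add: field_simps)
      then show "of_nat N / of_nat M * ((of_int b + e + of_nat M * of_int v) * K + (of_int a + e + of_nat M * of_int u) * J)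
            + - (of_nat N * of_int (u + v) * e')
          = of_nat N / of_nat M * ((of_int b + e) * K + (of_int a + e) * J) + of_int (int N * (v * int nk + u * int nj))"
        by (simp only:) (simp add: J K algebra_simps)
    qed
    have "X (of_int a + e + of_nat M * of_int u) (of_int b + e + of_nat M * of_int v) * e2pi (- (of_nat N * of_int (u + v) * e'))
        = X (of_int a + e) (of_int b + e)"
      unfolding X_def left_diff_distrib 1 2 ..
    from arg_cong[OF this, of "\<lambda>x. x * Q (of_int a + e) (of_int b + e)"]
    show "g (a + int M * u) (b + int M * v) = g a b"
      unfolding g_def sh Q_def psi_half_mod[OF assms(1) N(1) assms(2) zl] by (simp only: mult.assoc)
  next
    fix a b assume "int M dvd a + b + r"
    then obtain l where l: "a + b + r = int M * l" by blast
    define A B where "A = of_int a + e" and "B = of_int b + e"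
    have "A + B = of_int (a + b + r)"
      by (simp add: A_def B_def re)
    then have B: "B = of_nat M * of_int l - A"
      unfolding l by (simp add: algebra_simps)
    have "e2pi (- (of_nat N / of_nat M * (B * J + A * K))) = e2pi (of_nat N / of_nat M * (B * K + A * J))"
    proof (rule e2pi_eqI)
      show "- (of_nat N / of_nat M * (B * J + A * K))
        = of_nat N / of_nat M * (B * K + A * J) + of_int (- (int N * l * (r' + int nj + int nk)))"
        unfolding B using assms(2) by (simp add: J K re field_simps)
    qed
    then show "g a b = 0"
      by (simp add: g_def X_def A_def B_def)
  next
    fix a b :: int
    define A B where "A = of_int a + e" and "B = of_int b + e"
    have AB: "of_int (- b - r) + e = - B" "of_int (- a - r) + e = - A"
      by (simp_all add: A_def B_def re)
    have AB': "complex_of_real (of_int a + \<epsilon>) = A" "complex_of_real (of_int b + \<epsilon>) = B"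
      by (simp_all add: A_def B_def e_def)
    have 1: "Psi_mod M m s \<epsilon>' (of_int a + \<epsilon>) (of_int b + \<epsilon>) \<tau> (- z) z 0 = Q A B - Q (- B) (- A)"
      unfolding Q_def N_def AB'[symmetric]
    proof (rule Psi_mod_eq_psi_half[OF assms(1,2)])
      show "2 * e' = of_int r'" by (simp add: re)
      show "e' = of_real \<epsilon>'" by (simp add: e'_def)
      show "- z + complex_of_real (of_int a + \<epsilon>) * \<tau> + e' \<notin> lat (of_nat M * \<tau>)"
        using nlat[of A a e' 0] lat_mult_subset unfolding AB' by (auto simp: A_def add.commute)
      have "- z + (- B) * \<tau> + - e' \<notin> lat \<tau>"
        by (rule nlat[of _ "- b - r" _ "- r'"]) (simp_all add: B_def re)
      then show "- z - complex_of_real (of_int b + \<epsilon>) * \<tau> - e' \<notin> lat (of_nat M * \<tau>)"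
        using lat_mult_subset unfolding AB' by auto
    qed
    have 2: "X (- B) (- A) = - X A B"
      by (simp add: X_def algebra_simps)
    show "f (of_int a + \<epsilon>, of_int b + \<epsilon>) = g a b + g (- b - r) (- a - r)"
      unfolding f_def g_def AB prod.case AB' A_def[symmetric] B_def[symmetric] 1 2 by (simp add: algebra_simps)
  qed
  finally show ?thesis
    unfolding f_def X_def N_def J_def K_def .
qed

theorem theorem4p1:
  fixes M m s :: nat and c \<epsilon> \<epsilon>' j k :: real and \<tau> z :: complex
  assumes "M \<ge> 2"
    and "m > 0 \<Longrightarrow> gcd M (2 * m + 2) = 1"
    and "c = 3 * (1 - (2 * real m + 2) / real M)"
    and "s \<le> m"
    and "\<epsilon> \<in> {0, 1 / 2}" and "\<epsilon>' \<in> {0, 1 / 2}"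
    and "(j, k) \<in> Omega M \<epsilon>'"
    and "Im \<tau> > 0"
  shows "(z \<notin> N2_poles \<epsilon>' \<epsilon> \<tau> \<and> z / \<tau> \<notin> N2_poles \<epsilon> \<epsilon>' (- 1 / \<tau>) \<longrightarrow>
           N2_ch M m s \<epsilon> j k \<epsilon>' (- 1 / \<tau>) (z / \<tau>) =
             exp (of_real pi * \<i> * of_real c / (3 * \<tau>) * z\<^sup>2)
             * (\<Sum>(a, b)\<in>Omega M \<epsilon>. S_matrix M m \<epsilon> \<epsilon>' (j, k) (a, b) * N2_ch M m s \<epsilon>' a b \<epsilon> \<tau> z))
       \<and> (z \<notin> N2_poles \<epsilon> \<epsilon>' (\<tau> + 1) \<and> z \<notin> N2_poles \<bar>\<epsilon> - \<epsilon>'\<bar> \<epsilon>' \<tau> \<longrightarrow>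
           N2_ch M m s \<epsilon> j k \<epsilon>' (\<tau> + 1) z =
             exp (2 * of_real pi * \<i> * of_nat (m + 1) / of_nat M * of_real (j * k)
                  - of_real pi * \<i> * of_real \<epsilon>' / 2)
             * N2_ch M m s \<bar>\<epsilon> - \<epsilon>'\<bar> j k \<epsilon>' \<tau> z)"
proof -
  have M: "M > 0" using assms(1) by simp
  have tau: "\<tau> \<noteq> 0" using assms(8) by auto
  have cop: "coprime (m + 1) M"
  proof (cases "m > 0")
    case True
    have "coprime M (2 * (m + 1))"
      using assms(2)[OF True] by (simp add: coprime_iff_gcd_eq_1)
    then have "coprime M (m + 1)"
      by (simp only: coprime_mult_right_iff)
    then show ?thesis
      by (simp only: coprime_commute)
  qed simp
  obtain nj nk :: nat where j: "j = \<epsilon>' + real nj" and k: "k = \<epsilon>' + real nk"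
    using assms(7) unfolding Omega_def by auto
  obtain p p' :: int where p: "1 - 2 * \<epsilon> = of_int p" "1 - 2 * \<epsilon>' = of_int p'"
  proof
    show "1 - 2 * \<epsilon> = of_int (if \<epsilon> = 0 then 1 else 0)" "1 - 2 * \<epsilon>' = of_int (if \<epsilon>' = 0 then 1 else 0)"
      using assms(5,6) by auto
  qed
  let ?X = "\<lambda>a b. e2pi (- (of_nat (m + 1) / of_nat M * (of_real b * of_real j + of_real a * of_real k)))
           - e2pi (of_nat (m + 1) / of_nat M * (of_real b * of_real k + of_real a * of_real j))"
  let ?\<Psi> = "\<lambda>a b. Psi_mod M m s \<epsilon>' a b \<tau> (- z) z 0"
  let ?D = "N2_denom \<epsilon>' \<epsilon> \<tau> z"
  have S: "N2_ch M m s \<epsilon> j k \<epsilon>' (- 1 / \<tau>) (z / \<tau>) =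
             exp (of_real pi * \<i> * of_real c / (3 * \<tau>) * z\<^sup>2)
             * (\<Sum>(a, b)\<in>Omega M \<epsilon>. S_matrix M m \<epsilon> \<epsilon>' (j, k) (a, b) * N2_ch M m s \<epsilon>' a b \<epsilon> \<tau> z)"
    if z: "z \<notin> N2_poles \<epsilon>' \<epsilon> \<tau>"
  proof -
    define E where "E = e2pi (of_int (p * p') / 4)"
    define Y where "Y = e2pi (- (of_nat (m + 1) * z\<^sup>2 / (of_nat M * \<tau>)))"
    define U where "U = e2pi (- (z\<^sup>2 / (2 * \<tau>)))"
    define R where "R = (\<Sum>(a, b)\<in>Omega M \<epsilon>. ?X a b * ?\<Psi> a b)"
    have "N2_ch M m s \<epsilon> j k \<epsilon>' (- 1 / \<tau>) (z / \<tau>) = (\<tau> / of_nat M * Y * R) / (- \<i> * \<tau> * U * E * ?D)"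
      unfolding N2_ch_def Psi_mod_inversion[OF assms(8) M cop assms(5,6) j k z] N2_denom_inversion[OF assms(8) p]
        E_def Y_def U_def R_def ..
    also have "\<dots> = (Y / U) * (inverse E * (\<i> / of_nat M) * (R / ?D))"
      using tau M by (cases "?D = 0") (simp_all add: E_def U_def field_simps)
    also have "Y / U = exp (of_real pi * \<i> * of_real c / (3 * \<tau>) * z\<^sup>2)"
      unfolding Y_def U_def e2pi_diff[symmetric] unfolding e2pi_def assms(3) using tau M
      by (intro arg_cong[of _ _ exp]) (simp add: field_simps)
    also have "inverse E * (\<i> / of_nat M) * (R / ?D)
        = (\<Sum>(a, b)\<in>Omega M \<epsilon>. S_matrix M m \<epsilon> \<epsilon>' (j, k) (a, b) * N2_ch M m s \<epsilon>' a b \<epsilon> \<tau> z)"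
      unfolding S_matrix_eq[OF assms(5,6) p M] N2_ch_def R_def e2pi_minus E_def[symmetric]
        sum_divide_distrib sum_distrib_left case_prod_unfold by (simp only: times_divide_eq_right mult.assoc)
    finally show ?thesis .
  qed
  have T: "N2_ch M m s \<epsilon> j k \<epsilon>' (\<tau> + 1) z =
             exp (2 * of_real pi * \<i> * of_nat (m + 1) / of_nat M * of_real (j * k)
                  - of_real pi * \<i> * of_real \<epsilon>' / 2)
             * N2_ch M m s \<bar>\<epsilon> - \<epsilon>'\<bar> j k \<epsilon>' \<tau> z"
  proof -
    have "exp (2 * of_real pi * \<i> * of_nat (m + 1) / of_nat M * of_real (j * k) - of_real pi * \<i> * of_real \<epsilon>' / 2)
        = e2pi (of_nat (m + 1) / of_nat M * of_real (j * k)) / e2pi (of_real \<epsilon>' / 4)"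
      unfolding e2pi_diff[symmetric] unfolding e2pi_def
      by (rule arg_cong[of _ _ exp]) (simp add: algebra_simps)
    then show ?thesis
      unfolding N2_ch_def Psi_mod_add_1[OF assms(8) M assms(5,6) j k] N2_denom_add_1[OF assms(5,6)] by simp
  qed
  show ?thesis
    using S T by blast
qed

end
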